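(* Let $\mathbb{G}$ and $\mathbb{H}$ be two graph products of finite abelian groups with underlying marked graphs $\mathcal{G}$ and $\mathcal{H}$, respectively. The following are equivalent: \begin{itemize} \item the marked graphs $\mathcal{G}$ and $\mathcal{H}$ are isomorphic; \item the groups $\mathbb{G}$ and $\mathbb{H}$ are isomorphic; \item the groups $\mathbb{G}$ and $\mathbb{H}$ are elementarily equivalent; \item the groups $\mathbb{G}$ and $\mathbb{H}$ are $\exists\forall$-equivalent. \end{itemize}
   Context: Graph products. Let $\mathcal{G}_0$ be a finite, undirected, simplicial graph with vertices $v_1,\dots,v_k$, and let $A_i=\langle X_i\mid R_i\rangle$, $i=1,\dots,k$, be groups. The graph product of $A_1,\dots,A_k$ with respect to $\mathcal{G}_0$ is the group with presentation $\langle X_1,\dots,X_k\mid R_1,\dots,R_k,\mathcal{R}\rangle$, where $\mathcal{R}=\{[X_i,X_j]\mid v_i \text{ and } v_j \text{ are adjacent in } \mathcal{G}_0\}$ (that is, $A_i$ and $A_j$ commute elementwise when $v_i,v_j$ are adjacent). Marked graphs. Suppose all $A_i$ are finite abelian. Write $A_i=G_{i,1}\times\dots\times G_{i,r_i}$ with each $G_{i,j}$ cyclic of prime power order $p_{i,j}^{n_{i,j}}$ ($p_{i,j}$ prime, $n_{i,j}\ge 1$); this decomposition is unique up to permutation of the factors. The marked graph $\mathcal{G}$ of the graph product is obtained from $\mathcal{G}_0$ by replacing each vertex $v_i$ by vertices $v_{i,1},\dots,v_{i,r_i}$, pairwise joined by edges, and joining $v_{i,l_1}$ and $v_{j,l_2}$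 by an edge for all $l_1,l_2$ whenever $v_i,v_j$ are adjacent in $\mathcal{G}_0$. The vertex $v_{i,j}$ is marked (labelled) by the number $p_{i,j}^{n_{i,j}}$. The graph product of the cyclic groups $G_{i,j}$ with respect to $\mathcal{G}$ is isomorphic to the original graph product. So every graph product of finite abelian groups is regarded as given by a marked graph: a finite simplicial graph whose vertices are labelled by prime powers $p^n$, $n\ge 1$, the vertex group at a vertex labelled $p^n$ being cyclic of order $p^n$. Two marked graphs are isomorphic if there is a graph isomorphism between them that preserves the labels. Logic. The first-order language of groups consists of symbols for multiplication $\cdot$, inversion $^{-1}$ and the identity $1$ (no constants from the groups). Two groups are elementarily equivalent if they satisfy the same first-order sentences in this language. An $\exists\forall$-sentence is a sentence of the form $\exists x_1\dots\exists x_a\forall y_1\dots\forall y_b\,\Psi(x_1,\dots,x_a,y_1,\dots,y_b)$ with $\Psi$ quantifier-free. Two groups are $\exists\forall$-equivalent if they satisfy the same $\exists\forall$-sentences. *)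

theory Defs
  imports "HOL-Algebra.Product_Groups" "HOL-Number_Theory.Prime_Powers"
begin

section \<open>Group presentations\<close>

text \<open>A letter \<open>(x, True)\<close> stands for the generator \<open>x\<close> and \<open>(x, False)\<close> for its formal inverse.\<close>

type_synonym 'x word = "('x \<times> bool) list"

definition words :: "'x set \<Rightarrow> 'x word set" where
  "words X = lists (X \<times> UNIV)"

definition inv_word :: "'x word \<Rightarrow> 'x word" where
  "inv_word w = rev (map (\<lambda>(x, s). (x, \<not> s)) w)"

text \<open>Equality of words in the group with generators \<open>X\<close> and relators \<open>R \<subseteq> words X\<close>:
  the least congruence on \<open>words X\<close> that makes all relators and all words
  \<open>x x\<^sup>-\<^sup>1\<close>, \<open>x\<^sup>-\<^sup>1 x\<close> trivial.\<close>

inductive pres_eq :: "'x set \<Rightarrow> 'x word set \<Rightarrow> 'x word \<Rightarrow> 'x word \<Rightarrow> bool"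
  for X R where
  refl: "w \<in> words X \<Longrightarrow> pres_eq X R w w"
| sym: "pres_eq X R u v \<Longrightarrow> pres_eq X R v u"
| trans: "pres_eq X R u v \<Longrightarrow> pres_eq X R v w \<Longrightarrow> pres_eq X R u w"
| cancel: "u \<in> words X \<Longrightarrow> v \<in> words X \<Longrightarrow> x \<in> X \<Longrightarrow>
    pres_eq X R (u @ [(x, s), (x, \<not> s)] @ v) (u @ v)"
| relator: "u \<in> words X \<Longrightarrow> v \<in> words X \<Longrightarrow> r \<in> R \<Longrightarrow>
    pres_eq X R (u @ r @ v) (u @ v)"

definition pres_class :: "'x set \<Rightarrow> 'x word set \<Rightarrow> 'x word \<Rightarrow> 'x word set" where
  "pres_class X R w = {w'. pres_eq X R w w'}"

definition presented_group :: "'x set \<Rightarrow> 'x word set \<Rightarrow> 'x word set monoid" where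
  "presented_group X R =
    \<lparr>carrier = pres_class X R ` words X,
     monoid.mult = (\<lambda>C D. {w. \<exists>u\<in>C. \<exists>v\<in>D. pres_eq X R (u @ v) w}),
     one = pres_class X R []\<rparr>"

section \<open>Graphs and graph products\<close>

definition simple_graph :: "'v set \<Rightarrow> ('v \<times> 'v) set \<Rightarrow> bool" where
  "simple_graph V E \<longleftrightarrow> finite V \<and> E \<subseteq> V \<times> V \<and> Relation.sym E \<and> irrefl E"

text \<open>Each vertex group \<open>A i\<close> is presented by its multiplication table: the generators are all
  its elements and the relators are the words \<open>a b (ab)\<^sup>-\<^sup>1\<close>. Any other presentations of the
  vertex groups yield an isomorphic graph product.\<close>

definition graph_product_gens :: "'v set \<Rightarrow> ('v \<Rightarrow> 'a monoid) \<Rightarrow> ('v \<times> 'a) set" where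
  "graph_product_gens V A = (SIGMA i:V. carrier (A i))"

definition vertex_relators :: "'v \<Rightarrow> 'a monoid \<Rightarrow> ('v \<times> 'a) word set" where
  "vertex_relators i G =
    {[((i, a), True), ((i, b), True), ((i, a \<otimes>\<^bsub>G\<^esub> b), False)] | a b.
       a \<in> carrier G \<and> b \<in> carrier G}"

definition commutator_word :: "'x \<Rightarrow> 'x \<Rightarrow> 'x word" where
  "commutator_word x y = [(x, True), (y, True)] @ inv_word [(y, True), (x, True)]"

definition commutator_relators ::
    "('v \<times> 'v) set \<Rightarrow> ('v \<Rightarrow> 'a monoid) \<Rightarrow> ('v \<times> 'a) word set" where
  "commutator_relators E A =
    {commutator_word (i, a) (j, b) | i j a b.
       (i, j) \<in> E \<and> a \<in> carrier (A i) \<and> b \<in> carrier (A j)}"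

definition graph_product ::
    "'v set \<Rightarrow> ('v \<times> 'v) set \<Rightarrow> ('v \<Rightarrow> 'a monoid) \<Rightarrow> ('v \<times> 'a) word set monoid" where
  "graph_product V E A =
    presented_group (graph_product_gens V A)
      ((\<Union>i\<in>V. vertex_relators i (A i)) \<union> commutator_relators E A)"

section \<open>Marked graphs\<close>

record 'v marked_graph =
  verts :: "'v set"
  edges :: "('v \<times> 'v) set"
  mark :: "'v \<Rightarrow> nat"

definition marked_graph_iso :: "'v marked_graph \<Rightarrow> 'w marked_graph \<Rightarrow> bool" where
  "marked_graph_iso M N \<longleftrightarrow>
    (\<exists>f. bij_betw f (verts M) (verts N) \<and>
         (\<forall>x\<in>verts M. \<forall>y\<in>verts M. (x, y) \<in> edges M \<longleftrightarrow> (f x, f y) \<in> edges N) \<and>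
         (\<forall>x\<in>verts M. mark N (f x) = mark M x))"

text \<open>The list \<open>qs\<close> contains, in some order and with multiplicity, the orders of the cyclic factors
  in a decomposition of \<open>G\<close> as a direct product of cyclic groups of prime power order. It is empty
  if \<open>G\<close> is trivial.\<close>

definition primary_decomposition :: "'a monoid \<Rightarrow> nat list \<Rightarrow> bool" where
  "primary_decomposition G qs \<longleftrightarrow>
    (\<forall>q\<in>set qs. primepow q) \<and>
    G \<cong> product_group {..<length qs} (\<lambda>j. integer_mod_group (qs ! j))"

text \<open>The vertex \<open>i\<close> is blown up to a clique of vertices \<open>(i, j)\<close>, one for each entry of \<open>qs i\<close>.\<close>

definition marked_graph_of ::
    "'v set \<Rightarrow> ('v \<times> 'v) set \<Rightarrow> ('v \<Rightarrow> nat list) \<Rightarrow> ('v \<times> nat) marked_graph" where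
  "marked_graph_of V E qs =
    (let U = (SIGMA i:V. {..<length (qs i)}) in
    \<lparr>verts = U,
     edges = {((i, k), (j, l)) | i k j l.
       (i, k) \<in> U \<and> (j, l) \<in> U \<and> ((i = j \<and> k \<noteq> l) \<or> (i, j) \<in> E)},
     mark = (\<lambda>(i, j). qs i ! j)\<rparr>)"

section \<open>First-order logic of groups\<close>

datatype gterm =
    Var nat
  | One
  | Inv gterm
  | Mult gterm gterm

datatype gform =
    Eq gterm gterm
  | Neg gform
  | Conj gform gform
  | Disj gform gform
  | Exists nat gform
  | Forall nat gform

fun term_val :: "'a monoid \<Rightarrow> (nat \<Rightarrow> 'a) \<Rightarrow> gterm \<Rightarrow> 'a" where
  "term_val G e (Var n) = e n"
| "term_val G e One = \<one>\<^bsub>G\<^esub>"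
| "term_val G e (Inv t) = inv\<^bsub>G\<^esub> (term_val G e t)"
| "term_val G e (Mult s t) = term_val G e s \<otimes>\<^bsub>G\<^esub> term_val G e t"

fun holds :: "'a monoid \<Rightarrow> (nat \<Rightarrow> 'a) \<Rightarrow> gform \<Rightarrow> bool" where
  "holds G e (Eq s t) \<longleftrightarrow> term_val G e s = term_val G e t"
| "holds G e (Neg \<phi>) \<longleftrightarrow> \<not> holds G e \<phi>"
| "holds G e (Conj \<phi> \<psi>) \<longleftrightarrow> holds G e \<phi> \<and> holds G e \<psi>"
| "holds G e (Disj \<phi> \<psi>) \<longleftrightarrow> holds G e \<phi> \<or> holds G e \<psi>"
| "holds G e (Exists n \<phi>) \<longleftrightarrow> (\<exists>a\<in>carrier G. holds G (e(n := a)) \<phi>)"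
| "holds G e (Forall n \<phi>) \<longleftrightarrow> (\<forall>a\<in>carrier G. holds G (e(n := a)) \<phi>)"

fun term_vars :: "gterm \<Rightarrow> nat set" where
  "term_vars (Var n) = {n}"
| "term_vars One = {}"
| "term_vars (Inv t) = term_vars t"
| "term_vars (Mult s t) = term_vars s \<union> term_vars t"

fun free_vars :: "gform \<Rightarrow> nat set" where
  "free_vars (Eq s t) = term_vars s \<union> term_vars t"
| "free_vars (Neg \<phi>) = free_vars \<phi>"
| "free_vars (Conj \<phi> \<psi>) = free_vars \<phi> \<union> free_vars \<psi>"
| "free_vars (Disj \<phi> \<psi>) = free_vars \<phi> \<union> free_vars \<psi>"
| "free_vars (Exists n \<phi>) = free_vars \<phi> - {n}"
| "free_vars (Forall n \<phi>) = free_vars \<phi> - {n}"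

fun quantifier_free :: "gform \<Rightarrow> bool" where
  "quantifier_free (Eq s t) \<longleftrightarrow> True"
| "quantifier_free (Neg \<phi>) \<longleftrightarrow> quantifier_free \<phi>"
| "quantifier_free (Conj \<phi> \<psi>) \<longleftrightarrow> quantifier_free \<phi> \<and> quantifier_free \<psi>"
| "quantifier_free (Disj \<phi> \<psi>) \<longleftrightarrow> quantifier_free \<phi> \<and> quantifier_free \<psi>"
| "quantifier_free (Exists n \<phi>) \<longleftrightarrow> False"
| "quantifier_free (Forall n \<phi>) \<longleftrightarrow> False"

definition sentence :: "gform \<Rightarrow> bool" where
  "sentence \<phi> \<longleftrightarrow> free_vars \<phi> = {}"

definition exists_forall_sentence :: "gform \<Rightarrow> bool" where
  "exists_forall_sentence \<phi> \<longleftrightarrow> sentence \<phi> \<and>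
    (\<exists>xs ys \<psi>. distinct (xs @ ys) \<and> quantifier_free \<psi> \<and>
       \<phi> = foldr Exists xs (foldr Forall ys \<psi>))"

text \<open>The truth value of a sentence does not depend on the assignment, so any will do.\<close>

definition satisfies :: "'a monoid \<Rightarrow> gform \<Rightarrow> bool" where
  "satisfies G \<phi> \<longleftrightarrow> holds G (\<lambda>_. \<one>\<^bsub>G\<^esub>) \<phi>"

definition elementarily_equivalent :: "'a monoid \<Rightarrow> 'b monoid \<Rightarrow> bool" where
  "elementarily_equivalent G H \<longleftrightarrow>
    (\<forall>\<phi>. sentence \<phi> \<longrightarrow> (satisfies G \<phi> \<longleftrightarrow> satisfies H \<phi>))"

definition exists_forall_equivalent :: "'a monoid \<Rightarrow> 'b monoid \<Rightarrow> bool" where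
  "exists_forall_equivalent G H \<longleftrightarrow>
    (\<forall>\<phi>. exists_forall_sentence \<phi> \<longrightarrow> (satisfies G \<phi> \<longleftrightarrow> satisfies H \<phi>))"

end

(*
  A sentence of the form "exists x, for all y" can describe conjugacy classes of elements of finite
  order: finitely many pairwise non-conjugate elements x_i, the orders of the x_i, and, by means of
  further existential witnesses, which pairs of classes have commuting representatives. In a graph
  product of finite cyclic groups each element of finite order is conjugate into the subgroup of
  a clique, where it is determined up to conjugacy by its image in the abelianization. So there are
  finitely many such classes, they correspond to the vectors over the marked graph with clique
  support, and two classes have commuting representatives iff the union of their supports is
  a clique. If the two groups satisfy the same sentences of this form, counting in both directions
  yields a bijection of classes that preserves orders and the commutation relation.

  The marked graph is recovered as follows. For a vector t let D(t) be the set of all b such that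
  every class commuting with t also commutes with b. Then D(t) is the product of the vertex groups
  over the set of those v whose unit vector e_v has D(e_v) contained in D(t), and so the number of its
  elements annihilated by d is the product of gcd(d, q_v) over these v. Induction along inclusion
  shows that for every D the product of gcd(d, q_v) over the v with D(e_v) = D is an
  invariant; as d varies it determines the prime powers q_v with multiplicity. Distinct vertices v, w
  are adjacent iff D(e_v) and D(e_w) commute elementwise, so any label-preserving bijection between
  the vertices with corresponding D is an isomorphism of marked graphs.
*)

theory Submission
  imports Defs "HOL-Algebra.Bij"
begin


section \<open>Presented groups\<close>

text \<open>The bijection of classes respects orders and compatibility but not the group structure,
  and it need not send unit vectors to unit vectors: two vectors with the same support and the same
  order cannot be told apart by these data. So vertices are never matched directly. D(t) is useful
  because it is defined by compatibility alone and contains, with a vector, all vectors of smaller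
  support; this makes it a product of whole vertex groups, in which elements of a given exponent can
  be counted. One universally quantified variable suffices. It expresses non-conjugacy, whereas
  non-commutation is never asserted but recovered by counting pairs. Finite order costs no
  quantifier, since one fixed exponent, a common multiple of all marks, kills every chosen element.
  The group-theoretic core is that nonempty reduced words represent nontrivial elements. It comes
  from an action of the graph product on stacks of beads, which replaces a confluence proof for
  rewriting modulo shuffling.\<close>

locale presentation =
  fixes X :: "'x set" and R :: "'x word set"
  assumes relators_words: "R \<subseteq> words X"
begin

abbreviation "cls \<equiv> pres_class X R"
abbreviation "PG \<equiv> presented_group X R"

lemma words_simps [simp]:
  "[] \<in> words X" "x # w \<in> words X \<longleftrightarrow> fst x \<in> X \<and> w \<in> words X"
  "u @ v \<in> words X \<longleftrightarrow> u \<in> words X \<and> v \<in> words X"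
  by (cases x; auto simp: words_def)+

lemma pres_eq_words: "pres_eq X R u v \<Longrightarrow> u \<in> words X \<and> v \<in> words X"
  by (induction rule: pres_eq.induct) (use relators_words in auto)

lemma pres_eq_append_right:
  "pres_eq X R u v \<Longrightarrow> w \<in> words X \<Longrightarrow> pres_eq X R (u @ w) (v @ w)"
proof (induction rule: pres_eq.induct)
  case (cancel u v x s)
  then show ?case using pres_eq.cancel[of u X "v @ w" x R s] by simp
next
  case (relator u v r)
  then show ?case using pres_eq.relator[of u X "v @ w" r R] by simp
qed (auto intro: pres_eq.intros)

lemma pres_eq_append_left:
  "pres_eq X R u v \<Longrightarrow> w \<in> words X \<Longrightarrow> pres_eq X R (w @ u) (w @ v)"
proof (induction rule: pres_eq.induct)
  case (cancel u v x s)
  then show ?case using pres_eq.cancel[of "w @ u" X v x R s] by simp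
next
  case (relator u v r)
  then show ?case using pres_eq.relator[of "w @ u" X v r R] by simp
qed (auto intro: pres_eq.intros)

lemma pres_eq_append:
  "pres_eq X R u u' \<Longrightarrow> pres_eq X R v v' \<Longrightarrow> pres_eq X R (u @ v) (u' @ v')"
  by (meson pres_eq.trans pres_eq_append_left pres_eq_append_right pres_eq_words)

lemma cls_eq_iff: "u \<in> words X \<Longrightarrow> v \<in> words X \<Longrightarrow> cls u = cls v \<longleftrightarrow> pres_eq X R u v"
  unfolding pres_class_def set_eq_iff mem_Collect_eq by (metis pres_eq.intros(1-3))

lemma carrier_PG: "carrier PG = cls ` words X"
  and one_PG: "\<one>\<^bsub>PG\<^esub> = cls []"
  by (simp_all add: presented_group_def)

lemma mult_PG:
  assumes "u \<in> words X" "v \<in> words X"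
  shows "cls u \<otimes>\<^bsub>PG\<^esub> cls v = cls (u @ v)"
proof -
  have "cls u \<otimes>\<^bsub>PG\<^esub> cls v
      = {w. \<exists>u'. pres_eq X R u u' \<and> (\<exists>v'. pres_eq X R v v' \<and> pres_eq X R (u' @ v') w)}"
    by (auto simp: presented_group_def pres_class_def)
  also have "\<dots> = cls (u @ v)"
    unfolding pres_class_def set_eq_iff mem_Collect_eq
    using assms by (metis pres_eq.intros(1-3) pres_eq_append)
  finally show ?thesis .
qed

lemma inv_word_words: "w \<in> words X \<Longrightarrow> inv_word w \<in> words X"
  by (auto simp: words_def inv_word_def in_lists_conv_set)

lemma pres_eq_inv_word: "w \<in> words X \<Longrightarrow> pres_eq X R (inv_word w @ w) []"
proof (induction w)
  case Nil
  then show ?case by (simp add: inv_word_def pres_eq.refl)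
next
  case (Cons x w)
  obtain y s where x: "x = (y, s)" by force
  have "pres_eq X R (inv_word w @ [(y, \<not> s), (y, \<not> \<not> s)] @ w) (inv_word w @ w)"
    using Cons.prems x by (intro pres_eq.cancel inv_word_words) auto
  moreover have "inv_word (x # w) @ x # w = inv_word w @ [(y, \<not> s), (y, \<not> \<not> s)] @ w"
    by (simp add: x inv_word_def)
  ultimately show ?case
    using Cons by (metis pres_eq.trans words_simps(2))
qed

lemma group_PG: "group PG"
proof (rule groupI)
  fix x y z
  assume "x \<in> carrier PG" "y \<in> carrier PG" "z \<in> carrier PG"
  then show "x \<otimes>\<^bsub>PG\<^esub> y \<otimes>\<^bsub>PG\<^esub> z = x \<otimes>\<^bsub>PG\<^esub> (y \<otimes>\<^bsub>PG\<^esub> z)"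
    by (auto simp: carrier_PG mult_PG)
next
  fix x
  assume "x \<in> carrier PG"
  then obtain w where w: "w \<in> words X" "x = cls w"
    by (auto simp: carrier_PG)
  then have "cls (inv_word w) \<otimes>\<^bsub>PG\<^esub> x = \<one>\<^bsub>PG\<^esub>"
    by (simp add: mult_PG inv_word_words one_PG cls_eq_iff pres_eq_inv_word)
  then show "\<exists>y\<in>carrier PG. y \<otimes>\<^bsub>PG\<^esub> x = \<one>\<^bsub>PG\<^esub>"
    using w by (auto simp: carrier_PG inv_word_words)
qed (auto simp: carrier_PG mult_PG one_PG)

end

section \<open>Evaluation of words in a group and the universal property\<close>

fun word_eval :: "('c, 'm) monoid_scheme \<Rightarrow> ('x \<Rightarrow> 'c) \<Rightarrow> 'x word \<Rightarrow> 'c" where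
  "word_eval L f [] = \<one>\<^bsub>L\<^esub>"
| "word_eval L f ((x, s) # w) = (if s then f x else inv\<^bsub>L\<^esub> (f x)) \<otimes>\<^bsub>L\<^esub> word_eval L f w"

lemma (in group) word_eval_closed [simp]:
  "f ` X \<subseteq> carrier G \<Longrightarrow> w \<in> words X \<Longrightarrow> word_eval G f w \<in> carrier G"
  by (induction w) (auto simp: words_def)

lemma (in group) word_eval_append:
  assumes f: "f ` X \<subseteq> carrier G" and v: "v \<in> words X"
  shows "u \<in> words X \<Longrightarrow> word_eval G f (u @ v) = word_eval G f u \<otimes> word_eval G f v"
proof (induction u)
  case (Cons z u)
  obtain x s where z: "z = (x, s)" by force
  have u: "u \<in> words X" "x \<in> X" using Cons.prems z by (auto simp: words_def)
  have "word_eval G f u \<in> carrier G" "word_eval G f v \<in> carrier G" "f x \<in> carrier G"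
    using f v u word_eval_closed[OF f] by auto
  with u Cons.IH z show ?case by (auto simp: m_assoc)
qed (use word_eval_closed[OF f v] in simp)

context presentation
begin

text \<open>Each basic step of \<open>pres_eq\<close> removes a factor that evaluates to one. This
  makes evaluation well defined on classes.\<close>

lemma word_eval_pres_eq:
  assumes "group L" "f ` X \<subseteq> carrier L"
    and "\<And>r. r \<in> R \<Longrightarrow> word_eval L f r = \<one>\<^bsub>L\<^esub>"
  shows "pres_eq X R u v \<Longrightarrow> word_eval L f u = word_eval L f v"
proof (induction rule: pres_eq.induct)
  case (cancel u v x s)
  interpret L: group L by fact
  have "f x \<in> carrier L" using cancel assms by auto
  then have "word_eval L f ([(x, s), (x, \<not> s)] @ v) = word_eval L f v"
    using cancel assms by (auto simp flip: L.m_assoc)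
  then show ?case
    using cancel L.word_eval_append[OF assms(2)] by simp
next
  case (relator u v r)
  interpret L: group L by fact
  have "r \<in> words X" using relator relators_words by auto
  then show ?case
    using relator assms by (simp add: L.word_eval_append)
qed auto

lemma universal_property:
  assumes "group L" "f ` X \<subseteq> carrier L"
    and "\<And>r. r \<in> R \<Longrightarrow> word_eval L f r = \<one>\<^bsub>L\<^esub>"
  obtains h where "h \<in> hom PG L" "\<And>x. x \<in> X \<Longrightarrow> h (cls [(x, True)]) = f x"
proof -
  interpret L: group L by fact
  define h where "h C = word_eval L f (SOME w. w \<in> words X \<and> cls w = C)" for C
  have h: "h (cls w) = word_eval L f w" if "w \<in> words X" for w
  proof -
    have "\<exists>u. u \<in> words X \<and> cls u = cls w" using that by auto
    then have "(SOME u. u \<in> words X \<and> cls u = cls w) \<in> words X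
        \<and> cls (SOME u. u \<in> words X \<and> cls u = cls w) = cls w"
      by (rule someI_ex)
    then show ?thesis
      unfolding h_def using that assms word_eval_pres_eq cls_eq_iff by metis
  qed
  have "h \<in> hom PG L"
    by (rule homI) (use assms(2) in \<open>auto simp: carrier_PG mult_PG h L.word_eval_append\<close>)
  moreover have "h (cls [(x, True)]) = f x" if "x \<in> X" for x
    using that assms(2) by (auto simp: h)
  ultimately show ?thesis using that by blast
qed

lemma cls_letter_inv:
  assumes "x \<in> X"
  shows "cls [(x, False)] = inv\<^bsub>PG\<^esub> (cls [(x, True)])"
proof -
  interpret group PG by (rule group_PG)
  have "pres_eq X R ([] @ [(x, False), (x, \<not> False)] @ []) ([] @ [])"
    using assms by (intro pres_eq.cancel) auto
  then show ?thesis
    using assms by (intro inv_equality[symmetric])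
      (auto simp: mult_PG one_PG cls_eq_iff carrier_PG)
qed

text \<open>Read for a relator, this turns the relator into an equation between generators;
  \<open>relator_trivial\<close>, and with it \<open>gen_mult\<close> and
  \<open>gen_commute\<close>, depend on it.\<close>

lemma word_eval_cls:
  "w \<in> words X \<Longrightarrow> word_eval PG (\<lambda>x. cls [(x, True)]) w = cls w"
proof (induction w)
  case (Cons z w)
  obtain x s where "z = (x, s)" by force
  with Cons show ?case
    by (cases s) (auto simp: mult_PG cls_letter_inv[symmetric])
qed (simp add: one_PG)

end

section \<open>Graph products\<close>

locale graph_prod =
  fixes V :: "'v set" and E :: "('v \<times> 'v) set" and A :: "'v \<Rightarrow> 'a monoid"
  assumes graph: "simple_graph V E" and vertex_groups: "\<And>i. i \<in> V \<Longrightarrow> group (A i)"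
begin

definition "gp_rels = (\<Union>i\<in>V. vertex_relators i (A i)) \<union> commutator_relators E A"

abbreviation "GP \<equiv> graph_product V E A"

definition gen :: "'v \<Rightarrow> 'a \<Rightarrow> ('v \<times> 'a) word set" where
  "gen i a = pres_class (graph_product_gens V A) gp_rels [((i, a), True)]"

lemma finV: "finite V"
  and edgeV: "(i, j) \<in> E \<Longrightarrow> i \<in> V \<and> j \<in> V"
  and edge_sym: "(i, j) \<in> E \<Longrightarrow> (j, i) \<in> E"
  and edge_irrefl: "(i, i) \<notin> E"
  using graph by (auto simp: simple_graph_def sym_def irrefl_def)

sublocale pres: presentation "graph_product_gens V A" gp_rels
proof
  have "vertex_relators i (A i) \<subseteq> words (graph_product_gens V A)" if "i \<in> V" for i
    using that vertex_groups[of i]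
    by (auto simp: vertex_relators_def words_def graph_product_gens_def
        group.is_monoid monoid.m_closed)
  moreover have "commutator_relators E A \<subseteq> words (graph_product_gens V A)"
    using edgeV
    by (auto simp: commutator_relators_def commutator_word_def inv_word_def words_def
        graph_product_gens_def)
  ultimately show "gp_rels \<subseteq> words (graph_product_gens V A)"
    by (auto simp: gp_rels_def)
qed

lemma GP_eq: "GP = presented_group (graph_product_gens V A) gp_rels"
  by (simp add: graph_product_def gp_rels_def)

sublocale GP: group GP
  unfolding GP_eq by (rule pres.group_PG)

lemma gen_closed [simp]: "i \<in> V \<Longrightarrow> a \<in> carrier (A i) \<Longrightarrow> gen i a \<in> carrier GP"
  unfolding GP_eq gen_def pres.carrier_PG
  by (rule imageI) (simp add: words_def graph_product_gens_def)

lemma relator_trivial: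
  assumes "r \<in> gp_rels"
  shows "word_eval GP (\<lambda>(i, a). gen i a) r = \<one>\<^bsub>GP\<^esub>"
proof -
  have r: "r \<in> words (graph_product_gens V A)"
    using assms pres.relators_words by auto
  have *: "(\<lambda>(i, a). gen i a) = (\<lambda>x. pres_class (graph_product_gens V A) gp_rels [(x, True)])"
    by (auto simp: gen_def)
  have "pres_eq (graph_product_gens V A) gp_rels ([] @ r @ []) ([] @ [])"
    using assms by (intro pres_eq.relator) auto
  then show ?thesis
    unfolding * GP_eq using r pres.word_eval_cls[OF r] by (simp add: pres.one_PG pres.cls_eq_iff)
qed

lemma gen_mult:
  assumes i: "i \<in> V" and a: "a \<in> carrier (A i)" and b: "b \<in> carrier (A i)"
  shows "gen i a \<otimes>\<^bsub>GP\<^esub> gen i b = gen i (a \<otimes>\<^bsub>A i\<^esub> b)"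
proof -
  have ab: "a \<otimes>\<^bsub>A i\<^esub> b \<in> carrier (A i)"
    using assms vertex_groups by (simp add: group.is_monoid monoid.m_closed)
  have "[((i, a), True), ((i, b), True), ((i, a \<otimes>\<^bsub>A i\<^esub> b), False)] \<in> gp_rels"
    using assms by (auto simp: gp_rels_def vertex_relators_def)
  from relator_trivial[OF this] show ?thesis
    using assms ab by (simp flip: GP.m_assoc)
      (metis GP.inv_closed GP.inv_inv GP.inv_equality GP.m_closed gen_closed)
qed

lemma gen_one [simp]: "i \<in> V \<Longrightarrow> gen i \<one>\<^bsub>A i\<^esub> = \<one>\<^bsub>GP\<^esub>"
  using gen_mult[of i "\<one>\<^bsub>A i\<^esub>" "\<one>\<^bsub>A i\<^esub>"] vertex_groups[of i]
  by (simp add: group.is_monoid monoid.one_closed GP.l_cancel_one)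

lemma gen_hom: "i \<in> V \<Longrightarrow> gen i \<in> hom (A i) GP"
  by (intro homI) (auto simp: gen_mult)

lemma gen_commute:
  assumes e: "(i, j) \<in> E" and a: "a \<in> carrier (A i)" and b: "b \<in> carrier (A j)"
  shows "gen i a \<otimes>\<^bsub>GP\<^esub> gen j b = gen j b \<otimes>\<^bsub>GP\<^esub> gen i a"
proof -
  have ij: "i \<in> V" "j \<in> V" using edgeV e by auto
  have "commutator_word (i, a) (j, b) \<in> gp_rels"
    using assms by (auto simp: gp_rels_def commutator_relators_def)
  from relator_trivial[OF this]
  have "gen i a \<otimes>\<^bsub>GP\<^esub> (gen j b \<otimes>\<^bsub>GP\<^esub> (inv\<^bsub>GP\<^esub> gen i a \<otimes>\<^bsub>GP\<^esub> inv\<^bsub>GP\<^esub> gen j b)) = \<one>\<^bsub>GP\<^esub>"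
    using assms ij by (simp add: commutator_word_def inv_word_def)
  then have "(gen i a \<otimes>\<^bsub>GP\<^esub> gen j b) \<otimes>\<^bsub>GP\<^esub> inv\<^bsub>GP\<^esub> (gen j b \<otimes>\<^bsub>GP\<^esub> gen i a) = \<one>\<^bsub>GP\<^esub>"
    using assms ij by (simp add: GP.inv_mult_group GP.m_assoc)
  then show ?thesis
    using assms ij by (metis GP.inv_closed GP.inv_equality GP.inv_inv GP.m_closed gen_closed)
qed

text \<open>The explicit homomorphisms out of graph products below all arise from it: the comparison
  with cyclic products, the action on pilings, the retractions and the projections. Vertex relators
  are respected because each \<open>h i\<close> is a homomorphism, commutator relators because of
  \<open>comm\<close>.\<close>

lemma hom_extension:
  fixes L :: "('c, 'm) monoid_scheme"
  assumes L: "group L" and h: "\<And>i. i \<in> V \<Longrightarrow> h i \<in> hom (A i) L"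
    and comm: "\<And>i j a b. (i, j) \<in> E \<Longrightarrow> a \<in> carrier (A i) \<Longrightarrow> b \<in> carrier (A j) \<Longrightarrow>
      h i a \<otimes>\<^bsub>L\<^esub> h j b = h j b \<otimes>\<^bsub>L\<^esub> h i a"
  obtains f where "f \<in> hom GP L"
    "\<And>i a. i \<in> V \<Longrightarrow> a \<in> carrier (A i) \<Longrightarrow> f (gen i a) = h i a"
proof -
  interpret L: group L by fact
  have hc: "h i a \<in> carrier L" if "i \<in> V" "a \<in> carrier (A i)" for i a
    using h that by (auto simp: hom_def)
  have "word_eval L (\<lambda>(i, a). h i a) r = \<one>\<^bsub>L\<^esub>" if r: "r \<in> gp_rels" for r
    using r unfolding gp_rels_def
  proof
    assume "r \<in> (\<Union>i\<in>V. vertex_relators i (A i))"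
    then obtain i a b where i: "i \<in> V" "a \<in> carrier (A i)" "b \<in> carrier (A i)"
      and r: "r = [((i, a), True), ((i, b), True), ((i, a \<otimes>\<^bsub>A i\<^esub> b), False)]"
      by (auto simp: vertex_relators_def)
    show ?thesis
      using i h[OF i(1)] hc by (simp add: r hom_mult flip: L.m_assoc)
  next
    assume "r \<in> commutator_relators E A"
    then obtain i j a b where ij: "(i, j) \<in> E" "a \<in> carrier (A i)" "b \<in> carrier (A j)"
      and r: "r = commutator_word (i, a) (j, b)"
      by (auto simp: commutator_relators_def)
    have hcs: "h i a \<in> carrier L" "h j b \<in> carrier L" using ij edgeV hc by blast+
    have "word_eval L (\<lambda>(i, a). h i a) r = (h i a \<otimes>\<^bsub>L\<^esub> h j b) \<otimes>\<^bsub>L\<^esub> inv\<^bsub>L\<^esub> (h j b \<otimes>\<^bsub>L\<^esub> h i a)"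
      using hcs by (simp add: r commutator_word_def inv_word_def L.inv_mult_group L.m_assoc)
    also have "\<dots> = \<one>\<^bsub>L\<^esub>"
      using hcs comm[OF ij] by simp
    finally show ?thesis .
  qed
  moreover have "(\<lambda>(i, a). h i a) ` graph_product_gens V A \<subseteq> carrier L"
    using hc by (auto simp: graph_product_gens_def)
  ultimately obtain f where "f \<in> hom GP L"
    "\<And>x. x \<in> graph_product_gens V A \<Longrightarrow>
      f (pres_class (graph_product_gens V A) gp_rels [(x, True)]) = (\<lambda>(i, a). h i a) x"
    using pres.universal_property[OF L] unfolding GP_eq by metis
  then show ?thesis
    by (intro that[of f]) (auto simp: gen_def graph_product_gens_def)
qed

text \<open>Syllables carry no sign, because the inverse of \<open>gen i a\<close> is
  \<open>gen i\<close> applied to the inverse of \<open>a\<close>; \<open>ev_exhaust\<close> rests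
  on this.\<close>

fun ev :: "('v \<times> 'a) list \<Rightarrow> ('v \<times> 'a) word set" where
  "ev [] = \<one>\<^bsub>GP\<^esub>"
| "ev ((i, a) # w) = gen i a \<otimes>\<^bsub>GP\<^esub> ev w"

abbreviation "sylls \<equiv> lists (graph_product_gens V A)"

lemma ev_closed [simp]: "w \<in> sylls \<Longrightarrow> ev w \<in> carrier GP"
  by (induction w rule: ev.induct) (auto simp: graph_product_gens_def)

lemma ev_append: "u \<in> sylls \<Longrightarrow> v \<in> sylls \<Longrightarrow> ev (u @ v) = ev u \<otimes>\<^bsub>GP\<^esub> ev v"
  by (induction u rule: ev.induct) (auto simp: graph_product_gens_def GP.m_assoc)

lemma ev_exhaust:
  assumes "x \<in> carrier GP"
  obtains w where "w \<in> sylls" "x = ev w"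
proof -
  obtain u where u: "u \<in> words (graph_product_gens V A)"
    "x = pres_class (graph_product_gens V A) gp_rels u"
    using assms by (auto simp: GP_eq pres.carrier_PG)
  have inv: "inv\<^bsub>GP\<^esub> gen i a = gen i (inv\<^bsub>A i\<^esub> a)" if "i \<in> V" "a \<in> carrier (A i)" for i a
  proof -
    interpret Ai: group "A i" using vertex_groups that by auto
    show ?thesis
      using that by (intro GP.inv_equality) (auto simp: gen_mult)
  qed
  have "\<exists>w\<in>sylls. word_eval GP (\<lambda>x. pres_class (graph_product_gens V A) gp_rels [(x, True)]) u = ev w"
    using u(1)
  proof (induction u)
    case (Cons z u)
    obtain i a s where z: "z = ((i, a), s)" by (metis surj_pair)
    then have ia: "i \<in> V" "a \<in> carrier (A i)" using Cons.prems by (auto simp: words_def graph_product_gens_def)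
    obtain w where w: "w \<in> sylls"
      "word_eval GP (\<lambda>x. pres_class (graph_product_gens V A) gp_rels [(x, True)]) u = ev w"
      using Cons by (auto simp: words_def)
    have g: "pres_class (graph_product_gens V A) gp_rels [((i, a), True)] = gen i a"
      by (simp add: gen_def)
    show ?case
      using z w g ia vertex_groups[OF ia(1)] inv[OF ia]
      by (intro bexI[of _ "(i, if s then a else inv\<^bsub>A i\<^esub> a) # w"])
        (auto simp: graph_product_gens_def)
  qed (auto intro!: bexI[of _ "[]"])
  then show ?thesis
    using u pres.word_eval_cls[OF u(1)] that by (metis GP_eq)
qed

lemma hom_eqI:
  assumes L: "group L" and f: "f \<in> hom GP L" and h: "h \<in> hom GP L"
    and eq: "\<And>i a. i \<in> V \<Longrightarrow> a \<in> carrier (A i) \<Longrightarrow> f (gen i a) = h (gen i a)"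
    and x: "x \<in> carrier GP"
  shows "f x = h x"
proof -
  obtain w where w: "w \<in> sylls" "x = ev w" using ev_exhaust x by blast
  from w(1) have "f (ev w) = h (ev w)"
  proof (induction w rule: ev.induct)
    case 1
    then show ?case using f h L by (simp add: hom_one GP.is_group)
  next
    case (2 i a w)
    then show ?case using f h eq by (auto simp: graph_product_gens_def hom_mult)
  qed
  with w show ?thesis by simp
qed

end


section \<open>Passing to cyclic vertex groups\<close>

text \<open>The factors are taken in index order since a graph product need not be commutative. The
  lemmas below ask for commutation only of those factors that have to be exchanged.\<close>

fun ordered_prod :: "('a, 'm) monoid_scheme \<Rightarrow> (nat \<Rightarrow> 'a) \<Rightarrow> nat \<Rightarrow> 'a" where
  "ordered_prod G g 0 = \<one>\<^bsub>G\<^esub>"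
| "ordered_prod G g (Suc n) = ordered_prod G g n \<otimes>\<^bsub>G\<^esub> g n"

context group
begin

lemma ordered_prod_closed [simp]:
  "(\<And>k. k < n \<Longrightarrow> g k \<in> carrier G) \<Longrightarrow> ordered_prod G g n \<in> carrier G"
  by (induction n) auto

lemma ordered_prod_commute:
  assumes "x \<in> carrier G"
  shows "(\<And>k. k < n \<Longrightarrow> g k \<in> carrier G \<and> x \<otimes> g k = g k \<otimes> x) \<Longrightarrow>
    x \<otimes> ordered_prod G g n = ordered_prod G g n \<otimes> x"
proof (induction n)
  case (Suc n)
  then have c: "ordered_prod G g n \<in> carrier G" "g n \<in> carrier G" by auto
  have IH: "x \<otimes> ordered_prod G g n = ordered_prod G g n \<otimes> x"
    using Suc by auto
  have "x \<otimes> (ordered_prod G g n \<otimes> g n) = ordered_prod G g n \<otimes> (x \<otimes> g n)"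
    using IH c assms by (simp flip: m_assoc)
  also have "\<dots> = ordered_prod G g n \<otimes> g n \<otimes> x"
    using Suc.prems[of n] c assms by (simp add: m_assoc)
  finally show ?case by simp
qed (use assms in simp)

lemma ordered_prod_mult:
  "(\<And>k. k < n \<Longrightarrow> g k \<in> carrier G \<and> h k \<in> carrier G) \<Longrightarrow>
   (\<And>j k. j < n \<Longrightarrow> k < n \<Longrightarrow> j \<noteq> k \<Longrightarrow> g j \<otimes> h k = h k \<otimes> g j) \<Longrightarrow>
   ordered_prod G (\<lambda>k. g k \<otimes> h k) n = ordered_prod G g n \<otimes> ordered_prod G h n"
proof (induction n)
  case (Suc n)
  let ?P = "ordered_prod G g n" and ?Q = "ordered_prod G h n"
  have c: "?P \<in> carrier G" "?Q \<in> carrier G" "g n \<in> carrier G" "h n \<in> carrier G"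
    using Suc.prems(1) by auto
  have comm: "g n \<otimes> ?Q = ?Q \<otimes> g n"
    by (rule ordered_prod_commute) (use Suc.prems in auto)
  have "?P \<otimes> ?Q \<otimes> (g n \<otimes> h n) = ?P \<otimes> (?Q \<otimes> g n) \<otimes> h n"
    using c by (simp add: m_assoc)
  also have "\<dots> = ?P \<otimes> g n \<otimes> (?Q \<otimes> h n)"
    using c by (simp add: m_assoc flip: comm)
  finally show ?case using Suc by simp
qed simp

lemma ordered_prod_single:
  assumes "\<And>k. k < n \<Longrightarrow> k \<noteq> l \<Longrightarrow> g k = \<one>" and "g l \<in> carrier G"
  shows "ordered_prod G g n = (if l < n then g l else \<one>)"
  using assms(1)
proof (induction n)
  case (Suc n)
  have "ordered_prod G g n = (if l < n then g l else \<one>)"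
    by (rule Suc.IH) (use Suc.prems in auto)
  then show ?case
    using assms(2) Suc.prems[of n] by (cases "l = n") auto
qed simp

end

lemma (in group_hom) hom_ordered_prod:
  "(\<And>k. k < n \<Longrightarrow> g k \<in> carrier G) \<Longrightarrow>
    h (ordered_prod G g n) = ordered_prod H (\<lambda>k. h (g k)) n"
  by (induction n) auto

lemma ordered_prod_cong:
  "(\<And>k. k < n \<Longrightarrow> g k = h k) \<Longrightarrow> ordered_prod G g n = ordered_prod G h n"
  by (induction n) auto

lemma is_iso_by_inverse_homs:
  assumes f: "f \<in> hom G H" and g: "g \<in> hom H G"
    and "\<And>x. x \<in> carrier G \<Longrightarrow> g (f x) = x" "\<And>y. y \<in> carrier H \<Longrightarrow> f (g y) = y"
  shows "G \<cong> H"
proof -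
  have "bij_betw f (carrier G) (carrier H)"
    using assms by (intro bij_betw_byWitness[where f' = g]) (auto simp: hom_def)
  then show ?thesis using f unfolding is_iso_def iso_def by auto
qed

section \<open>Comparison with graph products of cyclic groups\<close>

abbreviation cyclic_product :: "'v marked_graph \<Rightarrow> ('v \<times> int) word set monoid" where
  "cyclic_product M \<equiv> graph_product (verts M) (edges M) (\<lambda>u. integer_mod_group (mark M u))"

lemma graph_prod_cyclic:
  "simple_graph (verts M) (edges M) \<Longrightarrow>
    graph_prod (verts M) (edges M) (\<lambda>u. integer_mod_group (mark M u))"
  by (rule graph_prod.intro) auto

lemma cyclic_product_iso:
  assumes M: "simple_graph (verts M) (edges M)" and N: "simple_graph (verts N) (edges N)"
    and iso: "marked_graph_iso M N"
  shows "cyclic_product M \<cong> cyclic_product N"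
proof -
  interpret M: graph_prod "verts M" "edges M" "\<lambda>u. integer_mod_group (mark M u)"
    using M by (rule graph_prod_cyclic)
  interpret N: graph_prod "verts N" "edges N" "\<lambda>u. integer_mod_group (mark N u)"
    using N by (rule graph_prod_cyclic)
  obtain f where f: "bij_betw f (verts M) (verts N)"
    and e: "\<And>x y. x \<in> verts M \<Longrightarrow> y \<in> verts M \<Longrightarrow> (x, y) \<in> edges M \<longleftrightarrow> (f x, f y) \<in> edges N"
    and m: "\<And>x. x \<in> verts M \<Longrightarrow> mark N (f x) = mark M x"
    using iso unfolding marked_graph_iso_def by metis
  define g where "g = inv_into (verts M) f"
  have fg: "f (g y) = y" "g y \<in> verts M" if "y \<in> verts N" for y
    using f that unfolding g_def
    by (auto simp: bij_betw_def f_inv_into_f inv_into_into)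
  have gf: "g (f x) = x" "f x \<in> verts N" if "x \<in> verts M" for x
    using f that unfolding g_def by (auto simp: bij_betw_def)
  obtain \<alpha> where a: "\<alpha> \<in> hom M.GP N.GP"
    "\<And>i a. i \<in> verts M \<Longrightarrow> a \<in> carrier (integer_mod_group (mark M i)) \<Longrightarrow>
        \<alpha> (M.gen i a) = N.gen (f i) a"
  proof (rule M.hom_extension[where h = "\<lambda>i. N.gen (f i)" and L = N.GP])
    show "N.gen (f i) \<in> hom (integer_mod_group (mark M i)) N.GP" if "i \<in> verts M" for i
      using N.gen_hom[of "f i"] gf[OF that] m[OF that] by simp
    show "N.gen (f i) a \<otimes>\<^bsub>N.GP\<^esub> N.gen (f j) b = N.gen (f j) b \<otimes>\<^bsub>N.GP\<^esub> N.gen (f i) a"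
      if "(i, j) \<in> edges M" "a \<in> carrier (integer_mod_group (mark M i))"
        "b \<in> carrier (integer_mod_group (mark M j))" for i j a b
      using that M.edgeV[OF that(1)] e m by (intro N.gen_commute) auto
  qed (use N.GP.is_group in auto)
  obtain \<beta> where b: "\<beta> \<in> hom N.GP M.GP"
    "\<And>i a. i \<in> verts N \<Longrightarrow> a \<in> carrier (integer_mod_group (mark N i)) \<Longrightarrow>
        \<beta> (N.gen i a) = M.gen (g i) a"
  proof (rule N.hom_extension[where h = "\<lambda>i. M.gen (g i)" and L = M.GP])
    show "M.gen (g i) \<in> hom (integer_mod_group (mark N i)) M.GP" if "i \<in> verts N" for i
      using M.gen_hom[of "g i"] fg[OF that] m[of "g i"] by simp
    show "M.gen (g i) a \<otimes>\<^bsub>M.GP\<^esub> M.gen (g j) b = M.gen (g j) b \<otimes>\<^bsub>M.GP\<^esub> M.gen (g i) a"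
      if "(i, j) \<in> edges N" "a \<in> carrier (integer_mod_group (mark N i))"
        "b \<in> carrier (integer_mod_group (mark N j))" for i j a b
    proof -
      have ij: "i \<in> verts N" "j \<in> verts N" using N.edgeV[OF that(1)] by auto
      show ?thesis
        using that fg[OF ij(1)] fg[OF ij(2)] e[of "g i" "g j"] m[of "g i"] m[of "g j"]
        by (intro M.gen_commute) auto
    qed
  qed (use M.GP.is_group in auto)
  show ?thesis
  proof (rule is_iso_by_inverse_homs[OF a(1) b(1)])
    show "\<beta> (\<alpha> x) = x" if "x \<in> carrier M.GP" for x
    proof (rule M.hom_eqI[where f = "\<lambda>x. \<beta> (\<alpha> x)" and h = "\<lambda>x. x", OF M.GP.is_group _ _ _ that])
      show "(\<lambda>x. \<beta> (\<alpha> x)) \<in> hom M.GP M.GP"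
        using hom_compose[OF a(1) b(1)] by (simp add: comp_def)
    qed (use a(2) b(2) gf m in \<open>auto simp: hom_def\<close>)
    show "\<alpha> (\<beta> x) = x" if "x \<in> carrier N.GP" for x
    proof (rule N.hom_eqI[where f = "\<lambda>x. \<alpha> (\<beta> x)" and h = "\<lambda>x. x", OF N.GP.is_group _ _ _ that])
      show "(\<lambda>x. \<alpha> (\<beta> x)) \<in> hom N.GP N.GP"
        using hom_compose[OF b(1) a(1)] by (simp add: comp_def)
      show "\<alpha> (\<beta> (N.gen i a)) = N.gen i a"
        if "i \<in> verts N" "a \<in> carrier (integer_mod_group (mark N i))" for i a
        using a(2)[of "g i" a] b(2)[OF that] fg[OF that(1)] m[of "g i"] that by simp
    qed (auto simp: hom_def)
  qed
qed

lemma marked_graph_of_simps: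
  "verts (marked_graph_of V E P) = (SIGMA i:V. {..<length (P i)})"
  "mark (marked_graph_of V E P) (i, k) = P i ! k"
  "((i, k), (j, l)) \<in> edges (marked_graph_of V E P) \<longleftrightarrow>
    i \<in> V \<and> k < length (P i) \<and> j \<in> V \<and> l < length (P j) \<and> (i = j \<and> k \<noteq> l \<or> (i, j) \<in> E)"
  by (auto simp: marked_graph_of_def Let_def)

lemma simple_graph_marked_graph_of:
  assumes "simple_graph V E"
  shows "simple_graph (verts (marked_graph_of V E P)) (edges (marked_graph_of V E P))"
  using assms
  by (auto simp: simple_graph_def marked_graph_of_def Let_def sym_def irrefl_def)

text \<open>An element of \<open>A i\<close> goes to the product of its coordinates, which commute
  because the blown-up vertices form a clique. Conversely a generator over \<open>(i, k)\<close>
  goes to the element of \<open>A i\<close> whose only nontrivial coordinate is the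
  \<open>k\<close>-th. The two homomorphisms are mutually inverse because they are so on
  generators.\<close>

lemma graph_product_iso_cyclic_product:
  assumes graph: "simple_graph V E"
    and vertex: "\<And>i. i \<in> V \<Longrightarrow> comm_group (A i)"
    and dec: "\<And>i. i \<in> V \<Longrightarrow> primary_decomposition (A i) (P i)"
  shows "graph_product V E A \<cong> cyclic_product (marked_graph_of V E P)"
proof -
  define M where "M = marked_graph_of V E P"
  note Msimps = marked_graph_of_simps[where V = V and E = E and P = P, folded M_def]
  define prd where "prd i = product_group {..<length (P i)} (\<lambda>j. integer_mod_group (P i ! j))" for i
  interpret G: graph_prod V E A
    using graph vertex by (intro graph_prod.intro) (auto simp: comm_group.axioms(2))
  interpret C: graph_prod "verts M" "edges M" "\<lambda>u. integer_mod_group (mark M u)"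
    unfolding M_def by (intro graph_prod_cyclic simple_graph_marked_graph_of graph)
  have prd_group: "group (prd i)" for i
    by (simp add: prd_def)
  define \<psi> where "\<psi> i = (SOME f. f \<in> iso (A i) (prd i))" for i
  define \<phi> where "\<phi> i = inv_into (carrier (A i)) (\<psi> i)" for i
  have \<psi>: "\<psi> i \<in> iso (A i) (prd i)" if "i \<in> V" for i
    using dec[OF that] unfolding \<psi>_def prd_def primary_decomposition_def is_iso_def
    by (intro some_in_eq[THEN iffD2]) auto
  have \<psi>_hom: "\<psi> i \<in> hom (A i) (prd i)" if "i \<in> V" for i
    using \<psi>[OF that] by (simp add: iso_def)
  have \<phi>_hom: "\<phi> i \<in> hom (prd i) (A i)" if "i \<in> V" for i
    using group.iso_set_sym[OF G.vertex_groups[OF that] \<psi>[OF that]]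
    unfolding \<phi>_def by (simp add: iso_def)
  have \<psi>\<phi>: "\<psi> i (\<phi> i x) = x" if "i \<in> V" "x \<in> carrier (prd i)" for i x
    using \<psi>[OF that(1)] that(2) unfolding \<phi>_def
    by (auto simp: iso_def bij_betw_def f_inv_into_f)
  have \<phi>\<psi>: "\<phi> i (\<psi> i x) = x" if "i \<in> V" "x \<in> carrier (A i)" for i x
    using \<psi>[OF that(1)] that(2) unfolding \<phi>_def
    by (auto simp: iso_def bij_betw_def)
  have \<psi>_closed: "\<psi> i a \<in> carrier (prd i)" if "i \<in> V" "a \<in> carrier (A i)" for i a
    using \<psi>_hom[OF that(1)] that(2) by (auto simp: hom_def)
  have coord: "x k \<in> carrier (integer_mod_group (mark M (i, k)))"
    if "x \<in> carrier (prd i)" "k < length (P i)" for x i k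
    using that by (auto simp: prd_def Msimps PiE_iff)
  \<comment> \<open>The embedding of the \<open>k\<close>-th cyclic factor into the product; the
    restriction makes it extensional, as elements of \<open>product_group\<close> are.\<close>
  define bas where "bas = (\<lambda>i k (m::int). \<lambda>j\<in>{..<length (P i)}. if j = k then m else 0)"
  have bas_closed: "bas i k m \<in> carrier (prd i)"
    if "m \<in> carrier (integer_mod_group (mark M (i, k)))" for i k m
    using that by (auto simp: bas_def prd_def Msimps)
  have bas_hom: "bas i k \<in> hom (integer_mod_group (mark M (i, k))) (prd i)" for i k
  proof (rule homI)
    fix x y
    show "bas i k (x \<otimes>\<^bsub>integer_mod_group (mark M (i, k))\<^esub> y) = bas i k x \<otimes>\<^bsub>prd i\<^esub> bas i k y"
      by (auto simp: bas_def prd_def Msimps fun_eq_iff)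
  qed (rule bas_closed)
  have bas_prod: "ordered_prod (prd i) (\<lambda>k. bas i k (x k)) (length (P i)) = x"
    if x: "x \<in> carrier (prd i)" for i x
  proof -
    \<comment> \<open>Generalised to partial products: the first \<open>n\<close> factors give
      \<open>x\<close> with all later coordinates set to zero.\<close>
    have "n \<le> length (P i) \<Longrightarrow> ordered_prod (prd i) (\<lambda>k. bas i k (x k)) n
        = (\<lambda>j\<in>{..<length (P i)}. if j < n then x j else 0)" for n
    proof (induction n)
      case 0
      then show ?case by (simp add: prd_def)
    next
      case (Suc n)
      have "x j mod int (P i ! j) = x j" if "j < length (P i)" for j
        using coord[OF x that] by (auto simp: Msimps carrier_integer_mod_group split: if_splits)
      with Suc show ?case
        by (auto simp: prd_def bas_def fun_eq_iff less_Suc_eq)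
    qed
    then show ?thesis
      using x by (auto simp: prd_def fun_eq_iff PiE_iff extensional_def)
  qed

  define F where "F = (\<lambda>i a. ordered_prod C.GP (\<lambda>k. C.gen (i, k) (\<psi> i a k)) (length (P i)))"
  define H where "H = (\<lambda>u m. G.gen (fst u) (\<phi> (fst u) (bas (fst u) (snd u) m)))"
  have genC_closed: "C.gen (i, k) (x k) \<in> carrier C.GP"
    if "i \<in> V" "x \<in> carrier (prd i)" "k < length (P i)" for i k x
    using that coord by (intro C.gen_closed) (auto simp: Msimps)
  have F_hom: "F i \<in> hom (A i) C.GP" if i: "i \<in> V" for i
  proof (rule homI)
    fix a b assume ab: "a \<in> carrier (A i)" "b \<in> carrier (A i)"
    note cl = \<psi>_closed[OF i ab(1)] \<psi>_closed[OF i ab(2)]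
    have "F i (a \<otimes>\<^bsub>A i\<^esub> b)
        = ordered_prod C.GP (\<lambda>k. C.gen (i, k) (\<psi> i a k) \<otimes>\<^bsub>C.GP\<^esub> C.gen (i, k) (\<psi> i b k)) (length (P i))"
      unfolding F_def
    proof (rule ordered_prod_cong)
      fix k assume k: "k < length (P i)"
      have "\<psi> i (a \<otimes>\<^bsub>A i\<^esub> b) k = \<psi> i a k \<otimes>\<^bsub>integer_mod_group (mark M (i, k))\<^esub> \<psi> i b k"
        using hom_mult[OF \<psi>_hom[OF i] ab] k by (simp add: prd_def Msimps)
      then show "C.gen (i, k) (\<psi> i (a \<otimes>\<^bsub>A i\<^esub> b) k)
          = C.gen (i, k) (\<psi> i a k) \<otimes>\<^bsub>C.GP\<^esub> C.gen (i, k) (\<psi> i b k)"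
        using k i cl coord by (subst C.gen_mult) (auto simp: Msimps)
    qed
    also have "\<dots> = F i a \<otimes>\<^bsub>C.GP\<^esub> F i b"
      unfolding F_def
    proof (rule C.GP.ordered_prod_mult)
      fix j k assume "j < length (P i)" "k < length (P i)" "j \<noteq> k"
      then show "C.gen (i, j) (\<psi> i a j) \<otimes>\<^bsub>C.GP\<^esub> C.gen (i, k) (\<psi> i b k)
          = C.gen (i, k) (\<psi> i b k) \<otimes>\<^bsub>C.GP\<^esub> C.gen (i, j) (\<psi> i a j)"
        using i cl coord by (intro C.gen_commute) (auto simp: Msimps)
    qed (use i cl genC_closed in auto)
    finally show "F i (a \<otimes>\<^bsub>A i\<^esub> b) = F i a \<otimes>\<^bsub>C.GP\<^esub> F i b" .
  next
    fix a assume "a \<in> carrier (A i)"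
    then show "F i a \<in> carrier C.GP"
      unfolding F_def using i \<psi>_closed genC_closed by (intro C.GP.ordered_prod_closed) auto
  qed
  obtain \<alpha> where a: "\<alpha> \<in> hom G.GP C.GP"
    "\<And>i a. i \<in> V \<Longrightarrow> a \<in> carrier (A i) \<Longrightarrow> \<alpha> (G.gen i a) = F i a"
  proof (rule G.hom_extension[where h = F and L = C.GP])
    fix i j a b
    assume ij: "(i, j) \<in> E" and a: "a \<in> carrier (A i)" and b: "b \<in> carrier (A j)"
    have V: "i \<in> V" "j \<in> V" using ij G.edgeV by auto
    note cl = \<psi>_closed[OF V(1) a] \<psi>_closed[OF V(2) b]
    have "C.gen (i, k) (\<psi> i a k) \<otimes>\<^bsub>C.GP\<^esub> F j b = F j b \<otimes>\<^bsub>C.GP\<^esub> C.gen (i, k) (\<psi> i a k)"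
      if "k < length (P i)" for k
      unfolding F_def
    proof (rule C.GP.ordered_prod_commute)
      fix l assume "l < length (P j)"
      then show "C.gen (j, l) (\<psi> j b l) \<in> carrier C.GP \<and>
        C.gen (i, k) (\<psi> i a k) \<otimes>\<^bsub>C.GP\<^esub> C.gen (j, l) (\<psi> j b l)
          = C.gen (j, l) (\<psi> j b l) \<otimes>\<^bsub>C.GP\<^esub> C.gen (i, k) (\<psi> i a k)"
        using that ij V cl coord
        by (intro conjI C.gen_commute genC_closed) (auto simp: Msimps)
    qed (use that V cl genC_closed in auto)
    \<comment> \<open>Commutation with a product is used twice: each factor of \<open>F i a\<close>
      commutes with \<open>F j b\<close>, and therefore \<open>F j b\<close> commutes with the
      product of these factors.\<close>
    then have "F j b \<otimes>\<^bsub>C.GP\<^esub> F i a = F i a \<otimes>\<^bsub>C.GP\<^esub> F j b"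
      unfolding fun_cong[OF F_def, of i]
      using V cl genC_closed F_hom[OF V(2)] b by (intro C.GP.ordered_prod_commute) (auto simp: hom_def)
    then show "F i a \<otimes>\<^bsub>C.GP\<^esub> F j b = F j b \<otimes>\<^bsub>C.GP\<^esub> F i a" by simp
  qed (use C.GP.is_group F_hom in auto)

  have H_hom: "H u \<in> hom (integer_mod_group (mark M u)) G.GP" if "u \<in> verts M" for u
  proof -
    obtain i k where u: "u = (i, k)" by force
    then have i: "i \<in> V" using that by (auto simp: Msimps)
    show ?thesis
      using hom_compose[OF hom_compose[OF bas_hom[of i k] \<phi>_hom[OF i]] G.gen_hom[OF i]]
      by (simp add: H_def u comp_def)
  qed
  have \<phi>_closed: "\<phi> i (bas i k m) \<in> carrier (A i)"
    if "i \<in> V" "m \<in> carrier (integer_mod_group (mark M (i, k)))" for i k m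
    using \<phi>_hom[OF that(1)] bas_closed[OF that(2)] by (auto simp: hom_def)
  obtain \<beta> where b: "\<beta> \<in> hom C.GP G.GP"
    "\<And>u m. u \<in> verts M \<Longrightarrow> m \<in> carrier (integer_mod_group (mark M u)) \<Longrightarrow> \<beta> (C.gen u m) = H u m"
  proof (rule C.hom_extension[where h = H and L = G.GP])
    fix u v m n
    assume uv: "(u, v) \<in> edges M" and mn: "m \<in> carrier (integer_mod_group (mark M u))"
      "n \<in> carrier (integer_mod_group (mark M v))"
    obtain i k j l where u: "u = (i, k)" "v = (j, l)" by force
    have ij: "i \<in> V" "j \<in> V" "i = j \<or> (i, j) \<in> E" using uv u by (auto simp: Msimps)
    note cl = \<phi>_closed[OF ij(1) mn(1)[unfolded u]] \<phi>_closed[OF ij(2) mn(2)[unfolded u]]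
    from ij(3) have "G.gen i (\<phi> i (bas i k m)) \<otimes>\<^bsub>G.GP\<^esub> G.gen j (\<phi> j (bas j l n))
        = G.gen j (\<phi> j (bas j l n)) \<otimes>\<^bsub>G.GP\<^esub> G.gen i (\<phi> i (bas i k m))"
    proof
      assume "(i, j) \<in> E"
      then show ?thesis using cl by (intro G.gen_commute)
    next
      \<comment> \<open>Two cyclic factors of the same vertex group: this is where the vertex groups
        have to be commutative.\<close>
      assume [simp]: "i = j"
      interpret Aj: comm_group "A j" using vertex ij by auto
      show ?thesis using cl ij by (simp add: G.gen_mult Aj.m_comm)
    qed
    then show "H u m \<otimes>\<^bsub>G.GP\<^esub> H v n = H v n \<otimes>\<^bsub>G.GP\<^esub> H u m"
      by (simp add: H_def u)
  qed (use G.GP.is_group H_hom in auto)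

  have \<beta>\<alpha>: "\<beta> (\<alpha> (G.gen i a)) = G.gen i a" if i: "i \<in> V" and ai: "a \<in> carrier (A i)" for i a
  proof -
    interpret \<beta>: group_hom C.GP G.GP \<beta>
      using b(1) C.GP.is_group G.GP.is_group by (simp add: group_hom_def group_hom_axioms_def)
    have "(\<lambda>x. G.gen i (\<phi> i x)) \<in> hom (prd i) G.GP"
      using hom_compose[OF \<phi>_hom[OF i] G.gen_hom[OF i]] by (simp add: comp_def)
    then interpret \<gamma>: group_hom "prd i" G.GP "\<lambda>x. G.gen i (\<phi> i x)"
      using prd_group G.GP.is_group by (simp add: group_hom_def group_hom_axioms_def)
    note cl = \<psi>_closed[OF i ai]
    have "\<beta> (\<alpha> (G.gen i a)) = ordered_prod G.GP (\<lambda>k. \<beta> (C.gen (i, k) (\<psi> i a k))) (length (P i))"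
      using that a(2) genC_closed[OF i cl] by (simp add: F_def \<beta>.hom_ordered_prod)
    also have "\<dots> = ordered_prod G.GP (\<lambda>k. G.gen i (\<phi> i (bas i k (\<psi> i a k)))) (length (P i))"
      by (rule ordered_prod_cong) (use i b(2) coord[OF cl] in \<open>auto simp: H_def Msimps(1)\<close>)
    also have "\<dots> = G.gen i (\<phi> i (ordered_prod (prd i) (\<lambda>k. bas i k (\<psi> i a k)) (length (P i))))"
      using bas_closed coord[OF cl] by (intro \<gamma>.hom_ordered_prod[symmetric]) auto
    also have "\<dots> = G.gen i a"
      using bas_prod[OF cl] \<phi>\<psi>[OF i ai] by simp
    finally show ?thesis .
  qed
  have \<alpha>\<beta>: "\<alpha> (\<beta> (C.gen u m)) = C.gen u m"
    if u: "u \<in> verts M" and m: "m \<in> carrier (integer_mod_group (mark M u))" for u m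
  proof -
    obtain i k where uik: "u = (i, k)" by force
    then have i: "i \<in> V" and k: "k < length (P i)" using u by (auto simp: Msimps)
    have bc: "bas i k m \<in> carrier (prd i)" using bas_closed m uik by simp
    have "\<alpha> (\<beta> (C.gen u m))
        = ordered_prod C.GP (\<lambda>l. C.gen (i, l) (bas i k m l)) (length (P i))"
      using b(2)[OF u m] a(2) i m uik \<phi>_closed \<psi>\<phi>[OF i bc] by (simp add: H_def F_def)
    also have "\<dots> = (if k < length (P i) then C.gen (i, k) (bas i k m k) else \<one>\<^bsub>C.GP\<^esub>)"
    proof (rule C.GP.ordered_prod_single)
      fix l assume "l < length (P i)" "l \<noteq> k"
      then show "C.gen (i, l) (bas i k m l) = \<one>\<^bsub>C.GP\<^esub>"
        using C.gen_one[of "(i, l)"] i by (simp add: bas_def Msimps(1))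
    qed (use genC_closed[OF i bc k] in auto)
    also have "\<dots> = C.gen u m" using k uik by (simp add: bas_def)
    finally show ?thesis .
  qed
  show ?thesis unfolding M_def[symmetric]
  proof (rule is_iso_by_inverse_homs[OF a(1) b(1)])
    show "\<beta> (\<alpha> x) = x" if "x \<in> carrier G.GP" for x
    proof (rule G.hom_eqI[where f = "\<lambda>x. \<beta> (\<alpha> x)" and h = "\<lambda>x. x", OF G.GP.is_group _ _ _ that])
      show "(\<lambda>x. \<beta> (\<alpha> x)) \<in> hom G.GP G.GP"
        using hom_compose[OF a(1) b(1)] by (simp add: comp_def)
    qed (use \<beta>\<alpha> in \<open>auto simp: hom_def\<close>)
    show "\<alpha> (\<beta> x) = x" if "x \<in> carrier C.GP" for x
    proof (rule C.hom_eqI[where f = "\<lambda>x. \<alpha> (\<beta> x)" and h = "\<lambda>x. x", OF C.GP.is_group _ _ _ that])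
      show "(\<lambda>x. \<alpha> (\<beta> x)) \<in> hom C.GP C.GP"
        using hom_compose[OF b(1) a(1)] by (simp add: comp_def)
    qed (use \<alpha>\<beta> in \<open>auto simp: hom_def\<close>)
  qed
qed


section \<open>Sentences\<close>

lemma term_val_closed:
  "group G \<Longrightarrow> (\<And>n. e n \<in> carrier G) \<Longrightarrow> term_val G e t \<in> carrier G"
  by (induction t) (auto simp: group.is_monoid monoid.m_closed monoid.one_closed)

lemma term_val_iso:
  assumes G: "group G" and H: "group H" and h: "h \<in> hom G H" and e: "\<And>n. e n \<in> carrier G"
  shows "term_val H (\<lambda>n. h (e n)) t = h (term_val G e t)"
proof -
  interpret group_hom G H h using G H h by (simp add: group_hom_def group_hom_axioms_def)
  show ?thesis
    by (induction t) (simp_all add: term_val_closed[OF G e])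
qed

text \<open>The assignment has to vary, because quantifiers change it. Injectivity of
  \<open>h\<close> handles equations, and surjectivity turns a quantifier over \<open>H\<close> into
  one over \<open>G\<close>.\<close>

lemma holds_iso:
  assumes G: "group G" and H: "group H" and h: "h \<in> iso G H"
  shows "(\<And>n. e n \<in> carrier G) \<Longrightarrow> holds H (\<lambda>n. h (e n)) \<phi> \<longleftrightarrow> holds G e \<phi>"
proof (induction \<phi> arbitrary: e)
  case (Eq s t)
  have "h \<in> hom G H" "inj_on h (carrier G)" using h by (auto simp: iso_def bij_betw_def)
  then show ?case
    using Eq by (simp add: term_val_iso[OF G H] term_val_closed[OF G] inj_on_eq_iff)
next
  case (Exists n \<phi>)
  have h_image: "carrier H = h ` carrier G" using h by (auto simp: iso_def bij_betw_def)
  have upd: "(\<lambda>m. h ((e(n := a)) m)) = (\<lambda>m. h (e m))(n := h a)" for a by auto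
  have "holds H (\<lambda>n. h (e n)) (Exists n \<phi>) \<longleftrightarrow>
      (\<exists>a\<in>h ` carrier G. holds H ((\<lambda>m. h (e m))(n := a)) \<phi>)"
    by (simp only: holds.simps h_image)
  also have "\<dots> \<longleftrightarrow> (\<exists>a\<in>carrier G. holds H (\<lambda>m. h ((e(n := a)) m)) \<phi>)"
    by (simp only: bex_simps upd)
  also have "\<dots> \<longleftrightarrow> (\<exists>a\<in>carrier G. holds G (e(n := a)) \<phi>)"
    by (intro bex_cong refl Exists.IH) (use Exists.prems in auto)
  finally show ?case by simp
next
  case (Forall n \<phi>)
  have h_image: "carrier H = h ` carrier G" using h by (auto simp: iso_def bij_betw_def)
  have upd: "(\<lambda>m. h ((e(n := a)) m)) = (\<lambda>m. h (e m))(n := h a)" for a by auto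
  have "holds H (\<lambda>n. h (e n)) (Forall n \<phi>) \<longleftrightarrow>
      (\<forall>a\<in>h ` carrier G. holds H ((\<lambda>m. h (e m))(n := a)) \<phi>)"
    by (simp only: holds.simps h_image)
  also have "\<dots> \<longleftrightarrow> (\<forall>a\<in>carrier G. holds H (\<lambda>m. h ((e(n := a)) m)) \<phi>)"
    by (simp only: ball_simps upd)
  also have "\<dots> \<longleftrightarrow> (\<forall>a\<in>carrier G. holds G (e(n := a)) \<phi>)"
    by (intro ball_cong refl Forall.IH) (use Forall.prems in auto)
  finally show ?case by simp
qed auto

lemma satisfies_iso:
  assumes G: "group G" and H: "group H" and iso: "G \<cong> H"
  shows "satisfies G \<phi> \<longleftrightarrow> satisfies H \<phi>"
proof -
  obtain h where h: "h \<in> iso G H" using iso by (auto simp: is_iso_def)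
  have "h \<one>\<^bsub>G\<^esub> = \<one>\<^bsub>H\<^esub>"
    using h G H by (auto simp: iso_def hom_one)
  with holds_iso[OF G H h, of "\<lambda>_. \<one>\<^bsub>G\<^esub>" \<phi>] G show ?thesis
    by (simp add: satisfies_def group.is_monoid monoid.one_closed)
qed

section \<open>Sentences describing a configuration of conjugacy classes\<close>

definition conj_list :: "gform list \<Rightarrow> gform" where
  "conj_list \<phi>s = foldr Conj \<phi>s (Eq One One)"

lemma conj_list_simps:
  "holds G e (conj_list \<phi>s) \<longleftrightarrow> (\<forall>\<phi>\<in>set \<phi>s. holds G e \<phi>)"
  "free_vars (conj_list \<phi>s) = (\<Union>\<phi>\<in>set \<phi>s. free_vars \<phi>)"
  "quantifier_free (conj_list \<phi>s) \<longleftrightarrow> (\<forall>\<phi>\<in>set \<phi>s. quantifier_free \<phi>)"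
  by (induction \<phi>s) (auto simp: conj_list_def)

text \<open>Builds a truth value found in one group into the sentence, so that both the validity and
  the failure of an equation are transferred.\<close>

definition literal :: "bool \<Rightarrow> gform \<Rightarrow> gform" where
  "literal b \<phi> = (if b then \<phi> else Neg \<phi>)"

lemma literal_simps [simp]:
  "holds G e (literal b \<phi>) \<longleftrightarrow> (holds G e \<phi> \<longleftrightarrow> b)"
  "free_vars (literal b \<phi>) = free_vars \<phi>"
  "quantifier_free (literal b \<phi>) \<longleftrightarrow> quantifier_free \<phi>"
  by (auto simp: literal_def)

fun term_power :: "gterm \<Rightarrow> nat \<Rightarrow> gterm" where
  "term_power t 0 = One"
| "term_power t (Suc d) = Mult (term_power t d) t"

lemma term_power_simps:
  "term_val G e (term_power t d) = term_val G e t [^]\<^bsub>G\<^esub> d"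
  "term_vars (term_power t d) \<subseteq> term_vars t"
  by (induction d) (auto simp: nat_pow_def)

lemma holds_foldr_Exists:
  "holds G e (foldr Exists xs \<phi>) \<longleftrightarrow>
    (\<exists>e'. (\<forall>n\<in>set xs. e' n \<in> carrier G) \<and> (\<forall>n. n \<notin> set xs \<longrightarrow> e' n = e n) \<and> holds G e' \<phi>)"
proof (induction xs arbitrary: e)
  case Nil
  have "e' = e" if "\<forall>n. e' n = e n" for e' using that by auto
  then show ?case by auto
next
  case (Cons x xs)
  show ?case
  proof
    assume "holds G e (foldr Exists (x # xs) \<phi>)"
    then obtain a e' where *: "a \<in> carrier G" "\<forall>n\<in>set xs. e' n \<in> carrier G"
      "\<forall>n. n \<notin> set xs \<longrightarrow> e' n = (e(x := a)) n" "holds G e' \<phi>"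
      using Cons.IH by auto
    \<comment> \<open>If \<open>x\<close> is bound again further inside, the inner value counts;
      otherwise \<open>e' x\<close> is the outer witness \<open>a\<close>.\<close>
    then have "e' x \<in> carrier G" by (cases "x \<in> set xs") auto
    with * show "\<exists>e'. (\<forall>n\<in>set (x # xs). e' n \<in> carrier G) \<and>
        (\<forall>n. n \<notin> set (x # xs) \<longrightarrow> e' n = e n) \<and> holds G e' \<phi>"
      by (intro exI[of _ e']) auto
  next
    assume "\<exists>e'. (\<forall>n\<in>set (x # xs). e' n \<in> carrier G) \<and>
        (\<forall>n. n \<notin> set (x # xs) \<longrightarrow> e' n = e n) \<and> holds G e' \<phi>"
    then obtain e' where *: "\<forall>n\<in>set (x # xs). e' n \<in> carrier G"
        "\<forall>n. n \<notin> set (x # xs) \<longrightarrow> e' n = e n" "holds G e' \<phi>" by blast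
    then have "holds G (e(x := e' x)) (foldr Exists xs \<phi>)"
      unfolding Cons.IH by (intro exI[of _ e']) auto
    with * show "holds G e (foldr Exists (x # xs) \<phi>)" by auto
  qed
qed

lemma free_vars_foldr_Exists: "free_vars (foldr Exists xs \<phi>) = free_vars \<phi> - set xs"
  by (induction xs) auto

text \<open>Variable \<open>i < n\<close> stands for the \<open>i\<close>-th element, variable \<open>n + i * n + j\<close> for an element
  conjugating the \<open>j\<close>-th into the centralizer of the \<open>i\<close>-th, and variable \<open>n + n * n\<close> is the
  universally quantified one.\<close>

abbreviation "conj_term s t \<equiv> Mult (Mult s t) (Inv s)"

definition configuration_matrix ::
    "nat \<Rightarrow> nat \<Rightarrow> (nat \<Rightarrow> nat \<Rightarrow> bool) \<Rightarrow> (nat \<Rightarrow> nat \<Rightarrow> bool) \<Rightarrow> gform" where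
  "configuration_matrix n N ord R = conj_list (
     map (\<lambda>(i, j). Neg (Eq (Mult (Var (n + n * n)) (Var i)) (Mult (Var j) (Var (n + n * n)))))
       (filter (\<lambda>(i, j). i \<noteq> j) (List.product [0..<n] [0..<n])) @
     map (\<lambda>(i, d). literal (ord i d) (Eq (term_power (Var i) d) One))
       (List.product [0..<n] [0..<N]) @
     map (\<lambda>(i, j). Eq (Mult (Var i) (conj_term (Var (n + i * n + j)) (Var j)))
         (Mult (conj_term (Var (n + i * n + j)) (Var j)) (Var i)))
       (filter (\<lambda>(i, j). R i j) (List.product [0..<n] [0..<n])))"

text \<open>Only the non-conjugacy conjuncts mention the universally quantified variable.
  Commutation is asserted for the pairs in \<open>R\<close> and never denied; the converse comes
  from the counting in \<open>clique_vectors_transfer\<close>.\<close>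

definition configuration_sentence ::
    "nat \<Rightarrow> nat \<Rightarrow> (nat \<Rightarrow> nat \<Rightarrow> bool) \<Rightarrow> (nat \<Rightarrow> nat \<Rightarrow> bool) \<Rightarrow> gform" where
  "configuration_sentence n N ord R =
     foldr Exists [0..<n + n * n] (Forall (n + n * n) (configuration_matrix n N ord R))"

definition commutes_with_conj :: "('a, 'm) monoid_scheme \<Rightarrow> 'a \<Rightarrow> 'a \<Rightarrow> 'a \<Rightarrow> bool" where
  "commutes_with_conj G x y g \<longleftrightarrow>
    x \<otimes>\<^bsub>G\<^esub> (g \<otimes>\<^bsub>G\<^esub> y \<otimes>\<^bsub>G\<^esub> inv\<^bsub>G\<^esub> g) = g \<otimes>\<^bsub>G\<^esub> y \<otimes>\<^bsub>G\<^esub> inv\<^bsub>G\<^esub> g \<otimes>\<^bsub>G\<^esub> x"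

lemma holds_configuration_matrix:
  "holds G e (configuration_matrix n N ord R) \<longleftrightarrow>
    (\<forall>i<n. \<forall>j<n. i \<noteq> j \<longrightarrow> e (n + n * n) \<otimes>\<^bsub>G\<^esub> e i \<noteq> e j \<otimes>\<^bsub>G\<^esub> e (n + n * n)) \<and>
    (\<forall>i<n. \<forall>d<N. e i [^]\<^bsub>G\<^esub> d = \<one>\<^bsub>G\<^esub> \<longleftrightarrow> ord i d) \<and>
    (\<forall>i<n. \<forall>j<n. R i j \<longrightarrow>
      commutes_with_conj G (e i) (e j) (e (n + i * n + j)))"
  unfolding configuration_matrix_def conj_list_simps set_append ball_Un
proof (intro arg_cong2[where f = "(\<and>)"], goal_cases)
    case 1
    show ?case by (simp add: split_beta) auto
  next
    case 2
    show ?case by (auto simp: term_power_simps)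
  next
    case 3
    show ?case by (auto simp: commutes_with_conj_def)
qed

text \<open>The variable \<open>n + i * n + j\<close> that codes a pair is thus strictly below the
  universally quantified variable \<open>n + n * n\<close>.\<close>

lemma index_bound: "i < n \<Longrightarrow> j < n \<Longrightarrow> i * n + j < n * (n::nat)"
  by (metis add.commute add_less_le_mono le_simps(3) less_le_trans mult_Suc mult_le_mono1
      nat_add_left_cancel_less)

lemma configuration_sentence: "exists_forall_sentence (configuration_sentence n N ord R)"
proof -
  have "free_vars (configuration_matrix n N ord R) \<subseteq> {..n + n * n}"
    unfolding configuration_matrix_def conj_list_simps
    using term_power_simps(2)[of "Var _"] index_bound
    by (fastforce simp: less_imp_le add.assoc split: if_splits)
  moreover have "quantifier_free (configuration_matrix n N ord R)"
    unfolding configuration_matrix_def conj_list_simps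
    by auto
  ultimately show ?thesis
    unfolding exists_forall_sentence_def sentence_def configuration_sentence_def
    by (intro conjI exI[of _ "[0..<n + n * n]"] exI[of _ "[n + n * n]"]
        exI[of _ "configuration_matrix n N ord R"])
      (auto simp: free_vars_foldr_Exists)
qed

text \<open>Says that the two conjugacy classes have commuting representatives: simultaneous
  conjugation allows one of the two to be kept fixed.\<close>

definition conj_commute :: "('a, 'm) monoid_scheme \<Rightarrow> 'a \<Rightarrow> 'a \<Rightarrow> bool" where
  "conj_commute G x y \<longleftrightarrow> (\<exists>g\<in>carrier G. commutes_with_conj G x y g)"

text \<open>Stated without an inverse, in exactly the form that the sentence denies for all values
  of its last variable.\<close>

definition conjugate :: "('a, 'm) monoid_scheme \<Rightarrow> 'a \<Rightarrow> 'a \<Rightarrow> bool" where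
  "conjugate G x y \<longleftrightarrow> (\<exists>g\<in>carrier G. g \<otimes>\<^bsub>G\<^esub> x = y \<otimes>\<^bsub>G\<^esub> g)"

text \<open>The tables \<open>ord\<close> and \<open>R\<close> are read off in \<open>G\<close>, so
  the sentence holds in \<open>G\<close> by construction; its witnesses in \<open>H\<close> are the
  required elements.\<close>

lemma exists_forall_transfer_configuration:
  fixes G :: "'a monoid" and H :: "'b monoid" and n N :: nat
  assumes G: "group G" and H: "group H"
    and transfer: "\<And>\<phi>. exists_forall_sentence \<phi> \<Longrightarrow> satisfies G \<phi> \<Longrightarrow> satisfies H \<phi>"
    and x: "\<And>i. i < n \<Longrightarrow> x i \<in> carrier G"
    and nonconj: "\<And>i j. i < n \<Longrightarrow> j < n \<Longrightarrow> i \<noteq> j \<Longrightarrow> \<not> conjugate G (x i) (x j)"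
  obtains y where "\<And>i. i < n \<Longrightarrow> y i \<in> carrier H"
    "\<And>i j. i < n \<Longrightarrow> j < n \<Longrightarrow> i \<noteq> j \<Longrightarrow> \<not> conjugate H (y i) (y j)"
    "\<And>i d. i < n \<Longrightarrow> d < N \<Longrightarrow> y i [^]\<^bsub>H\<^esub> d = \<one>\<^bsub>H\<^esub> \<longleftrightarrow> x i [^]\<^bsub>G\<^esub> (d::nat) = \<one>\<^bsub>G\<^esub>"
    "\<And>i j. i < n \<Longrightarrow> j < n \<Longrightarrow> conj_commute G (x i) (x j) \<Longrightarrow> conj_commute H (y i) (y j)"
proof -
  define ord where "ord i d \<longleftrightarrow> x i [^]\<^bsub>G\<^esub> (d::nat) = \<one>\<^bsub>G\<^esub>" for i d
  define R where "R i j \<longleftrightarrow> conj_commute G (x i) (x j)" for i j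
  define \<phi> where "\<phi> = configuration_sentence n N ord R"
  define cm where "cm i j g \<longleftrightarrow> g \<in> carrier G \<and> commutes_with_conj G (x i) (x j) g" for i j g
  \<comment> \<open>The default value keeps \<open>c i j\<close> in the carrier for pairs without a
    conjugating element.\<close>
  define c where "c i j = (if R i j then SOME g. cm i j g else \<one>\<^bsub>G\<^esub>)" for i j
  have cR: "cm i j (c i j)" if "R i j" for i j
  proof -
    have "\<exists>g. cm i j g" using that by (auto simp: R_def conj_commute_def cm_def)
    from someI_ex[OF this] show ?thesis using that by (simp add: c_def)
  qed
  have cG: "c i j \<in> carrier G" for i j
    using cR[of i j] G by (cases "R i j") (auto simp: cm_def c_def group.is_monoid monoid.one_closed)
  \<comment> \<open>Variables from \<open>n\<close> on are decoded as pairs by division by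
    \<open>n\<close>; the last value is overwritten by the universal quantifier.\<close>
  define e where "e k = (if k < n then x k else if k < n + n * n
    then c ((k - n) div n) ((k - n) mod n) else \<one>\<^bsub>G\<^esub>)" for k
  have ec: "e (n + i * n + j) = c i j" if "i < n" "j < n" for i j
    using that index_bound[OF that] by (auto simp: e_def add.assoc)
  have "holds G (e(n + n * n := y)) (configuration_matrix n N ord R)" if "y \<in> carrier G" for y
    unfolding holds_configuration_matrix
  proof (intro conjI allI impI)
    fix i j assume ij: "i < n" "j < n" "R i j"
    have neq: "n + i * n + j \<noteq> n + n * n" using index_bound[OF ij(1,2)] by simp
    show "commutes_with_conj G ((e(n + n * n := y)) i) ((e(n + n * n := y)) j)
        ((e(n + n * n := y)) (n + i * n + j))"
      using cR[OF ij(3)] ij neq ec[OF ij(1,2)] by (simp add: cm_def e_def)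
  qed (use that nonconj in \<open>auto simp: e_def ord_def conjugate_def\<close>)
  then have "satisfies G \<phi>"
    unfolding \<phi>_def configuration_sentence_def satisfies_def holds_foldr_Exists
    using x cG by (intro exI[of _ e]) (auto simp: e_def)
  then have "satisfies H \<phi>"
    using transfer configuration_sentence by (simp add: \<phi>_def)
  then obtain f where f0: "\<forall>k\<in>set [0..<n + n * n]. f k \<in> carrier H"
    "holds H f (Forall (n + n * n) (configuration_matrix n N ord R))"
    unfolding \<phi>_def configuration_sentence_def satisfies_def holds_foldr_Exists by blast
  have f: "f k \<in> carrier H" if "k < n + n * n" for k
    using f0(1) that by simp
  have *: "holds H (f(n + n * n := y)) (configuration_matrix n N ord R)" if "y \<in> carrier H" for y
    using f0(2) that by simp
  note ** = *[unfolded holds_configuration_matrix]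
  \<comment> \<open>The conjuncts on powers and on commutation do not mention the universal
    variable, so a single value in the carrier extracts them.\<close>
  have one: "\<one>\<^bsub>H\<^esub> \<in> carrier H" using H by (simp add: group.is_monoid monoid.one_closed)
  show ?thesis
  proof (rule that[of f])
    show "f i \<in> carrier H" if "i < n" for i using f that by simp
    show "\<not> conjugate H (f i) (f j)" if ij: "i < n" "j < n" "i \<noteq> j" for i j
      using conjunct1[OF **, rule_format, OF _ ij] ij by (auto simp: conjugate_def)
    show "f i [^]\<^bsub>H\<^esub> d = \<one>\<^bsub>H\<^esub> \<longleftrightarrow> x i [^]\<^bsub>G\<^esub> d = \<one>\<^bsub>G\<^esub>" if "i < n" "d < N" for i d
      using conjunct1[OF conjunct2[OF **[OF one]], rule_format, OF that] that
      by (auto simp: ord_def)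
    show "conj_commute H (f i) (f j)" if ij: "i < n" "j < n" and c: "conj_commute G (x i) (x j)" for i j
    proof -
      have neq: "n + i * n + j \<noteq> n + n * n" "n + i * n + j < n + n * n"
        using index_bound[OF ij] by simp_all
      show ?thesis
        using conjunct2[OF conjunct2[OF **[OF one]], rule_format, OF ij] c ij neq f[OF neq(2)]
        unfolding conj_commute_def R_def
        by (intro bexI[of _ "f (n + i * n + j)"]) (auto simp: conj_commute_def)
    qed
  qed
qed

section \<open>Conjugacy in a group\<close>

context group
begin

lemma conjugateI: "g \<in> carrier G \<Longrightarrow> g \<otimes> x = y \<otimes> g \<Longrightarrow> conjugate G x y"
  by (auto simp: conjugate_def)

lemma conjugate_iff:
  assumes "x \<in> carrier G" "y \<in> carrier G"
  shows "conjugate G x y \<longleftrightarrow> (\<exists>g\<in>carrier G. y = g \<otimes> x \<otimes> inv g)"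
  unfolding conjugate_def using assms inv_solve_right by (metis m_closed)

lemma conjugate_refl: "x \<in> carrier G \<Longrightarrow> conjugate G x x"
  by (intro conjugateI[of \<one>]) auto

lemma conjugate_sym:
  assumes "x \<in> carrier G" "y \<in> carrier G" "conjugate G x y"
  shows "conjugate G y x"
proof -
  obtain g where g: "g \<in> carrier G" "g \<otimes> x = y \<otimes> g" using assms by (auto simp: conjugate_def)
  have "inv g \<otimes> y = inv g \<otimes> (y \<otimes> g) \<otimes> inv g" using g(1) assms by (simp add: m_assoc)
  also have "\<dots> = x \<otimes> inv g" using g assms by (simp flip: g(2) m_assoc)
  finally show ?thesis using g by (intro conjugateI[of "inv g"]) auto
qed

lemma conjugate_trans:
  assumes "x \<in> carrier G" "y \<in> carrier G" "z \<in> carrier G" "conjugate G x y" "conjugate G y z"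
  shows "conjugate G x z"
proof -
  obtain g h where g: "g \<in> carrier G" "g \<otimes> x = y \<otimes> g" and h: "h \<in> carrier G" "h \<otimes> y = z \<otimes> h"
    using assms by (auto simp: conjugate_def)
  have "h \<otimes> g \<otimes> x = h \<otimes> (g \<otimes> x)" using g(1) h(1) assms(1-3) by (simp add: m_assoc)
  also have "\<dots> = h \<otimes> y \<otimes> g" unfolding g(2) using g(1) h(1) assms(1-3) by (simp add: m_assoc)
  also have "\<dots> = z \<otimes> (h \<otimes> g)" unfolding h(2) using g(1) h(1) assms(1-3) by (simp add: m_assoc)
  finally show ?thesis using g h by (intro conjugateI[of "h \<otimes> g"]) auto
qed

lemma conjugate_pow:
  assumes "x \<in> carrier G" "y \<in> carrier G" "conjugate G x y" 
  shows "conjugate G (x [^] (n::nat)) (y [^] n)"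
proof -
  obtain g where g: "g \<in> carrier G" "g \<otimes> x = y \<otimes> g" using assms by (auto simp: conjugate_def)
  have "g \<otimes> x [^] n = y [^] n \<otimes> g"
  proof (induction n)
    case (Suc n)
    have "g \<otimes> x [^] Suc n = y [^] n \<otimes> (g \<otimes> x)"
      using Suc g(1) assms(1,2) by (simp flip: m_assoc)
    also have "\<dots> = y [^] n \<otimes> (y \<otimes> g)" by (simp only: g(2))
    also have "\<dots> = y [^] Suc n \<otimes> g" using g(1) assms by (simp add: m_assoc)
    finally show ?case .
  qed (use g in simp)
  with g show ?thesis by (intro conjugateI)
qed

lemma conjugate_one_iff:
  assumes "x \<in> carrier G" "conjugate G x y" "y \<in> carrier G"
  shows "x = \<one> \<longleftrightarrow> y = \<one>"
  using assms by (auto simp: conjugate_def)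

lemma conjugate_pow_one_iff:
  assumes "x \<in> carrier G" "conjugate G x y" "y \<in> carrier G"
  shows "x [^] (n::nat) = \<one> \<longleftrightarrow> y [^] n = \<one>"
  using assms by (intro conjugate_one_iff conjugate_pow) auto

end

lemma conjugate_hom:
  assumes "f \<in> hom G H" "conjugate G x y" "x \<in> carrier G" "y \<in> carrier G"
  shows "conjugate H (f x) (f y)"
proof -
  obtain g where g: "g \<in> carrier G" "g \<otimes>\<^bsub>G\<^esub> x = y \<otimes>\<^bsub>G\<^esub> g" using assms by (auto simp: conjugate_def)
  have "f g \<otimes>\<^bsub>H\<^esub> f x = f y \<otimes>\<^bsub>H\<^esub> f g" using g assms by (simp flip: hom_mult)
  with g assms show ?thesis unfolding conjugate_def by (auto simp: hom_def)
qed


section \<open>Reduced words\<close>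

text \<open>Following Crisp, Godelle and Wiest, the graph product acts on pilings: each vertex carries a
  stack of beads, and a syllable at \<open>i\<close> puts a labelled bead on the stack of \<open>i\<close> and a blank bead
  \<open>None\<close> on the stack of every vertex that is neither \<open>i\<close> nor adjacent to \<open>i\<close>.\<close>

context graph_prod
begin

definition push :: "'v \<Rightarrow> 'a \<Rightarrow> ('v \<Rightarrow> 'a option list) \<Rightarrow> ('v \<Rightarrow> 'a option list)" where
  "push i a \<sigma> = (\<lambda>j. if j = i then Some a # \<sigma> j else if (i, j) \<in> E then \<sigma> j else None # \<sigma> j)"

text \<open>A blank on top of the stack of \<open>i\<close> records a syllable pushed since at a
  vertex neither equal nor adjacent to \<open>i\<close>. A label on top is a syllable at
  \<open>i\<close> that can be moved to the front of the word.\<close>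

definition on_top :: "'v \<Rightarrow> ('v \<Rightarrow> 'a option list) \<Rightarrow> bool" where
  "on_top i \<sigma> \<longleftrightarrow> (\<exists>a s. \<sigma> i = Some a # s)"

text \<open>A bead is pushed only where it cannot merge with an earlier one at the same vertex, so
  these are the configurations built by reduced words.\<close>

inductive_set pilings :: "('v \<Rightarrow> 'a option list) set" where
  empty: "(\<lambda>_. []) \<in> pilings"
| push: "\<sigma> \<in> pilings \<Longrightarrow> i \<in> V \<Longrightarrow> a \<in> carrier (A i) \<Longrightarrow> a \<noteq> \<one>\<^bsub>A i\<^esub> \<Longrightarrow> \<not> on_top i \<sigma> \<Longrightarrow>
    push i a \<sigma> \<in> pilings"

lemma push_eq_iff: "push i a \<sigma> = push i b \<tau> \<longleftrightarrow> a = b \<and> \<sigma> = \<tau>"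
proof
  assume *: "push i a \<sigma> = push i b \<tau>"
  have "\<sigma> j = \<tau> j" for j
    using fun_cong[OF *, of j] by (auto simp: push_def split: if_splits)
  moreover have "a = b"
    using fun_cong[OF *, of i] by (simp add: push_def)
  ultimately show "a = b \<and> \<sigma> = \<tau>" by auto
qed simp

lemma push_commute: "(i, j) \<in> E \<Longrightarrow> push i a (push j b \<sigma>) = push j b (push i a \<sigma>)"
  using edge_sym edge_irrefl by (fastforce simp: push_def)

lemma on_top_push: "on_top j (push i a \<sigma>) \<longleftrightarrow> j = i \<or> (i, j) \<in> E \<and> on_top j \<sigma>"
  by (auto simp: on_top_def push_def edge_irrefl)

text \<open>If the last push was at another vertex \<open>j\<close>, it has left the stack of
  \<open>i\<close> without a new blank, so \<open>j\<close> is adjacent to \<open>i\<close> and the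
  two pushes can be exchanged.\<close>

lemma on_top_pilings:
  "\<sigma> \<in> pilings \<Longrightarrow> on_top i \<sigma> \<Longrightarrow>
    \<exists>a \<tau>. \<sigma> = push i a \<tau> \<and> \<tau> \<in> pilings \<and> \<not> on_top i \<tau> \<and> a \<in> carrier (A i) \<and> a \<noteq> \<one>\<^bsub>A i\<^esub>"
proof (induction rule: pilings.induct)
  case empty
  then show ?case by (simp add: on_top_def)
next
  case (push \<sigma> j b)
  show ?case
  proof (cases "i = j")
    case True
    then show ?thesis using push by blast
  next
    case False
    then have ji: "(j, i) \<in> E" "(i, j) \<in> E" "on_top i \<sigma>"
      using push.prems edge_sym by (auto simp: on_top_push)
    then obtain a \<tau> where *: "\<sigma> = push i a \<tau>" "\<tau> \<in> pilings" "\<not> on_top i \<tau>" "a \<in> carrier (A i)"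
      "a \<noteq> \<one>\<^bsub>A i\<^esub>" using push.IH by blast
    then have "\<not> on_top j \<tau>" using push.hyps ji by (auto simp: on_top_push)
    then have "push j b \<tau> \<in> pilings" using * push.hyps by (intro pilings.push)
    moreover have "push j b \<sigma> = push i a (push j b \<tau>)" using * ji push_commute by simp
    moreover have "\<not> on_top i (push j b \<tau>)" using * False by (simp add: on_top_push)
    ultimately show ?thesis using * by blast
  qed
qed

text \<open>For a vertex \<open>i\<close>, each piling is \<open>push1 i a \<tau>\<close> for
  exactly one \<open>a\<close> in \<open>A i\<close> and one \<open>\<tau>\<close> in
  \<open>bare i\<close>. So the pilings are a product of \<open>A i\<close> and
  \<open>bare i\<close>, and \<open>act i\<close> is left multiplication on the first
  factor.\<close>

definition bare :: "'v \<Rightarrow> ('v \<Rightarrow> 'a option list) set" where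
  "bare i = {\<tau> \<in> pilings. \<not> on_top i \<tau>}"

definition push1 :: "'v \<Rightarrow> 'a \<Rightarrow> ('v \<Rightarrow> 'a option list) \<Rightarrow> ('v \<Rightarrow> 'a option list)" where
  "push1 i a \<tau> = (if a = \<one>\<^bsub>A i\<^esub> then \<tau> else push i a \<tau>)"

lemma push1_pilings: "i \<in> V \<Longrightarrow> a \<in> carrier (A i) \<Longrightarrow> \<tau> \<in> bare i \<Longrightarrow> push1 i a \<tau> \<in> pilings"
  by (auto simp: push1_def bare_def intro: pilings.push)

lemma push1_exhaust:
  assumes "i \<in> V" "\<sigma> \<in> pilings"
  obtains a \<tau> where "a \<in> carrier (A i)" "\<tau> \<in> bare i" "\<sigma> = push1 i a \<tau>"
proof (cases "on_top i \<sigma>")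
  case True
  then show ?thesis
    using on_top_pilings[OF assms(2)] that by (fastforce simp: push1_def bare_def)
next
  case False
  then show ?thesis
    using assms vertex_groups that[of "\<one>\<^bsub>A i\<^esub>" \<sigma>]
    by (simp add: push1_def bare_def group.is_monoid monoid.one_closed)
qed

lemma push1_eq_iff:
  "\<tau> \<in> bare i \<Longrightarrow> \<rho> \<in> bare i \<Longrightarrow> push1 i a \<tau> = push1 i b \<rho> \<longleftrightarrow> a = b \<and> \<tau> = \<rho>"
  by (auto simp: push1_def push_eq_iff bare_def on_top_push)

definition act :: "'v \<Rightarrow> 'a \<Rightarrow> ('v \<Rightarrow> 'a option list) \<Rightarrow> ('v \<Rightarrow> 'a option list)" where
  "act i a \<sigma> = (THE \<rho>. \<exists>b\<in>carrier (A i). \<exists>\<tau>\<in>bare i. \<sigma> = push1 i b \<tau> \<and> \<rho> = push1 i (a \<otimes>\<^bsub>A i\<^esub> b) \<tau>)"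

lemma act_push1:
  assumes "b \<in> carrier (A i)" "\<tau> \<in> bare i"
  shows "act i a (push1 i b \<tau>) = push1 i (a \<otimes>\<^bsub>A i\<^esub> b) \<tau>"
  unfolding act_def
  by (rule the_equality) (use assms in \<open>auto simp: push1_eq_iff\<close>)

lemma act_pilings: "i \<in> V \<Longrightarrow> a \<in> carrier (A i) \<Longrightarrow> \<sigma> \<in> pilings \<Longrightarrow> act i a \<sigma> \<in> pilings"
  by (metis act_push1 group.is_monoid monoid.m_closed push1_exhaust push1_pilings vertex_groups)

lemma act_mult:
  assumes "i \<in> V" "a \<in> carrier (A i)" "b \<in> carrier (A i)" "\<sigma> \<in> pilings"
  shows "act i (a \<otimes>\<^bsub>A i\<^esub> b) \<sigma> = act i a (act i b \<sigma>)"
proof -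
  interpret Ai: group "A i" using vertex_groups assms by auto
  obtain c \<tau> where "c \<in> carrier (A i)" "\<tau> \<in> bare i" "\<sigma> = push1 i c \<tau>"
    using push1_exhaust assms by metis
  then show ?thesis using assms by (simp add: act_push1 Ai.m_assoc)
qed

lemma act_one:
  assumes "i \<in> V" "\<sigma> \<in> pilings"
  shows "act i \<one>\<^bsub>A i\<^esub> \<sigma> = \<sigma>"
proof -
  interpret Ai: group "A i" using vertex_groups assms by auto
  obtain c \<tau> where "c \<in> carrier (A i)" "\<tau> \<in> bare i" "\<sigma> = push1 i c \<tau>"
    using push1_exhaust assms by metis
  then show ?thesis by (simp add: act_push1)
qed

lemma push1_bare:
  assumes "(i, j) \<in> E" "\<tau> \<in> bare i" "\<tau> \<in> bare j" "a \<in> carrier (A i)"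
  shows "push1 i a \<tau> \<in> bare j"
  using assms edgeV[OF assms(1)] push1_pilings[of i a \<tau>] edge_irrefl
  by (auto simp: bare_def push1_def on_top_push)

text \<open>Stripping the beads on top at \<open>i\<close> and \<open>j\<close> leaves a piling
  \<open>\<rho>\<close> that is bare for both. Adjacent pushes commute, so each action changes only
  its own label above \<open>\<rho>\<close>.\<close>

lemma act_commute:
  assumes ij: "(i, j) \<in> E" and a: "a \<in> carrier (A i)" and b: "b \<in> carrier (A j)"
    and \<sigma>: "\<sigma> \<in> pilings"
  shows "act i a (act j b \<sigma>) = act j b (act i a \<sigma>)"
proof -
  have V: "i \<in> V" "j \<in> V" using ij edgeV by auto
  note ji = edge_sym[OF ij]
  interpret Ai: group "A i" using vertex_groups V by auto
  interpret Aj: group "A j" using vertex_groups V by auto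
  obtain c \<tau> where c: "c \<in> carrier (A i)" "\<tau> \<in> bare i" "\<sigma> = push1 i c \<tau>"
    using push1_exhaust V \<sigma> by metis
  have "\<tau> \<in> pilings" using c by (simp add: bare_def)
  then obtain d \<rho> where d: "d \<in> carrier (A j)" "\<rho> \<in> bare j" "\<tau> = push1 j d \<rho>"
    using push1_exhaust V by metis
  have \<rho>: "\<rho> \<in> bare i"
    using c(2) d ji by (auto simp: bare_def push1_def on_top_push split: if_splits)
  have comm: "push1 i x (push1 j y \<rho>) = push1 j y (push1 i x \<rho>)" for x y
    using push_commute[OF ij] by (auto simp: push1_def)
  note bs = push1_bare[OF ij \<rho> d(2)] push1_bare[OF ji d(2) \<rho>]
  have "act i a (act j b \<sigma>) = act i a (act j b (push1 j d (push1 i c \<rho>)))"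
    by (simp add: c d comm)
  also have "\<dots> = act i a (push1 j (b \<otimes>\<^bsub>A j\<^esub> d) (push1 i c \<rho>))"
    using bs(1)[OF c(1)] d by (simp add: act_push1)
  also have "\<dots> = act i a (push1 i c (push1 j (b \<otimes>\<^bsub>A j\<^esub> d) \<rho>))"
    by (simp only: comm)
  also have "\<dots> = push1 i (a \<otimes>\<^bsub>A i\<^esub> c) (push1 j (b \<otimes>\<^bsub>A j\<^esub> d) \<rho>)"
    using bs(2)[of "b \<otimes>\<^bsub>A j\<^esub> d"] b c d by (simp add: act_push1)
  also have "\<dots> = push1 j (b \<otimes>\<^bsub>A j\<^esub> d) (push1 i (a \<otimes>\<^bsub>A i\<^esub> c) \<rho>)"
    by (rule comm)
  also have "\<dots> = act j b (push1 j d (push1 i (a \<otimes>\<^bsub>A i\<^esub> c) \<rho>))"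
    using bs(1)[of "a \<otimes>\<^bsub>A i\<^esub> c"] a c d by (simp add: act_push1)
  also have "\<dots> = act j b (push1 i (a \<otimes>\<^bsub>A i\<^esub> c) (push1 j d \<rho>))"
    by (simp only: comm)
  also have "\<dots> = act j b (act i a \<sigma>)"
    using c d by (simp add: act_push1)
  finally show ?thesis .
qed

lemma act_extension:
  obtains f where "f \<in> hom GP (BijGroup pilings)"
    "\<And>i a \<sigma>. i \<in> V \<Longrightarrow> a \<in> carrier (A i) \<Longrightarrow> \<sigma> \<in> pilings \<Longrightarrow> f (gen i a) \<sigma> = act i a \<sigma>"
proof -
  \<comment> \<open>\<open>Bij\<close> consists of extensional functions, hence the
    restriction.\<close>
  define h where "h i a = restrict (act i a) pilings" for i a
  have hB: "h i a \<in> Bij pilings" if "i \<in> V" "a \<in> carrier (A i)" for i a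
  proof -
    interpret Ai: group "A i" using vertex_groups that by auto
    have "bij_betw (act i a) pilings pilings"
      using that act_pilings act_one
      by (intro bij_betw_byWitness[where f' = "act i (inv\<^bsub>A i\<^esub> a)"])
        (auto simp flip: act_mult)
    then show ?thesis by (simp add: h_def Bij_def bij_betw_def inj_on_def)
  qed
  have comp: "compose pilings (h i a) (h j b) = restrict (\<lambda>\<sigma>. act i a (act j b \<sigma>)) pilings"
    if "j \<in> V" "b \<in> carrier (A j)" for i j a b
    using that act_pilings by (auto simp: h_def compose_def)
  obtain f where f: "f \<in> hom GP (BijGroup pilings)"
    "\<And>i a. i \<in> V \<Longrightarrow> a \<in> carrier (A i) \<Longrightarrow> f (gen i a) = h i a"
  proof (rule hom_extension[where h = h and L = "BijGroup pilings"])
    show "group (BijGroup pilings)" by (rule group_BijGroup)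
    fix i assume i: "i \<in> V"
    interpret Ai: group "A i" using vertex_groups i by auto
    show "h i \<in> hom (A i) (BijGroup pilings)"
    proof (rule homI)
      fix a b assume "a \<in> carrier (A i)" "b \<in> carrier (A i)"
      then show "h i (a \<otimes>\<^bsub>A i\<^esub> b) = h i a \<otimes>\<^bsub>BijGroup pilings\<^esub> h i b"
        using i hB by (simp add: BijGroup_def comp) (auto simp: h_def act_mult)
    qed (use hB i in \<open>simp add: BijGroup_def\<close>)
  next
    fix i j a b assume ij: "(i, j) \<in> E" "a \<in> carrier (A i)" "b \<in> carrier (A j)"
    then show "h i a \<otimes>\<^bsub>BijGroup pilings\<^esub> h j b = h j b \<otimes>\<^bsub>BijGroup pilings\<^esub> h i a"
      using edgeV[OF ij(1)] hB by (auto simp: BijGroup_def comp act_commute[OF ij])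
  qed blast
  then show ?thesis using that by (auto simp: h_def)
qed

text \<open>The vertices at which a syllable can be shuffled to the front of the word, passing only
  syllables at adjacent vertices.\<close>

fun first_verts :: "('v \<times> 'a) list \<Rightarrow> 'v set" where
  "first_verts [] = {}"
| "first_verts ((j, b) # w) = insert j {i \<in> first_verts w. (i, j) \<in> E}"

abbreviation "last_verts w \<equiv> first_verts (rev w)"

text \<open>No syllable is trivial, and no two syllables at one vertex can be shuffled next to each
  other.\<close>

fun reduced :: "('v \<times> 'a) list \<Rightarrow> bool" where
  "reduced [] \<longleftrightarrow> True"
| "reduced ((j, b) # w) \<longleftrightarrow> b \<noteq> \<one>\<^bsub>A j\<^esub> \<and> j \<notin> first_verts w \<and> reduced w"

text \<open>On the empty piling a reduced word pushes one label for each syllable and never merges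
  or removes one. The vertices on top at the end are \<open>first_verts w\<close>, which is
  nonempty, whereas the identity leaves the piling empty.\<close>

theorem reduced_nontrivial:
  assumes "w \<in> sylls" "reduced w" "w \<noteq> []"
  shows "ev w \<noteq> \<one>\<^bsub>GP\<^esub>"
proof
  assume ev: "ev w = \<one>\<^bsub>GP\<^esub>"
  obtain f where f: "f \<in> hom GP (BijGroup pilings)"
    "\<And>i a \<sigma>. i \<in> V \<Longrightarrow> a \<in> carrier (A i) \<Longrightarrow> \<sigma> \<in> pilings \<Longrightarrow> f (gen i a) \<sigma> = act i a \<sigma>"
    using act_extension by blast
  have one: "f \<one>\<^bsub>GP\<^esub> = restrict (\<lambda>\<sigma>. \<sigma>) pilings"
    using hom_one[OF f(1) GP.is_group group_BijGroup] by (simp add: BijGroup_def)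
  have "f (ev w) (\<lambda>_. []) \<in> pilings \<and> (\<forall>i. on_top i (f (ev w) (\<lambda>_. [])) \<longleftrightarrow> i \<in> first_verts w)"
    using assms(1,2)
  proof (induction w rule: reduced.induct)
    case 1
    show ?case by (simp add: one pilings.empty on_top_def)
  next
    case (2 j b w)
    let ?\<sigma> = "f (ev w) (\<lambda>_. [])"
    have j: "j \<in> V" "b \<in> carrier (A j)" "w \<in> sylls" using 2 by (auto simp: graph_product_gens_def)
    interpret Aj: group "A j" using vertex_groups j by auto
    have \<sigma>: "?\<sigma> \<in> bare j" "\<And>i. on_top i ?\<sigma> \<longleftrightarrow> i \<in> first_verts w"
      using 2 by (auto simp: bare_def)
    have "f x \<in> Bij pilings" if "x \<in> carrier GP" for x
      using f(1) that by (auto simp: hom_def BijGroup_def)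
    then have B: "f (gen j b) \<in> Bij pilings" "f (ev w) \<in> Bij pilings"
      using j by auto
    have "f (ev ((j, b) # w)) (\<lambda>_. []) = f (gen j b) ?\<sigma>"
      using f(1) j B by (simp add: hom_mult BijGroup_def compose_def pilings.empty)
    \<comment> \<open>Since \<open>j\<close> is not on top, \<open>?\<sigma>\<close> is its own bare
      part, with trivial label.\<close>
    also have "\<dots> = act j b (push1 j \<one>\<^bsub>A j\<^esub> ?\<sigma>)"
      using f(2) j \<sigma> by (simp add: bare_def push1_def)
    also have "\<dots> = push j b ?\<sigma>"
      using j \<sigma> 2 by (simp add: act_push1) (simp add: push1_def)
    finally have *: "f (ev ((j, b) # w)) (\<lambda>_. []) = push j b ?\<sigma>" .
    have "push j b ?\<sigma> \<in> pilings"
      using \<sigma> j 2 by (intro pilings.push) (auto simp: bare_def)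
    then show ?case
      using \<sigma>(2) edge_sym unfolding * by (auto simp: on_top_push)
  qed
  moreover have "first_verts w \<noteq> {}" using assms(3) by (cases w) auto
  ultimately show False by (auto simp: ev one pilings.empty on_top_def)
qed

lemma first_verts_subset: "first_verts w \<subseteq> fst ` set w"
  by (induction w rule: first_verts.induct) auto

lemma first_verts_append:
  "first_verts (u @ v) = first_verts u \<union> {i \<in> first_verts v. \<forall>x\<in>set u. (i, fst x) \<in> E}"
  by (induction u rule: first_verts.induct) auto

text \<open>The only new obstruction is that, up to shuffling, a syllable at the end of
  \<open>u\<close> meets one at the same vertex at the beginning of \<open>v\<close>.\<close>

lemma reduced_append:
  "reduced (u @ v) \<longleftrightarrow> reduced u \<and> reduced v \<and> last_verts u \<inter> first_verts v = {}"
  by (induction u rule: reduced.induct) (auto simp: first_verts_append)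

text \<open>Powers of a cyclically reduced word are reduced. The bound on the first vertices carries
  the induction: a further one would occur in \<open>u\<close> and also be adjacent to every vertex
  of \<open>u\<close>, hence to itself.\<close>

lemma reduced_replicate:
  assumes u: "reduced u" "last_verts u \<inter> first_verts u = {}"
  shows "reduced (concat (replicate n u)) \<and> first_verts (concat (replicate n u)) \<subseteq> first_verts u"
proof (induction n)
  case (Suc n)
  have "first_verts (concat (replicate n u)) \<subseteq> fst ` set u"
    using first_verts_subset[of "concat (replicate n u)"]
    by (auto simp: set_replicate_conv_if split: if_splits)
  then show ?case
    using Suc u edge_irrefl by (fastforce simp: reduced_append first_verts_append)
qed simp

lemma first_verts_split:
  "i \<in> first_verts w \<Longrightarrow> \<exists>p a r. w = p @ (i, a) # r \<and> (\<forall>x\<in>set p. (i, fst x) \<in> E)"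
proof (induction w rule: first_verts.induct)
  case (2 j b w)
  show ?case
  proof (cases "i = j")
    case True
    then show ?thesis by (intro exI[of _ "[]"]) auto
  next
    case False
    then obtain p a r where "w = p @ (i, a) # r" "\<forall>x\<in>set p. (i, fst x) \<in> E" "(i, j) \<in> E"
      using 2 by auto
    then show ?thesis by (intro exI[of _ "(j, b) # p"]) auto
  qed
qed simp

lemma last_verts_split:
  assumes "i \<in> last_verts w"
  shows "\<exists>p a r. w = p @ (i, a) # r \<and> (\<forall>x\<in>set r. (i, fst x) \<in> E)"
proof -
  obtain p a r where *: "rev w = p @ (i, a) # r" "\<forall>x\<in>set p. (i, fst x) \<in> E"
    using first_verts_split[OF assms] by blast
  have "w = rev r @ (i, a) # rev p" using arg_cong[OF *(1), of rev] by simp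
  with * show ?thesis by (metis set_rev)
qed

lemma sylls_iff: "w \<in> sylls \<longleftrightarrow> (\<forall>(i, a)\<in>set w. i \<in> V \<and> a \<in> carrier (A i))"
  by (auto simp: graph_product_gens_def)

lemma gen_ev_commute:
  assumes x: "x \<in> carrier GP" and w: "w \<in> sylls"
    and "\<And>i a. (i, a) \<in> set w \<Longrightarrow> x \<otimes>\<^bsub>GP\<^esub> gen i a = gen i a \<otimes>\<^bsub>GP\<^esub> x"
  shows "x \<otimes>\<^bsub>GP\<^esub> ev w = ev w \<otimes>\<^bsub>GP\<^esub> x"
  using w assms(3)
proof (induction w rule: ev.induct)
  case (2 i a w)
  then have c: "gen i a \<in> carrier GP" "ev w \<in> carrier GP" by (auto simp: sylls_iff)
  have "x \<otimes>\<^bsub>GP\<^esub> (gen i a \<otimes>\<^bsub>GP\<^esub> ev w) = gen i a \<otimes>\<^bsub>GP\<^esub> (x \<otimes>\<^bsub>GP\<^esub> ev w)"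
    using c x 2(3)[of i a] by (simp flip: GP.m_assoc)
  also have "\<dots> = gen i a \<otimes>\<^bsub>GP\<^esub> ev w \<otimes>\<^bsub>GP\<^esub> x"
    using c x 2 by (simp add: GP.m_assoc)
  finally show ?case by simp
qed (use x in simp)

lemma ev_commute:
  assumes u: "u \<in> sylls" and w: "w \<in> sylls"
    and comm: "\<And>i a j b. (i, a) \<in> set u \<Longrightarrow> (j, b) \<in> set w \<Longrightarrow>
      gen i a \<otimes>\<^bsub>GP\<^esub> gen j b = gen j b \<otimes>\<^bsub>GP\<^esub> gen i a"
  shows "ev u \<otimes>\<^bsub>GP\<^esub> ev w = ev w \<otimes>\<^bsub>GP\<^esub> ev u"
proof (rule gen_ev_commute[OF ev_closed[OF u] w])
  fix j b assume jb: "(j, b) \<in> set w"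
  have "gen j b \<otimes>\<^bsub>GP\<^esub> ev u = ev u \<otimes>\<^bsub>GP\<^esub> gen j b"
  proof (rule gen_ev_commute[OF _ u])
    show "gen j b \<in> carrier GP" using jb w by (auto simp: sylls_iff)
  qed (use comm jb in metis)
  then show "ev u \<otimes>\<^bsub>GP\<^esub> gen j b = gen j b \<otimes>\<^bsub>GP\<^esub> ev u" by simp
qed

lemma gen_ev_edge_commute:
  assumes "i \<in> V" "a \<in> carrier (A i)" "w \<in> sylls" "\<forall>x\<in>set w. (i, fst x) \<in> E"
  shows "gen i a \<otimes>\<^bsub>GP\<^esub> ev w = ev w \<otimes>\<^bsub>GP\<^esub> gen i a"
proof (rule gen_ev_commute[OF _ assms(3)])
  fix j b assume "(j, b) \<in> set w"
  then show "gen i a \<otimes>\<^bsub>GP\<^esub> gen j b = gen j b \<otimes>\<^bsub>GP\<^esub> gen i a"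
    using assms by (intro gen_commute) (auto simp: sylls_iff)
qed (use assms in simp)

lemma ev_filter:
  assumes "w \<in> sylls" "\<And>x y. x \<in> set w \<Longrightarrow> y \<in> set w \<Longrightarrow> P x \<Longrightarrow> \<not> P y \<Longrightarrow> (fst x, fst y) \<in> E"
  shows "ev w = ev (filter P w) \<otimes>\<^bsub>GP\<^esub> ev (filter (\<lambda>x. \<not> P x) w)"
  using assms
proof (induction w rule: ev.induct)
  case (2 i a w)
  let ?p = "ev (filter P w)" and ?q = "ev (filter (\<lambda>x. \<not> P x) w)"
  have s: "filter P w \<in> sylls" "filter (\<lambda>x. \<not> P x) w \<in> sylls" using 2 by auto
  then have c: "?p \<in> carrier GP" "?q \<in> carrier GP" by (auto intro!: ev_closed)
  have ia: "i \<in> V" "a \<in> carrier (A i)" using 2 by (auto simp: sylls_iff)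
  have IH: "ev w = ?p \<otimes>\<^bsub>GP\<^esub> ?q" using 2 by auto
  show ?case
  proof (cases "P (i, a)")
    case False
    have "gen i a \<otimes>\<^bsub>GP\<^esub> ?p = ?p \<otimes>\<^bsub>GP\<^esub> gen i a"
    proof (rule gen_ev_edge_commute[OF ia s(1)], intro ballI)
      fix x assume "x \<in> set (filter P w)"
      then have "(fst x, i) \<in> E" using 2(3)[of x "(i, a)"] False by auto
      then show "(i, fst x) \<in> E" by (rule edge_sym)
    qed
    then show ?thesis using False c ia by (simp add: IH flip: GP.m_assoc)
  qed (use c ia in \<open>simp add: IH GP.m_assoc\<close>)
qed simp

text \<open>Each failure saves a syllable: a trivial one is dropped, one that can be brought next to
  another at the same vertex is merged with it, and otherwise the tail is shortened.\<close>

lemma not_reduced_shorten: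
  "w \<in> sylls \<Longrightarrow> \<not> reduced w \<Longrightarrow> \<exists>w'\<in>sylls. length w' < length w \<and> ev w' = ev w"
proof (induction w rule: reduced.induct)
  case (2 j b w)
  have j: "j \<in> V" "b \<in> carrier (A j)" "w \<in> sylls" using 2 by (auto simp: sylls_iff)
  interpret Aj: group "A j" using vertex_groups j by auto
  consider "b = \<one>\<^bsub>A j\<^esub>" | "j \<in> first_verts w" | "\<not> reduced w" using 2 by auto
  then show ?case
  proof cases
    case 1
    then show ?thesis using j by (intro bexI[of _ w]) auto
  next
    case 2
    then obtain p c r where w: "w = p @ (j, c) # r" and p: "\<forall>x\<in>set p. (j, fst x) \<in> E"
      using first_verts_split by blast
    have s: "p \<in> sylls" "r \<in> sylls" "c \<in> carrier (A j)" using j w by (auto simp: sylls_iff)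
    have "ev ((j, b \<otimes>\<^bsub>A j\<^esub> c) # p @ r) = gen j b \<otimes>\<^bsub>GP\<^esub> (gen j c \<otimes>\<^bsub>GP\<^esub> ev p) \<otimes>\<^bsub>GP\<^esub> ev r"
      using j s by (simp add: ev_append gen_mult[symmetric] GP.m_assoc)
    also have "gen j c \<otimes>\<^bsub>GP\<^esub> ev p = ev p \<otimes>\<^bsub>GP\<^esub> gen j c"
      using j s p by (intro gen_ev_edge_commute)
    also have "gen j b \<otimes>\<^bsub>GP\<^esub> (ev p \<otimes>\<^bsub>GP\<^esub> gen j c) \<otimes>\<^bsub>GP\<^esub> ev r = ev ((j, b) # w)"
      using j s w by (simp add: ev_append GP.m_assoc)
    finally show ?thesis
      using j s w by (intro bexI[of _ "(j, b \<otimes>\<^bsub>A j\<^esub> c) # p @ r"]) (auto simp: sylls_iff)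
  next
    case 3
    then obtain w' where "w' \<in> sylls" "length w' < length w" "ev w' = ev w"
      using 2 j by blast
    then show ?thesis using j by (intro bexI[of _ "(j, b) # w'"]) (auto simp: sylls_iff)
  qed
qed simp

end


section \<open>Elements of finite order\<close>

context graph_prod
begin

definition torsion :: "('v \<times> 'a) word set \<Rightarrow> bool" where
  "torsion x \<longleftrightarrow> x \<in> carrier GP \<and> (\<exists>n>0. x [^]\<^bsub>GP\<^esub> (n::nat) = \<one>\<^bsub>GP\<^esub>)"

text \<open>Reducedness forces the vertices to be distinct (\<open>clique_word_distinct\<close>), so
  such a word describes an element of the direct product of the vertex groups over a clique.\<close>

definition clique_word :: "('v \<times> 'a) list \<Rightarrow> bool" where
  "clique_word w \<longleftrightarrow> w \<in> sylls \<and> reduced w \<and>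
    (\<forall>x\<in>set w. \<forall>y\<in>set w. fst x \<noteq> fst y \<longrightarrow> (fst x, fst y) \<in> E)"

lemma concat_replicate_sylls: "u \<in> sylls \<Longrightarrow> concat (replicate n u) \<in> sylls"
  by (induction n) auto

lemma ev_edge_commute:
  assumes "u \<in> sylls" "w \<in> sylls" "\<And>x y. x \<in> set u \<Longrightarrow> y \<in> set w \<Longrightarrow> (fst x, fst y) \<in> E"
  shows "ev u \<otimes>\<^bsub>GP\<^esub> ev w = ev w \<otimes>\<^bsub>GP\<^esub> ev u"
proof (rule ev_commute[OF assms(1,2)])
  fix i a j b assume "(i, a) \<in> set u" "(j, b) \<in> set w"
  then show "gen i a \<otimes>\<^bsub>GP\<^esub> gen j b = gen j b \<otimes>\<^bsub>GP\<^esub> gen i a"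
    using assms(1,2) assms(3)[of "(i, a)" "(j, b)"] by (intro gen_commute) (auto simp: sylls_iff)
qed

lemma ev_concat_replicate:
  "u \<in> sylls \<Longrightarrow> ev (concat (replicate n u)) = ev u [^]\<^bsub>GP\<^esub> n"
proof (induction n)
  case (Suc n)
  have "concat (replicate n u) \<in> sylls" using Suc by (simp add: concat_replicate_sylls)
  then have "ev (concat (replicate (Suc n) u)) = ev u \<otimes>\<^bsub>GP\<^esub> ev u [^]\<^bsub>GP\<^esub> n"
    using Suc by (simp add: ev_append)
  also have "\<dots> = ev u [^]\<^bsub>GP\<^esub> Suc n"
    using Suc.prems by (intro GP.nat_pow_Suc2[symmetric]) simp
  finally show ?case .
qed simp

text \<open>Killing the generators outside \<open>K\<close> respects all relators. It lets finite
  order pass from a word to the part of it over \<open>K\<close>.\<close>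

lemma retraction:
  obtains f where "f \<in> hom GP GP" "\<And>w. w \<in> sylls \<Longrightarrow> f (ev w) = ev (filter (\<lambda>x. fst x \<in> K) w)"
proof -
  define h where "h i a = (if i \<in> K then gen i a else \<one>\<^bsub>GP\<^esub>)" for i a
  obtain f where f: "f \<in> hom GP GP"
    "\<And>i a. i \<in> V \<Longrightarrow> a \<in> carrier (A i) \<Longrightarrow> f (gen i a) = h i a"
  proof (rule hom_extension[where h = h and L = GP])
    show "group GP" by (rule GP.is_group)
    show "h i \<in> hom (A i) GP" if "i \<in> V" for i
      using that by (intro homI) (auto simp: h_def gen_mult)
    show "h i a \<otimes>\<^bsub>GP\<^esub> h j b = h j b \<otimes>\<^bsub>GP\<^esub> h i a"
      if "(i, j) \<in> E" "a \<in> carrier (A i)" "b \<in> carrier (A j)" for i j a b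
      using gen_commute[OF that] edgeV[OF that(1)] that by (auto simp: h_def)
  qed blast
  have "f (ev w) = ev (filter (\<lambda>x. fst x \<in> K) w)" if "w \<in> sylls" for w
    using that
  proof (induction w rule: ev.induct)
    case 1
    show ?case using hom_one[OF f(1) GP.is_group GP.is_group] by simp
  next
    case (2 i a w)
    then have c: "i \<in> V" "a \<in> carrier (A i)" "w \<in> sylls" by (auto simp: sylls_iff)
    have c': "ev (filter (\<lambda>x. fst x \<in> K) w) \<in> carrier GP" using c by (intro ev_closed) auto
    show ?case
      using 2(1) c c' f by (auto simp: hom_mult[OF f(1)] h_def)
  qed
  with f that show ?thesis by blast
qed

text \<open>In a shortest word among all words for conjugates of \<open>x\<close>, the syllables that commute with all
  other syllables can be moved to the front. The remaining part \<open>u\<close> is cyclically reduced, so its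
  powers are reduced; since \<open>u\<close> is a retract of that word, it has finite order and must be empty.\<close>

theorem torsion_conjugate_clique_word:
  assumes "torsion x"
  obtains w where "clique_word w" "conjugate GP x (ev w)"
proof -
  have x: "x \<in> carrier GP" using assms by (simp add: torsion_def)
  obtain n :: nat where n: "n > 0" "x [^]\<^bsub>GP\<^esub> n = \<one>\<^bsub>GP\<^esub>" using assms by (auto simp: torsion_def)
  define C where "C w \<longleftrightarrow> w \<in> sylls \<and> conjugate GP x (ev w)" for w
  have "\<exists>w. C w"
    using ev_exhaust[OF x] GP.conjugate_refl[OF x] unfolding C_def by metis
  then obtain w where w: "C w" and min: "\<And>w'. C w' \<Longrightarrow> length w \<le> length w'"
    using ex_has_least_nat[of C _ length] by metis
  \<comment> \<open>A vertex outside \<open>K\<close> is adjacent to all other vertices of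
    \<open>w\<close>, so its syllables can be moved freely.\<close>
  define K where "K = {i. \<exists>y\<in>set w. i \<noteq> fst y \<and> (i, fst y) \<notin> E}"
  define u where "u = filter (\<lambda>x. fst x \<in> K) w"
  define c where "c = filter (\<lambda>x. \<not> fst x \<in> K) w"
  have ws: "w \<in> sylls" using w by (simp add: C_def)
  then have s: "u \<in> sylls" "c \<in> sylls" by (auto simp: u_def c_def)
  have cE: "(i, fst y) \<in> E" if "i \<notin> K" "y \<in> set w" "i \<noteq> fst y" for i y
    using that by (auto simp: K_def)
  have cu_edge: "(fst x, fst y) \<in> E" if "x \<in> set c" "y \<in> set u" for x y
    using that by (intro cE) (auto simp: c_def u_def)
  have "ev w = ev u \<otimes>\<^bsub>GP\<^esub> ev c"
    unfolding u_def c_def by (rule ev_filter[OF ws]) (metis cE edge_sym)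
  also have "\<dots> = ev c \<otimes>\<^bsub>GP\<^esub> ev u"
    by (rule ev_edge_commute[OF s(2,1) cu_edge, symmetric])
  finally have ev_cu: "ev w = ev (c @ u)" by (simp add: ev_append s)
  have len: "length w = length (c @ u)"
    using sum_length_filter_compl[of "\<lambda>x. fst x \<in> K" w] by (simp add: u_def c_def)
  have Ccu: "C (c @ u)" using w s by (simp add: C_def ev_cu)
  \<comment> \<open>A word of minimal length is reduced, as \<open>not_reduced_shorten\<close> would
    otherwise give a shorter word for the same element.\<close>
  have "reduced w'" if "C w'" "length w' = length w" for w'
    using not_reduced_shorten[of w'] that min unfolding C_def by (metis not_le)
  then have red_cu: "reduced (c @ u)" and red_w: "reduced w" using Ccu len w by auto
  have "u = []"
  proof (rule ccontr)
    assume "u \<noteq> []"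
    have "i \<notin> first_verts u" if last: "i \<in> last_verts u" for i
    proof
      assume "i \<in> first_verts u"
      then obtain p a t where u: "u = p @ (i, a) # t" and p: "\<forall>x\<in>set p. (i, fst x) \<in> E"
        using first_verts_split by blast
      have i: "i \<in> V" "a \<in> carrier (A i)" using s u by (auto simp: sylls_iff)
      have "(i, a) \<in> set u" using u by simp
      then have iK: "i \<in> K" unfolding u_def by simp
      \<comment> \<open>Either \<open>i\<close> is adjacent to everything in \<open>u\<close> except
        this one syllable, which contradicts \<open>i \<in> K\<close>, or a second syllable at
        \<open>i\<close> can be moved to the end. Conjugation by the latter carries it to the front,
        past \<open>c\<close> and \<open>p\<close>, where it merges with the first and gives the
        shorter word \<open>w'\<close>.\<close>
      consider "\<forall>x\<in>set t. (i, fst x) \<in> E" | "i \<in> last_verts t"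
        using last by (auto simp: u first_verts_append)
      then show False
      proof cases
        case 1
        obtain y where y: "y \<in> set w" "i \<noteq> fst y" "(i, fst y) \<notin> E" using iK by (auto simp: K_def)
        then have "y \<notin> set u" using 1 p u by auto
        then have "fst y \<notin> K" using y by (auto simp: u_def)
        moreover have "(i, a) \<in> set w" using arg_cong[OF u, of set] by (auto simp: u_def)
        ultimately have "(fst y, i) \<in> E" using cE[of "fst y" "(i, a)"] y by auto
        then show False using y edge_sym by blast
      next
        case 2
        then obtain q b r where t: "t = q @ (i, b) # r" and r: "\<forall>x\<in>set r. (i, fst x) \<in> E"
          using last_verts_split by blast
        have b: "b \<in> carrier (A i)" and pqr: "p \<in> sylls" "q \<in> sylls" "r \<in> sylls"
          using s u t by (auto simp: sylls_iff)
        interpret Ai: group "A i" using vertex_groups i by auto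
        define w' where "w' = c @ p @ (i, b \<otimes>\<^bsub>A i\<^esub> a) # q @ r"
        have w's: "w' \<in> sylls" using i b pqr s by (auto simp: w'_def sylls_iff)
        let ?g = "gen i b"
        have cl: "?g \<in> carrier GP" "gen i a \<in> carrier GP" "ev c \<in> carrier GP" "ev p \<in> carrier GP"
          "ev q \<in> carrier GP" "ev r \<in> carrier GP"
          using i b pqr s by auto
        have gc: "?g \<otimes>\<^bsub>GP\<^esub> ev (c @ p) = ev (c @ p) \<otimes>\<^bsub>GP\<^esub> ?g"
        proof (intro gen_ev_edge_commute ballI)
          fix x assume "x \<in> set (c @ p)"
          then show "(i, fst x) \<in> E"
            using p cu_edge[of x "(i, a)"] edge_sym u by auto
        qed (use i b s pqr in auto)
        have gr: "?g \<otimes>\<^bsub>GP\<^esub> ev r = ev r \<otimes>\<^bsub>GP\<^esub> ?g"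
          using i b pqr r by (intro gen_ev_edge_commute)
        have "?g \<otimes>\<^bsub>GP\<^esub> ev (c @ u)
            = ?g \<otimes>\<^bsub>GP\<^esub> ev (c @ p) \<otimes>\<^bsub>GP\<^esub> gen i a \<otimes>\<^bsub>GP\<^esub> ev q \<otimes>\<^bsub>GP\<^esub> (?g \<otimes>\<^bsub>GP\<^esub> ev r)"
          using cl s pqr i b by (simp add: u t ev_append sylls_iff GP.m_assoc)
        also have "\<dots> = ev (c @ p) \<otimes>\<^bsub>GP\<^esub> ?g \<otimes>\<^bsub>GP\<^esub> gen i a \<otimes>\<^bsub>GP\<^esub> ev q \<otimes>\<^bsub>GP\<^esub> (ev r \<otimes>\<^bsub>GP\<^esub> ?g)"
          by (simp only: gc gr)
        also have "\<dots> = ev w' \<otimes>\<^bsub>GP\<^esub> ?g"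
        proof -
          have "(i, b \<otimes>\<^bsub>A i\<^esub> a) \<in> graph_product_gens V A"
            using i b by (simp add: graph_product_gens_def)
          then have "ev w' = ev (c @ p) \<otimes>\<^bsub>GP\<^esub> (?g \<otimes>\<^bsub>GP\<^esub> gen i a \<otimes>\<^bsub>GP\<^esub> (ev q \<otimes>\<^bsub>GP\<^esub> ev r))"
            using cl s pqr i b gen_mult[OF i(1) b i(2)] by (simp add: w'_def ev_append GP.m_assoc)
          then show ?thesis
            using cl s pqr by (simp add: GP.m_assoc)
        qed
        finally have "conjugate GP (ev (c @ u)) (ev w')"
          using cl by (intro GP.conjugateI)
        then have "C w'"
          using Ccu w's GP.conjugate_trans[OF x ev_closed[of "c @ u"] ev_closed[OF w's]]
          unfolding C_def by blast
        then show False using min[of w'] len by (simp add: w'_def u t)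
      qed
    qed
    then have "reduced (concat (replicate n u))"
      using reduced_replicate[of u n] red_cu by (auto simp: reduced_append)
    moreover have "concat (replicate n u) \<noteq> []" using \<open>u \<noteq> []\<close> n by (cases n) auto
    moreover have "concat (replicate n u) \<in> sylls" by (rule concat_replicate_sylls[OF s(1)])
    ultimately have ne: "ev u [^]\<^bsub>GP\<^esub> n \<noteq> \<one>\<^bsub>GP\<^esub>"
      using reduced_nontrivial ev_concat_replicate[OF s(1)] by metis
    obtain f where f: "f \<in> hom GP GP"
      "\<And>w. w \<in> sylls \<Longrightarrow> f (ev w) = ev (filter (\<lambda>x. fst x \<in> K) w)"
      using retraction by metis
    have "ev w [^]\<^bsub>GP\<^esub> n = \<one>\<^bsub>GP\<^esub>"
      using GP.conjugate_pow_one_iff[OF x _ ev_closed[OF ws], of n] w n by (simp add: C_def)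
    then have "f (ev w) [^]\<^bsub>GP\<^esub> n = \<one>\<^bsub>GP\<^esub>"
      using hom_nat_pow[OF f(1) ev_closed[OF ws] GP.is_group GP.is_group, of n]
        hom_one[OF f(1) GP.is_group GP.is_group] by simp
    then show False using ne f(2)[OF ws] by (simp add: u_def)
  qed
  then have "fst y \<notin> K" if "y \<in> set w" for y
    using that by (auto simp: u_def filter_empty_conv)
  then have "clique_word w"
    using red_w ws cE by (auto simp: clique_word_def)
  then show ?thesis using that w by (auto simp: C_def)
qed

text \<open>A repeated vertex would be adjacent to all other vertices in between, so two of its
  syllables could be shuffled together.\<close>

lemma clique_word_distinct:
  assumes "clique_word w"
  shows "distinct (map fst w)"
proof -
  have *: "j \<in> first_verts w"
    if "j \<in> fst ` set w" "\<And>x. x \<in> set w \<Longrightarrow> fst x \<noteq> j \<Longrightarrow> (j, fst x) \<in> E" for j w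
    using that
  proof (induction w rule: first_verts.induct)
    case (2 i b w)
    then show ?case by (cases "i = j") force+
  qed simp
  have "reduced w \<Longrightarrow> (\<And>x y. x \<in> set w \<Longrightarrow> y \<in> set w \<Longrightarrow> fst x \<noteq> fst y \<Longrightarrow> (fst x, fst y) \<in> E) \<Longrightarrow>
      distinct (map fst w)" for w
  proof (induction w rule: reduced.induct)
    case (2 j b w)
    have "j \<notin> fst ` set w"
      using *[of j w] 2(2) 2(3)[of "(j, b)"] by force
    with 2 show ?case by (simp add: image_iff)
  qed simp
  then show ?thesis using assms by (auto simp: clique_word_def)
qed

lemma reduced_syllable: "reduced w \<Longrightarrow> (i, a) \<in> set w \<Longrightarrow> a \<noteq> \<one>\<^bsub>A i\<^esub>"
  by (induction w rule: reduced.induct) auto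

section \<open>Projections onto the vertex groups\<close>

definition proj :: "'v \<Rightarrow> ('v \<times> 'a) word set \<Rightarrow> 'a" where
  "proj i = (SOME f. f \<in> hom GP (A i) \<and>
    (\<forall>j\<in>V. \<forall>a\<in>carrier (A j). f (gen j a) = (if j = i then a else \<one>\<^bsub>A i\<^esub>)))"

text \<open>Killing all generators away from \<open>i\<close> respects the commutator relators,
  since of two adjacent vertices at most one is \<open>i\<close>.\<close>

lemma proj:
  assumes i: "i \<in> V"
  shows "proj i \<in> hom GP (A i)"
    "j \<in> V \<Longrightarrow> a \<in> carrier (A j) \<Longrightarrow> proj i (gen j a) = (if j = i then a else \<one>\<^bsub>A i\<^esub>)"
proof -
  interpret Ai: group "A i" using vertex_groups i by auto
  define h where "h j a = (if j = i then a else \<one>\<^bsub>A i\<^esub>)" for j a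
  have "\<exists>f. f \<in> hom GP (A i) \<and>
    (\<forall>j\<in>V. \<forall>a\<in>carrier (A j). f (gen j a) = (if j = i then a else \<one>\<^bsub>A i\<^esub>))"
  proof (rule hom_extension[where h = h and L = "A i"])
    show "h j \<in> hom (A j) (A i)" if "j \<in> V" for j
      by (intro homI) (auto simp: h_def)
    show "h j a \<otimes>\<^bsub>A i\<^esub> h k b = h k b \<otimes>\<^bsub>A i\<^esub> h j a"
      if "(j, k) \<in> E" "a \<in> carrier (A j)" "b \<in> carrier (A k)" for j k a b
      using that edge_irrefl by (auto simp: h_def)
  qed (auto simp: h_def)
  from someI_ex[OF this] show "proj i \<in> hom GP (A i)"
    "j \<in> V \<Longrightarrow> a \<in> carrier (A j) \<Longrightarrow> proj i (gen j a) = (if j = i then a else \<one>\<^bsub>A i\<^esub>)"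
    unfolding proj_def by auto
qed

lemma proj_closed: "i \<in> V \<Longrightarrow> x \<in> carrier GP \<Longrightarrow> proj i x \<in> carrier (A i)"
  using proj(1) by (auto simp: hom_def)

lemma proj_pow:
  "i \<in> V \<Longrightarrow> x \<in> carrier GP \<Longrightarrow> proj i (x [^]\<^bsub>GP\<^esub> (n::nat)) = proj i x [^]\<^bsub>A i\<^esub> n"
  using hom_nat_pow[OF proj(1)] GP.is_group vertex_groups by blast

lemma proj_ev_notin: "i \<in> V \<Longrightarrow> w \<in> sylls \<Longrightarrow> i \<notin> fst ` set w \<Longrightarrow> proj i (ev w) = \<one>\<^bsub>A i\<^esub>"
proof (induction w rule: ev.induct)
  case 1
  then show ?case using hom_one[OF proj(1) GP.is_group vertex_groups] by simp
next
  case (2 j b w)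
  interpret Ai: group "A i" using vertex_groups 2 by auto
  show ?case
    using 2 by (auto simp: hom_mult[OF proj(1)] proj(2) sylls_iff)
qed

lemma proj_ev_in:
  "i \<in> V \<Longrightarrow> w \<in> sylls \<Longrightarrow> distinct (map fst w) \<Longrightarrow> (i, a) \<in> set w \<Longrightarrow> proj i (ev w) = a"
proof (induction w rule: ev.induct)
  case (2 j b w)
  interpret Ai: group "A i" using vertex_groups 2 by auto
  have j: "j \<in> V" "b \<in> carrier (A j)" "w \<in> sylls" using 2 by (auto simp: sylls_iff)
  interpret Aj: group "A j" using vertex_groups j by auto
  have m: "proj i (ev ((j, b) # w)) = proj i (gen j b) \<otimes>\<^bsub>A i\<^esub> proj i (ev w)"
    using 2 j by (simp add: hom_mult[OF proj(1)])
  show ?case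
  proof (cases "i = j")
    case True
    then have "a = b" "i \<notin> fst ` set w" using 2 by (auto simp: image_iff)
    then show ?thesis
      using m True 2(2) j proj_ev_notin[of i w] Aj.r_one[OF j(2)] by (simp add: proj(2))
  next
    case False
    then have "(i, a) \<in> set w" using 2 by auto
    then have "proj i (ev w) = a" using 2 j by auto
    then show ?thesis using m False 2 j proj_closed[of i "ev w"] by (auto simp: proj(2))
  qed
qed simp

text \<open>The projections determine a clique word up to the order of its syllables, and by
  \<open>ev_permute\<close> the order does not affect the element.\<close>

lemma clique_word_set:
  assumes "clique_word w"
  shows "set w = {(i, proj i (ev w)) |i. i \<in> V \<and> proj i (ev w) \<noteq> \<one>\<^bsub>A i\<^esub>}"
proof -
  have w: "w \<in> sylls" "reduced w" "distinct (map fst w)"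
    using assms clique_word_distinct by (auto simp: clique_word_def)
  have "proj i (ev w) = a \<and> a \<noteq> \<one>\<^bsub>A i\<^esub> \<and> i \<in> V" if "(i, a) \<in> set w" for i a
  proof -
    have "i \<in> V" using that w(1) by (auto simp: sylls_iff)
    then show ?thesis
      using proj_ev_in[OF _ w(1,3) that] reduced_syllable[OF w(2) that] by auto
  qed
  moreover have "(i, proj i (ev w)) \<in> set w" if "i \<in> V" "proj i (ev w) \<noteq> \<one>\<^bsub>A i\<^esub>" for i
    using proj_ev_notin[OF that(1) w(1)] proj_ev_in[OF that(1) w(1,3)] that by fastforce
  ultimately show ?thesis by auto
qed

lemma clique_word_commute:
  assumes "clique_word w" "(i, a) \<in> set w" "(j, b) \<in> set w"
  shows "gen i a \<otimes>\<^bsub>GP\<^esub> gen j b = gen j b \<otimes>\<^bsub>GP\<^esub> gen i a"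
proof (cases "i = j")
  case True
  then have "a = b" using clique_word_distinct[OF assms(1)] assms(2,3) by (auto dest: eq_key_imp_eq_value)
  with True show ?thesis by simp
next
  case False
  then show ?thesis
    using assms by (intro gen_commute) (fastforce simp: clique_word_def sylls_iff)+
qed

lemma ev_permute:
  assumes "w \<in> sylls" "distinct w" "distinct w'" "set w' = set w"
    and "\<And>i a j b. (i, a) \<in> set w \<Longrightarrow> (j, b) \<in> set w \<Longrightarrow>
      gen i a \<otimes>\<^bsub>GP\<^esub> gen j b = gen j b \<otimes>\<^bsub>GP\<^esub> gen i a"
  shows "ev w' = ev w"
  using assms
proof (induction w arbitrary: w' rule: ev.induct)
  case (2 i a w)
  have "(i, a) \<in> set w'" using 2 by simp
  then obtain p q where w': "w' = p @ (i, a) # q" by (auto simp: in_set_conv_decomp)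
  have w: "w \<in> sylls" and ia: "i \<in> V" "a \<in> carrier (A i)" using 2 by (auto simp: sylls_iff)
  have pq: "set (p @ q) = set w" using 2(3-5) unfolding w' by auto
  then have s: "p \<in> sylls" "q \<in> sylls" using w by auto
  have IH: "ev (p @ q) = ev w"
    by (rule 2(1)) (use 2 w w' pq in auto)
  have "gen i a \<otimes>\<^bsub>GP\<^esub> ev p = ev p \<otimes>\<^bsub>GP\<^esub> gen i a"
  proof (rule gen_ev_commute[OF gen_closed[OF ia] s(1)])
    fix j b assume "(j, b) \<in> set p"
    then have "(j, b) \<in> set ((i, a) # w)" using pq by auto
    then show "gen i a \<otimes>\<^bsub>GP\<^esub> gen j b = gen j b \<otimes>\<^bsub>GP\<^esub> gen i a" using 2(6) by (metis list.set_intros(1))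
  qed
  then have "ev w' = gen i a \<otimes>\<^bsub>GP\<^esub> ev (p @ q)"
    using s ia by (simp add: w' ev_append sylls_iff flip: GP.m_assoc)
  then show ?case by (simp add: IH)
qed simp

lemma clique_word_eqI:
  assumes w: "clique_word w" and w': "clique_word w'"
    and "\<And>i. i \<in> V \<Longrightarrow> proj i (ev w) = proj i (ev w')"
  shows "ev w = ev w'"
proof (rule ev_permute)
  show "set w = set w'"
    unfolding clique_word_set[OF w] clique_word_set[OF w'] using assms(3) by force
qed (use w w' clique_word_distinct clique_word_commute[OF w']
    in \<open>auto simp: clique_word_def distinct_map\<close>)

lemma clique_word_pow_eq_one:
  assumes w: "clique_word w" and p: "\<And>i. i \<in> V \<Longrightarrow> proj i (ev w) [^]\<^bsub>A i\<^esub> (n::nat) = \<one>\<^bsub>A i\<^esub>"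
  shows "ev w [^]\<^bsub>GP\<^esub> n = \<one>\<^bsub>GP\<^esub>"
proof -
  have "u \<in> sylls \<Longrightarrow> (\<And>i a. (i, a) \<in> set u \<Longrightarrow> a [^]\<^bsub>A i\<^esub> n = \<one>\<^bsub>A i\<^esub>) \<Longrightarrow>
      (\<And>i a j b. (i, a) \<in> set u \<Longrightarrow> (j, b) \<in> set u \<Longrightarrow>
        gen i a \<otimes>\<^bsub>GP\<^esub> gen j b = gen j b \<otimes>\<^bsub>GP\<^esub> gen i a) \<Longrightarrow> ev u [^]\<^bsub>GP\<^esub> n = \<one>\<^bsub>GP\<^esub>" for u
  proof (induction u rule: ev.induct)
    case (2 i a u)
    have ia: "i \<in> V" "a \<in> carrier (A i)" "u \<in> sylls" using 2 by (auto simp: sylls_iff)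
    have "gen i a \<otimes>\<^bsub>GP\<^esub> ev u = ev u \<otimes>\<^bsub>GP\<^esub> gen i a"
      by (rule gen_ev_commute[OF gen_closed[OF ia(1,2)] ia(3)]) (metis 2(4) list.set_intros)
    then have "(gen i a \<otimes>\<^bsub>GP\<^esub> ev u) [^]\<^bsub>GP\<^esub> n = gen i a [^]\<^bsub>GP\<^esub> n \<otimes>\<^bsub>GP\<^esub> ev u [^]\<^bsub>GP\<^esub> n"
      using ia by (intro GP.pow_mult_distrib) auto
    also have "gen i a [^]\<^bsub>GP\<^esub> n = gen i (a [^]\<^bsub>A i\<^esub> n)"
      using hom_nat_pow[OF gen_hom[OF ia(1)] ia(2) vertex_groups[OF ia(1)] GP.is_group, of n] by simp
    also have "\<dots> = \<one>\<^bsub>GP\<^esub>" using 2(3)[of i a] ia by simp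
    finally have "(gen i a \<otimes>\<^bsub>GP\<^esub> ev u) [^]\<^bsub>GP\<^esub> n = ev u [^]\<^bsub>GP\<^esub> n"
      using ia by simp
    moreover have "ev u [^]\<^bsub>GP\<^esub> n = \<one>\<^bsub>GP\<^esub>"
      using 2(1)[OF ia(3)] 2(3,4) by (meson list.set_intros(2))
    ultimately show ?case by simp
  qed simp
  note * = this[of w]
  show ?thesis
  proof (rule *)
    show "w \<in> sylls" using w by (simp add: clique_word_def)
    show "a [^]\<^bsub>A i\<^esub> n = \<one>\<^bsub>A i\<^esub>" if "(i, a) \<in> set w" for i a
      using that p unfolding clique_word_set[OF w] by auto
  qed (rule clique_word_commute[OF w])
qed

lemma torsion_closed: "torsion x \<Longrightarrow> x \<in> carrier GP"
  by (simp add: torsion_def)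

text \<open>The projections do not separate the elements of a graph product in general. They detect
  triviality here because a torsion element is conjugate to a clique word, and conjugation preserves
  the triviality of powers both in the graph product and in each vertex group.\<close>

lemma torsion_pow_eq_one_iff:
  assumes x: "torsion x"
  shows "x [^]\<^bsub>GP\<^esub> (n::nat) = \<one>\<^bsub>GP\<^esub> \<longleftrightarrow> (\<forall>i\<in>V. proj i x [^]\<^bsub>A i\<^esub> n = \<one>\<^bsub>A i\<^esub>)"
proof
  assume "x [^]\<^bsub>GP\<^esub> n = \<one>\<^bsub>GP\<^esub>"
  then show "\<forall>i\<in>V. proj i x [^]\<^bsub>A i\<^esub> n = \<one>\<^bsub>A i\<^esub>"
    using torsion_closed[OF x] hom_one[OF proj(1) GP.is_group vertex_groups]
    by (simp flip: proj_pow)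
next
  assume p: "\<forall>i\<in>V. proj i x [^]\<^bsub>A i\<^esub> n = \<one>\<^bsub>A i\<^esub>"
  obtain w where w: "clique_word w" "conjugate GP x (ev w)"
    using torsion_conjugate_clique_word[OF x] by blast
  note cl = torsion_closed[OF x] ev_closed[of w]
  have ws: "ev w \<in> carrier GP" using w by (auto simp: clique_word_def)
  have "proj i (ev w) [^]\<^bsub>A i\<^esub> n = \<one>\<^bsub>A i\<^esub>" if i: "i \<in> V" for i
    using group.conjugate_pow_one_iff[OF vertex_groups[OF i] _
        conjugate_hom[OF proj(1)[OF i] w(2) torsion_closed[OF x] ws], of n]
      proj_closed[OF i] torsion_closed[OF x] ws p i by auto
  then show "x [^]\<^bsub>GP\<^esub> n = \<one>\<^bsub>GP\<^esub>"
    using GP.conjugate_pow_one_iff[OF torsion_closed[OF x] w(2) ws] clique_word_pow_eq_one[OF w(1)]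
    by simp
qed

lemma torsion_support_clique:
  assumes x: "torsion x" and ij: "i \<in> V" "j \<in> V" "i \<noteq> j"
    and ne: "proj i x \<noteq> \<one>\<^bsub>A i\<^esub>" "proj j x \<noteq> \<one>\<^bsub>A j\<^esub>"
  shows "(i, j) \<in> E"
proof -
  obtain w where w: "clique_word w" "conjugate GP x (ev w)"
    using torsion_conjugate_clique_word[OF x] by blast
  have ws: "w \<in> sylls" "ev w \<in> carrier GP" using w by (auto simp: clique_word_def)
  have "k \<in> fst ` set w" if k: "k \<in> V" "proj k x \<noteq> \<one>\<^bsub>A k\<^esub>" for k
    using group.conjugate_one_iff[OF vertex_groups[OF k(1)] _
        conjugate_hom[OF proj(1)[OF k(1)] w(2) torsion_closed[OF x] ws(2)]]
      proj_closed[OF k(1)] torsion_closed[OF x] ws k proj_ev_notin[of k w] by blast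
  then obtain u v where "u \<in> set w" "v \<in> set w" "fst u = i" "fst v = j"
    using ij ne by (metis imageE)
  then show ?thesis using ij(3) w(1) unfolding clique_word_def by metis
qed

lemma torsion_conjugate:
  assumes "torsion x" "y \<in> carrier GP" "conjugate GP x y"
  shows "torsion y"
  using assms GP.conjugate_pow_one_iff by (auto simp: torsion_def)

text \<open>The product of commuting torsion elements is torsion, so its support is a clique too. If
  neither \<open>x\<close> nor \<open>y\<close> alone has both \<open>i\<close> and \<open>j\<close>
  in its support, then their product has.\<close>

lemma torsion_commuting_support:
  assumes x: "torsion x" and y: "torsion y" and xy: "x \<otimes>\<^bsub>GP\<^esub> y = y \<otimes>\<^bsub>GP\<^esub> x"
    and ij: "i \<in> V" "j \<in> V" "i \<noteq> j"
    and ne: "proj i x \<noteq> \<one>\<^bsub>A i\<^esub>" "proj j y \<noteq> \<one>\<^bsub>A j\<^esub>"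
  shows "(i, j) \<in> E"
proof -
  interpret Ai: group "A i" using vertex_groups ij by auto
  interpret Aj: group "A j" using vertex_groups ij by auto
  obtain m n :: nat where m: "m > 0" "x [^]\<^bsub>GP\<^esub> m = \<one>\<^bsub>GP\<^esub>" and n: "n > 0" "y [^]\<^bsub>GP\<^esub> n = \<one>\<^bsub>GP\<^esub>"
    using x y by (auto simp: torsion_def)
  note cl = torsion_closed[OF x] torsion_closed[OF y]
  have "x [^]\<^bsub>GP\<^esub> (m * n) = \<one>\<^bsub>GP\<^esub>" "y [^]\<^bsub>GP\<^esub> (m * n) = \<one>\<^bsub>GP\<^esub>"
    using m n cl GP.nat_pow_pow[of x m n, symmetric] GP.nat_pow_pow[of y n m, symmetric]
    by (simp_all add: mult.commute)
  then have "(x \<otimes>\<^bsub>GP\<^esub> y) [^]\<^bsub>GP\<^esub> (m * n) = \<one>\<^bsub>GP\<^esub>"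
    using cl GP.pow_mult_distrib[OF xy] by simp
  then have t: "torsion (x \<otimes>\<^bsub>GP\<^esub> y)"
    using cl m n unfolding torsion_def by (metis GP.m_closed nat_0_less_mult_iff)
  have p: "proj k (x \<otimes>\<^bsub>GP\<^esub> y) = proj k x \<otimes>\<^bsub>A k\<^esub> proj k y" if "k \<in> V" for k
    using hom_mult[OF proj(1)[OF that] cl] .
  consider "proj j x \<noteq> \<one>\<^bsub>A j\<^esub>" | "proj i y \<noteq> \<one>\<^bsub>A i\<^esub>"
    | "proj j x = \<one>\<^bsub>A j\<^esub>" "proj i y = \<one>\<^bsub>A i\<^esub>" by blast
  then show ?thesis
  proof cases
    case 1
    then show ?thesis using torsion_support_clique[OF x ij ne(1)] by simp
  next
    case 2
    then show ?thesis using torsion_support_clique[OF y ij _ ne(2)] by simp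
  next
    case 3
    then show ?thesis
      using torsion_support_clique[OF t ij] p ij ne cl proj_closed by simp
  qed
qed

end


section \<open>Conjugacy classes of elements of finite order\<close>

lemma (in comm_group) conjugate_imp_eq:
  assumes "x \<in> carrier G" "y \<in> carrier G" "conjugate G x y"
  shows "x = y"
proof -
  obtain g where "g \<in> carrier G" "g \<otimes> x = y \<otimes> g" using assms by (auto simp: conjugate_def)
  then show ?thesis using assms by (metis Units_eq Units_l_cancel m_comm)
qed

locale abelian_graph_prod = graph_prod +
  assumes vertex_comm: "i \<in> V \<Longrightarrow> comm_group (A i)"
begin

lemma conjugate_proj_eq:
  "conjugate GP x y \<Longrightarrow> x \<in> carrier GP \<Longrightarrow> y \<in> carrier GP \<Longrightarrow> i \<in> V \<Longrightarrow> proj i x = proj i y"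
  using comm_group.conjugate_imp_eq[OF vertex_comm] conjugate_hom[OF proj(1)] proj_closed by metis

text \<open>Homomorphisms to commutative groups are constant on conjugacy classes. Conversely, both
  elements are conjugate to clique words, which represent the same element once their projections
  agree.\<close>

lemma torsion_conjugate_iff:
  assumes x: "torsion x" and y: "torsion y"
  shows "conjugate GP x y \<longleftrightarrow> (\<forall>i\<in>V. proj i x = proj i y)"
proof
  assume p: "\<forall>i\<in>V. proj i x = proj i y"
  obtain w where w: "clique_word w" "conjugate GP x (ev w)"
    using torsion_conjugate_clique_word[OF x] by blast
  obtain u where u: "clique_word u" "conjugate GP y (ev u)"
    using torsion_conjugate_clique_word[OF y] by blast
  have c: "x \<in> carrier GP" "y \<in> carrier GP" "ev w \<in> carrier GP" "ev u \<in> carrier GP"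
    using x y w u by (auto simp: torsion_def clique_word_def)
  have "ev w = ev u"
    using w(1) u(1)
  proof (rule clique_word_eqI)
    fix i assume "i \<in> V"
    then show "proj i (ev w) = proj i (ev u)"
      using p conjugate_proj_eq[OF w(2)] conjugate_proj_eq[OF u(2)] c by metis
  qed
  then show "conjugate GP x y"
    using w u c GP.conjugate_sym GP.conjugate_trans by metis
qed (use conjugate_proj_eq torsion_closed x y in blast)

text \<open>From left to right, \<open>y\<close> is replaced by its conjugate that commutes with
  \<open>x\<close>; this has the same projections. Conversely, clique words for \<open>x\<close> and
  \<open>y\<close> commute syllable by syllable, and conjugating both by one element carries the
  first to \<open>x\<close> itself.\<close>

lemma torsion_conj_commute_iff:
  assumes x: "torsion x" and y: "torsion y"
  shows "conj_commute GP x y \<longleftrightarrow>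
    (\<forall>i\<in>V. \<forall>j\<in>V. i \<noteq> j \<and> proj i x \<noteq> \<one>\<^bsub>A i\<^esub> \<and> proj j y \<noteq> \<one>\<^bsub>A j\<^esub> \<longrightarrow> (i, j) \<in> E)"
proof
  note cl = torsion_closed[OF x] torsion_closed[OF y]
  assume "conj_commute GP x y"
  then obtain g where g: "g \<in> carrier GP" and c: "commutes_with_conj GP x y g"
    by (auto simp: conj_commute_def)
  let ?y = "g \<otimes>\<^bsub>GP\<^esub> y \<otimes>\<^bsub>GP\<^esub> inv\<^bsub>GP\<^esub> g"
  have yc: "?y \<in> carrier GP" using g cl by simp
  have cy: "conjugate GP y ?y" using g cl GP.conjugate_iff[OF cl(2) yc] by blast
  then have "torsion ?y" using torsion_conjugate[OF y yc] by simp
  moreover have "proj i ?y = proj i y" if "i \<in> V" for i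
    using conjugate_proj_eq[OF cy cl(2) yc that] by simp
  ultimately show "\<forall>i\<in>V. \<forall>j\<in>V. i \<noteq> j \<and> proj i x \<noteq> \<one>\<^bsub>A i\<^esub> \<and> proj j y \<noteq> \<one>\<^bsub>A j\<^esub> \<longrightarrow> (i, j) \<in> E"
    using torsion_commuting_support[OF x, of ?y] c unfolding commutes_with_conj_def by metis
next
  assume E: "\<forall>i\<in>V. \<forall>j\<in>V. i \<noteq> j \<and> proj i x \<noteq> \<one>\<^bsub>A i\<^esub> \<and> proj j y \<noteq> \<one>\<^bsub>A j\<^esub> \<longrightarrow> (i, j) \<in> E"
  obtain w where w: "clique_word w" "conjugate GP x (ev w)"
    using torsion_conjugate_clique_word[OF x] by blast
  obtain u where u: "clique_word u" "conjugate GP y (ev u)"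
    using torsion_conjugate_clique_word[OF y] by blast
  have c: "x \<in> carrier GP" "y \<in> carrier GP" "ev w \<in> carrier GP" "ev u \<in> carrier GP"
    and s: "w \<in> sylls" "u \<in> sylls"
    using x y w u by (auto simp: torsion_def clique_word_def)
  have wu: "ev w \<otimes>\<^bsub>GP\<^esub> ev u = ev u \<otimes>\<^bsub>GP\<^esub> ev w"
  proof (rule ev_commute[OF s])
    fix i a j b assume ia: "(i, a) \<in> set w" and jb: "(j, b) \<in> set u"
    have V: "i \<in> V" "a \<in> carrier (A i)" "j \<in> V" "b \<in> carrier (A j)"
      using s ia jb by (auto simp: sylls_iff)
    show "gen i a \<otimes>\<^bsub>GP\<^esub> gen j b = gen j b \<otimes>\<^bsub>GP\<^esub> gen i a"
    proof (cases "i = j")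
      case True
      interpret Aj: comm_group "A j" using vertex_comm V by auto
      show ?thesis using True V by (simp add: gen_mult Aj.m_comm)
    next
      case False
      have "proj i x \<noteq> \<one>\<^bsub>A i\<^esub>"
        using ia clique_word_set[OF w(1)] conjugate_proj_eq[OF w(2) c(1,3) V(1)] by auto
      moreover have "proj j y \<noteq> \<one>\<^bsub>A j\<^esub>"
        using jb clique_word_set[OF u(1)] conjugate_proj_eq[OF u(2) c(2,4) V(3)] by auto
      ultimately show ?thesis using False E V by (intro gen_commute) auto
    qed
  qed
  obtain h where h: "h \<in> carrier GP" "x = h \<otimes>\<^bsub>GP\<^esub> ev w \<otimes>\<^bsub>GP\<^esub> inv\<^bsub>GP\<^esub> h"
    using GP.conjugate_sym[OF c(1,3) w(2)] GP.conjugate_iff[OF c(3,1)] by blast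
  let ?y = "h \<otimes>\<^bsub>GP\<^esub> ev u \<otimes>\<^bsub>GP\<^esub> inv\<^bsub>GP\<^esub> h"
  have yc: "?y \<in> carrier GP" using h c by simp
  have "conjugate GP (ev u) ?y" using GP.conjugate_iff[OF c(4) yc] h by blast
  then have "conjugate GP y ?y" using GP.conjugate_trans[OF c(2,4) yc u(2)] by blast
  then obtain g where g: "g \<in> carrier GP" "?y = g \<otimes>\<^bsub>GP\<^esub> y \<otimes>\<^bsub>GP\<^esub> inv\<^bsub>GP\<^esub> g"
    using GP.conjugate_iff[OF c(2) yc] by blast
  have cancel: "inv\<^bsub>GP\<^esub> h \<otimes>\<^bsub>GP\<^esub> (h \<otimes>\<^bsub>GP\<^esub> z) = z" if "z \<in> carrier GP" for z
    using h(1) that by (simp flip: GP.m_assoc)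
  have "x \<otimes>\<^bsub>GP\<^esub> ?y = h \<otimes>\<^bsub>GP\<^esub> (ev w \<otimes>\<^bsub>GP\<^esub> ev u) \<otimes>\<^bsub>GP\<^esub> inv\<^bsub>GP\<^esub> h"
    unfolding h(2) using h(1) c(3,4) by (simp add: GP.m_assoc cancel)
  also have "\<dots> = ?y \<otimes>\<^bsub>GP\<^esub> x"
    unfolding h(2) wu using h(1) c(3,4) by (simp add: GP.m_assoc cancel)
  finally show "conj_commute GP x y"
    using g unfolding conj_commute_def commutes_with_conj_def by metis
qed

text \<open>The converse of \<open>torsion_support_clique\<close>. The exponent \<open>n\<close>
  supplies finite order, as the vertex groups are not assumed finite here.\<close>

lemma torsion_with_projections:
  assumes t: "\<And>i. i \<in> V \<Longrightarrow> t i \<in> carrier (A i)"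
    and clique: "\<And>i j. i \<in> V \<Longrightarrow> j \<in> V \<Longrightarrow> i \<noteq> j \<Longrightarrow> t i \<noteq> \<one>\<^bsub>A i\<^esub> \<Longrightarrow> t j \<noteq> \<one>\<^bsub>A j\<^esub> \<Longrightarrow> (i, j) \<in> E"
    and n: "n > 0" "\<And>i. i \<in> V \<Longrightarrow> t i [^]\<^bsub>A i\<^esub> (n::nat) = \<one>\<^bsub>A i\<^esub>"
  obtains x where "torsion x" "\<And>i. i \<in> V \<Longrightarrow> proj i x = t i"
proof -
  define S where "S = {i \<in> V. t i \<noteq> \<one>\<^bsub>A i\<^esub>}"
  have "finite S" using finV by (simp add: S_def)
  then obtain xs where xs: "set xs = S" "distinct xs" using finite_distinct_list by blast
  define w where "w = map (\<lambda>i. (i, t i)) xs"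
  have fst_w: "map fst w = xs" by (simp add: w_def comp_def)
  have s: "w \<in> sylls" using xs t by (auto simp: w_def sylls_iff S_def)
  have red: "distinct (map fst w) \<Longrightarrow> (\<And>i a. (i, a) \<in> set w \<Longrightarrow> a \<noteq> \<one>\<^bsub>A i\<^esub>) \<Longrightarrow> reduced w" for w
  proof (induction w rule: reduced.induct)
    case (2 j b w)
    then show ?case using first_verts_subset[of w] by auto
  qed simp
  have "reduced w"
  proof (rule red)
    show "distinct (map fst w)" using xs fst_w by simp
    show "a \<noteq> \<one>\<^bsub>A i\<^esub>" if "(i, a) \<in> set w" for i a
      using that xs by (auto simp: w_def S_def)
  qed
  then have w: "clique_word w" using s xs clique by (auto simp: clique_word_def w_def S_def)
  have p: "proj i (ev w) = t i" if i: "i \<in> V" for i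
  proof (cases "i \<in> S")
    case True
    then have "(i, t i) \<in> set w" using xs by (auto simp: w_def)
    then show ?thesis using i s fst_w xs by (intro proj_ev_in) auto
  next
    case False
    then have "i \<notin> fst ` set w" using xs by (auto simp: w_def)
    then show ?thesis using proj_ev_notin[OF i s] False i by (simp add: S_def)
  qed
  have "ev w [^]\<^bsub>GP\<^esub> n = \<one>\<^bsub>GP\<^esub>"
    using w by (rule clique_word_pow_eq_one) (simp add: p n)
  then have "torsion (ev w)" using n s by (auto simp: torsion_def)
  then show ?thesis using p that by blast
qed

end

section \<open>Clique vectors of a marked graph\<close>

definition cliques_compatible :: "'v marked_graph \<Rightarrow> ('v \<Rightarrow> int) \<Rightarrow> ('v \<Rightarrow> int) \<Rightarrow> bool" where
  "cliques_compatible M s t \<longleftrightarrow>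
    (\<forall>u\<in>verts M. \<forall>v\<in>verts M. u \<noteq> v \<and> s u \<noteq> 0 \<and> t v \<noteq> 0 \<longrightarrow> (u, v) \<in> edges M)"

text \<open>\<open>cliques_compatible M t t\<close> makes the support of \<open>t\<close> a clique;
  for two such vectors, compatibility means that the union of the supports is a clique. Least
  nonnegative residues and extensional functions give each class exactly one vector.\<close>

definition clique_vectors :: "'v marked_graph \<Rightarrow> ('v \<Rightarrow> int) set" where
  "clique_vectors M =
    {t \<in> (\<Pi>\<^sub>E u\<in>verts M. {0..<int (mark M u)}). cliques_compatible M t t}"

text \<open>The equation \<open>n t = 0\<close> in the direct product of the cyclic groups, written
  additively.\<close>

definition annihilates :: "'v marked_graph \<Rightarrow> nat \<Rightarrow> ('v \<Rightarrow> int) \<Rightarrow> bool" where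
  "annihilates M n t \<longleftrightarrow> (\<forall>u\<in>verts M. int (mark M u) dvd int n * t u)"

lemma finite_clique_vectors:
  assumes "finite (verts M)"
  shows "finite (clique_vectors M)"
  unfolding clique_vectors_def
  using assms
  by (intro finite_subset[OF _ finite_PiE[of "verts M" "\<lambda>u. {0..<int (mark M u)}"]]) auto

text \<open>A sentence controls finitely many exponents; those below a common multiple
  \<open>N\<close> of the marks decide all of them.\<close>

lemma annihilates_mod:
  assumes "\<And>u. u \<in> verts M \<Longrightarrow> mark M u dvd N"
  shows "annihilates M (n mod N) t \<longleftrightarrow> annihilates M n t"
proof -
  have "int (mark M u) dvd int (n mod N) * t u \<longleftrightarrow> int (mark M u) dvd int n * t u"
    if "u \<in> verts M" for u
  proof -
    have "int n * t u = int (n mod N) * t u + int N * (int (n div N) * t u)"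
      by (metis (no_types) add.commute distrib_right mult.assoc mod_mult_div_eq of_nat_add of_nat_mult)
    moreover have "int (mark M u) dvd int N * (int (n div N) * t u)"
      using assms[OF that] by (metis dvd_mult2 of_nat_dvd_iff)
    ultimately show ?thesis by (metis dvd_add_left_iff)
  qed
  then show ?thesis by (simp add: annihilates_def)
qed

locale cyclic_graph_prod =
  fixes M :: "'v marked_graph"
  assumes simple: "simple_graph (verts M) (edges M)"
    and mark_pos: "\<And>u. u \<in> verts M \<Longrightarrow> mark M u > 0"

sublocale cyclic_graph_prod \<subseteq>
  abelian_graph_prod "verts M" "edges M" "\<lambda>u. integer_mod_group (mark M u)"
  by (intro abelian_graph_prod.intro abelian_graph_prod_axioms.intro graph_prod_cyclic simple
      abelian_integer_mod_group)

context cyclic_graph_prod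
begin

definition vector :: "('v \<times> int) word set \<Rightarrow> 'v \<Rightarrow> int" where
  "vector x = (\<lambda>u\<in>verts M. proj u x)"

lemma vector_clique_vectors:
  assumes "torsion x"
  shows "vector x \<in> clique_vectors M"
proof -
  have "proj u x \<in> {0..<int (mark M u)}" if "u \<in> verts M" for u
    using proj_closed[OF that torsion_closed[OF assms]] mark_pos[OF that]
    by (simp add: carrier_integer_mod_group)
  moreover have "cliques_compatible M (vector x) (vector x)"
    unfolding cliques_compatible_def vector_def
    using torsion_support_clique[OF assms] by auto
  ultimately show ?thesis by (auto simp: clique_vectors_def vector_def)
qed

lemma vector_annihilates_iff:
  "torsion x \<Longrightarrow> x [^]\<^bsub>GP\<^esub> n = \<one>\<^bsub>GP\<^esub> \<longleftrightarrow> annihilates M n (vector x)"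
  by (simp add: torsion_pow_eq_one_iff annihilates_def vector_def dvd_eq_mod_eq_0)

lemma vector_conjugate_iff:
  "torsion x \<Longrightarrow> torsion y \<Longrightarrow> conjugate GP x y \<longleftrightarrow> vector x = vector y"
  by (auto simp: torsion_conjugate_iff vector_def fun_eq_iff restrict_def)

lemma vector_compatible_iff:
  "torsion x \<Longrightarrow> torsion y \<Longrightarrow>
    conj_commute GP x y \<longleftrightarrow> cliques_compatible M (vector x) (vector y)"
  by (simp add: torsion_conj_commute_iff cliques_compatible_def vector_def)

lemma vector_surj:
  assumes "t \<in> clique_vectors M"
  obtains x where "torsion x" "vector x = t"
proof -
  have t: "t \<in> (\<Pi>\<^sub>E u\<in>verts M. {0..<int (mark M u)})" "cliques_compatible M t t"
    using assms by (auto simp: clique_vectors_def)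
  obtain x where "torsion x" "\<And>u. u \<in> verts M \<Longrightarrow> proj u x = t u"
  proof (rule torsion_with_projections[where t = t and n = "\<Prod>u\<in>verts M. mark M u"])
    show "t u \<in> carrier (integer_mod_group (mark M u))" if "u \<in> verts M" for u
      using t(1) that mark_pos[OF that] by (auto simp: carrier_integer_mod_group PiE_iff)
    show "0 < (\<Prod>u\<in>verts M. mark M u)" using mark_pos by (simp add: prod_pos)
    show "t u [^]\<^bsub>integer_mod_group (mark M u)\<^esub> (\<Prod>u\<in>verts M. mark M u)
        = \<one>\<^bsub>integer_mod_group (mark M u)\<^esub>" if "u \<in> verts M" for u
    proof -
      have "int (mark M u) dvd int (\<Prod>u\<in>verts M. mark M u)"
        using that finV by (intro int_dvd_int_iff[THEN iffD2] dvd_prodI)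
      then have "int (mark M u) dvd int (\<Prod>u\<in>verts M. mark M u) * t u" by (rule dvd_mult2)
      then show ?thesis by (simp only: pow_integer_mod_group one_integer_mod_group dvd_eq_mod_eq_0)
    qed
  qed (use t(2) in \<open>auto simp: cliques_compatible_def\<close>)
  then show ?thesis
    using t(1) by (intro that[of x]) (auto simp: vector_def PiE_iff extensional_def)
qed

end

text \<open>One representative of every torsion class of \<open>M\<close> enters the configuration.
  Non-conjugacy of the transferred elements is the injectivity of \<open>\<sigma>\<close>.\<close>

lemma clique_vectors_transfer_inj:
  fixes M :: "'v marked_graph" and N :: "'w marked_graph"
  assumes M: "cyclic_graph_prod M" and N: "cyclic_graph_prod N"
    and transfer: "\<And>\<phi>. exists_forall_sentence \<phi> \<Longrightarrow> satisfies (cyclic_product M) \<phi> \<Longrightarrow>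
      satisfies (cyclic_product N) \<phi>"
  obtains \<sigma> where "inj_on \<sigma> (clique_vectors M)" "\<sigma> ` clique_vectors M \<subseteq> clique_vectors N"
    "\<And>t n. t \<in> clique_vectors M \<Longrightarrow> annihilates N n (\<sigma> t) \<longleftrightarrow> annihilates M n t"
    "\<And>s t. s \<in> clique_vectors M \<Longrightarrow> t \<in> clique_vectors M \<Longrightarrow> cliques_compatible M s t \<Longrightarrow>
      cliques_compatible N (\<sigma> s) (\<sigma> t)"
proof -
  interpret M: cyclic_graph_prod M by (rule M)
  interpret N: cyclic_graph_prod N by (rule N)
  \<comment> \<open>A common multiple of the marks of both graphs, so one exponent kills the torsion
    elements on both sides and annihilation depends only on the exponent modulo
    \<open>L\<close>.\<close>
  define L where "L = (\<Prod>u\<in>verts M. mark M u) * (\<Prod>u\<in>verts N. mark N u)"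
  have L: "L > 0" "\<And>u. u \<in> verts M \<Longrightarrow> mark M u dvd L" "\<And>u. u \<in> verts N \<Longrightarrow> mark N u dvd L"
    using M.mark_pos N.mark_pos M.finV N.finV
    by (auto simp: L_def prod_pos intro!: dvd_mult2[OF dvd_prodI] dvd_mult[OF dvd_prodI])
  define n where "n = card (clique_vectors M)"
  obtain f where f: "bij_betw f {0..<n} (clique_vectors M)"
    using ex_bij_betw_nat_finite[OF finite_clique_vectors[OF M.finV]] unfolding n_def by blast
  have fi: "f i \<in> clique_vectors M" if "i < n" for i
    using f that by (auto simp: bij_betw_def)
  have f_inj: "f i = f j \<longleftrightarrow> i = j" if "i < n" "j < n" for i j
    using f that by (auto simp: bij_betw_def inj_on_def)
  have "\<exists>x. M.torsion x \<and> M.vector x = f i" if "i < n" for i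
    using M.vector_surj[OF fi[OF that]] by blast
  then obtain x where x: "\<And>i. i < n \<Longrightarrow> M.torsion (x i)" "\<And>i. i < n \<Longrightarrow> M.vector (x i) = f i"
    by metis
  obtain y where y: "\<And>i. i < n \<Longrightarrow> y i \<in> carrier N.GP"
    "\<And>i j. i < n \<Longrightarrow> j < n \<Longrightarrow> i \<noteq> j \<Longrightarrow> \<not> conjugate N.GP (y i) (y j)"
    "\<And>i d. i < n \<Longrightarrow> d < Suc L \<Longrightarrow>
      y i [^]\<^bsub>N.GP\<^esub> d = \<one>\<^bsub>N.GP\<^esub> \<longleftrightarrow> x i [^]\<^bsub>M.GP\<^esub> (d::nat) = \<one>\<^bsub>M.GP\<^esub>"
    "\<And>i j. i < n \<Longrightarrow> j < n \<Longrightarrow> conj_commute M.GP (x i) (x j) \<Longrightarrow> conj_commute N.GP (y i) (y j)"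
  proof (rule exists_forall_transfer_configuration[OF M.GP.is_group N.GP.is_group transfer])
    show "x i \<in> carrier M.GP" if "i < n" for i using M.torsion_closed x(1) that by blast
    show "\<not> conjugate M.GP (x i) (x j)" if "i < n" "j < n" "i \<noteq> j" for i j
      using that by (simp add: M.vector_conjugate_iff x f_inj)
  qed blast+
  have "annihilates M L (f i)" if "i < n" for i
    using L(2) by (auto simp: annihilates_def intro!: dvd_mult2)
  \<comment> \<open>The exponent \<open>L\<close> itself is needed for the finite order of
    \<open>y i\<close>, hence the bound \<open>Suc L\<close> in the configuration.\<close>
  then have "y i [^]\<^bsub>N.GP\<^esub> L = \<one>\<^bsub>N.GP\<^esub>" if "i < n" for i
    using y(3)[OF that, of L] M.vector_annihilates_iff[OF x(1)] x(2) that by simp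
  then have ty: "N.torsion (y i)" if "i < n" for i
    using y(1) L(1) that by (auto simp: N.torsion_def)
  define g where "g = the_inv_into {0..<n} f"
  have gf: "g (f i) = i" if "i < n" for i
    using f that unfolding g_def by (intro the_inv_into_f_f) (auto simp: bij_betw_def)
  have fE: "\<exists>i<n. t = f i" if "t \<in> clique_vectors M" for t
    using bij_betw_imp_surj_on[OF f] that by (metis atLeastLessThan_iff imageE)
  define \<sigma> where "\<sigma> t = N.vector (y (g t))" for t
  have \<sigma>: "\<sigma> (f i) = N.vector (y i)" if "i < n" for i using that by (simp add: \<sigma>_def gf)
  show ?thesis
  proof (rule that[of \<sigma>])
    show "inj_on \<sigma> (clique_vectors M)"
    proof (rule inj_onI)
      fix s t assume st: "s \<in> clique_vectors M" "t \<in> clique_vectors M" "\<sigma> s = \<sigma> t"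
      then obtain i j where ij: "i < n" "s = f i" "j < n" "t = f j" using fE by blast
      then have "conjugate N.GP (y i) (y j)"
        using st ty \<sigma> by (simp add: N.vector_conjugate_iff)
      then show "s = t" using y(2) ij by blast
    qed
    show "\<sigma> ` clique_vectors M \<subseteq> clique_vectors N"
      using fE \<sigma> ty N.vector_clique_vectors by fastforce
    show "annihilates N m (\<sigma> t) \<longleftrightarrow> annihilates M m t" if "t \<in> clique_vectors M" for t m
    proof -
      obtain i where i: "i < n" "t = f i" using fE \<open>t \<in> clique_vectors M\<close> by blast
      have "m mod L < Suc L" using L(1) by (simp add: less_SucI)
      then have "annihilates N (m mod L) (\<sigma> t) \<longleftrightarrow> annihilates M (m mod L) t"
        using y(3)[OF i(1), of "m mod L"] i ty x \<sigma>
        by (simp add: N.vector_annihilates_iff M.vector_annihilates_iff)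
      then show ?thesis using annihilates_mod[of M L] annihilates_mod[of N L] L by simp
    qed
    show "cliques_compatible N (\<sigma> s) (\<sigma> t)"
      if st: "s \<in> clique_vectors M" "t \<in> clique_vectors M" "cliques_compatible M s t" for s t
    proof -
      obtain i j where ij: "i < n" "s = f i" "j < n" "t = f j" using fE st by blast
      then show ?thesis
        using y(4)[OF ij(1,3)] st(3) ty x \<sigma>
        by (simp add: N.vector_compatible_iff M.vector_compatible_iff)
    qed
  qed
qed

text \<open>The injection \<open>\<rho>\<close> in the other direction need not be inverse to
  \<open>\<sigma>\<close>; it only bounds cardinalities. So \<open>\<sigma>\<close> is onto, and it
  maps the finite set of compatible pairs injectively into one of the same size, whence it also
  reflects compatibility.\<close>

theorem clique_vectors_transfer:
  fixes M :: "'v marked_graph" and N :: "'w marked_graph"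
  assumes M: "cyclic_graph_prod M" and N: "cyclic_graph_prod N"
    and ef: "exists_forall_equivalent (cyclic_product M) (cyclic_product N)"
  obtains \<sigma> where "bij_betw \<sigma> (clique_vectors M) (clique_vectors N)"
    "\<And>t n. t \<in> clique_vectors M \<Longrightarrow> annihilates N n (\<sigma> t) \<longleftrightarrow> annihilates M n t"
    "\<And>s t. s \<in> clique_vectors M \<Longrightarrow> t \<in> clique_vectors M \<Longrightarrow>
      cliques_compatible N (\<sigma> s) (\<sigma> t) \<longleftrightarrow> cliques_compatible M s t"
proof -
  interpret M: cyclic_graph_prod M by (rule M)
  interpret N: cyclic_graph_prod N by (rule N)
  let ?T = "clique_vectors M" and ?T' = "clique_vectors N"
  obtain \<sigma> where s: "inj_on \<sigma> ?T" "\<sigma> ` ?T \<subseteq> ?T'"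
    "\<And>t n. t \<in> ?T \<Longrightarrow> annihilates N n (\<sigma> t) \<longleftrightarrow> annihilates M n t"
    "\<And>s t. s \<in> ?T \<Longrightarrow> t \<in> ?T \<Longrightarrow> cliques_compatible M s t \<Longrightarrow> cliques_compatible N (\<sigma> s) (\<sigma> t)"
    using clique_vectors_transfer_inj[OF M N] ef unfolding exists_forall_equivalent_def by metis
  obtain \<rho> where r: "inj_on \<rho> ?T'" "\<rho> ` ?T' \<subseteq> ?T"
    "\<And>s t. s \<in> ?T' \<Longrightarrow> t \<in> ?T' \<Longrightarrow> cliques_compatible N s t \<Longrightarrow> cliques_compatible M (\<rho> s) (\<rho> t)"
    using clique_vectors_transfer_inj[OF N M] ef unfolding exists_forall_equivalent_def by metis
  have fin: "finite ?T" "finite ?T'" by (rule finite_clique_vectors M.finV N.finV)+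
  have "card ?T = card ?T'"
    using card_inj_on_le[OF s(1,2) fin(2)] card_inj_on_le[OF r(1,2) fin(1)] by simp
  then have bij: "bij_betw \<sigma> ?T ?T'"
    using s(1,2) fin by (metis bij_betw_def card_image card_subset_eq)
  define R where "R = {(s, t). s \<in> ?T \<and> t \<in> ?T \<and> cliques_compatible M s t}"
  define R' where "R' = {(s, t). s \<in> ?T' \<and> t \<in> ?T' \<and> cliques_compatible N s t}"
  have finR: "finite R" "finite R'"
    using finite_subset[of R "?T \<times> ?T"] finite_subset[of R' "?T' \<times> ?T'"] fin
    by (auto simp: R_def R'_def)
  have i: "inj_on (map_prod \<sigma> \<sigma>) R" "map_prod \<sigma> \<sigma> ` R \<subseteq> R'"
    using s by (auto simp: R_def R'_def inj_on_def)
  have "inj_on (map_prod \<rho> \<rho>) R'" "map_prod \<rho> \<rho> ` R' \<subseteq> R"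
    using r by (auto simp: R_def R'_def inj_on_def)
  then have "card R = card R'"
    using card_inj_on_le[OF i finR(2)] card_inj_on_le[OF _ _ finR(1)] by (metis le_antisym)
  then have "map_prod \<sigma> \<sigma> ` R = R'"
    using i finR by (metis card_image card_subset_eq)
  then have "cliques_compatible M a b"
    if ab: "a \<in> ?T" "b \<in> ?T" and c: "cliques_compatible N (\<sigma> a) (\<sigma> b)" for a b
  proof -
    have "(\<sigma> a, \<sigma> b) \<in> map_prod \<sigma> \<sigma> ` R"
      using \<open>map_prod \<sigma> \<sigma> ` R = R'\<close> ab c s(2) by (auto simp: R'_def)
    then obtain a' b' where "(a', b') \<in> R" "\<sigma> a = \<sigma> a'" "\<sigma> b = \<sigma> b'" by auto
    then show ?thesis using s(1) ab by (auto simp: R_def inj_on_def)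
  qed
  then show ?thesis using that bij s(3,4) by blast
qed


section \<open>Reconstruction of the marked graph\<close>

lemma gcd_prime_power_Suc:
  fixes p q :: nat
  assumes "prime p"
  shows "gcd (p ^ Suc k) q = gcd (p ^ k) q * (if p ^ Suc k dvd q then p else 1)"
proof (cases "p ^ Suc k dvd q")
  case True
  moreover from True have "p ^ k dvd q" using power_le_dvd by fastforce
  ultimately show ?thesis by (simp add: gcd_nat.absorb1 del: power_Suc) simp
next
  case False
  obtain j where j: "j \<le> Suc k" "gcd (p ^ Suc k) q = p ^ j"
    using divides_primepow_nat[OF assms] gcd_dvd1 by blast
  have "j \<noteq> Suc k" using False j(2) gcd_dvd2 by metis
  then have "p ^ j dvd p ^ k" using j by (simp add: le_imp_power_dvd)
  then have "gcd (p ^ Suc k) q dvd gcd (p ^ k) q" using j(2) by (metis gcd_dvd2 gcd_greatest)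
  moreover have "gcd (p ^ k) q dvd gcd (p ^ Suc k) q" by (intro gcd_mono) auto
  ultimately have "gcd (p ^ Suc k) q = gcd (p ^ k) q" by (rule dvd_antisym)
  then show ?thesis using False by (simp del: power_Suc)
qed

text \<open>The solutions are the multiples of \<open>q div gcd d q\<close>, of which
  \<open>gcd d q\<close> lie in the range of residues.\<close>

lemma card_annihilated_residues:
  assumes "q > 0"
  shows "card {m \<in> {0..<int q}. int q dvd int d * m} = gcd d q"
proof -
  define g where "g = gcd d q"
  have g: "g > 0" using assms by (simp add: g_def)
  obtain d' q' where dq: "d = d' * g" "q = q' * g" "coprime d' q'"
    using gcd_coprime_exists[of d q, folded g_def] g by blast
  have q': "q' > 0" using assms dq by (cases q') auto
  have "{m \<in> {0..<int q}. int q dvd int d * m} = (\<lambda>j. int q' * j) ` {0..<int g}"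
  proof (intro equalityI subsetI)
    fix m assume "m \<in> {m \<in> {0..<int q}. int q dvd int d * m}"
    then have m: "0 \<le> m" "m < int q" "int q' * int g dvd int d' * m * int g"
      by (auto simp: dq mult_ac)
    then have "int q' dvd int d' * m" using g by simp
    moreover have "coprime (int q') (int d')" using dq(3) by (simp add: coprime_commute)
    ultimately obtain j where j: "m = int q' * j" by (auto simp: coprime_dvd_mult_right_iff)
    have "0 \<le> j" "j < int g" using m(1,2) q' by (auto simp: j dq zero_le_mult_iff)
    then show "m \<in> (\<lambda>j. int q' * j) ` {0..<int g}" using j by auto
  next
    fix m assume "m \<in> (\<lambda>j. int q' * j) ` {0..<int g}"
    then obtain j where "m = int q' * j" "0 \<le> j" "j < int g"
      using atLeastLessThan_iff by (elim imageE) blast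
    then show "m \<in> {m \<in> {0..<int q}. int q dvd int d * m}"
      using q' by (auto simp: dq)
  qed
  also have "card \<dots> = g"
    using q' by (subst card_image) (auto simp: inj_on_def)
  finally show ?thesis by (simp add: g_def)
qed

lemma prod_gcd_prime_power_Suc:
  assumes "prime p" "finite I"
  shows "(\<Prod>i\<in>I. gcd (p ^ Suc k) (c i :: nat)) =
    (\<Prod>i\<in>I. gcd (p ^ k) (c i)) * p ^ card {i \<in> I. p ^ Suc k dvd c i}"
  using assms(2)
  by (simp only: gcd_prime_power_Suc[OF assms(1)] prod.distrib prod.If_cases prod_constant)
    (simp add: Int_def)

text \<open>Among prime powers, \<open>p ^ n\<close> with \<open>n > 0\<close> is the only one
  divisible by \<open>p ^ n\<close> but not by \<open>p ^ Suc n\<close>; for \<open>n = 0\<close>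
  powers of other primes would pass this test.\<close>

lemma card_eq_prime_power:
  assumes I: "finite I" and c: "\<And>i. i \<in> I \<Longrightarrow> primepow (c i)"
    and p: "prime p" "n > 0" "r = p ^ n"
  shows "card {i \<in> I. c i = r} = card {i \<in> I. p ^ n dvd c i} - card {i \<in> I. p ^ Suc n dvd (c i :: nat)}"
proof -
  have "c i = r \<longleftrightarrow> p ^ n dvd c i \<and> \<not> p ^ Suc n dvd c i" if i: "i \<in> I" for i
  proof -
    obtain p' m where m: "prime p'" "m > 0" "c i = p' ^ m" using c[OF i] by (auto simp: primepow_def)
    show ?thesis
    proof (cases "p = p'")
      case True
      have "p > 1" using p(1) by (rule prime_gt_1_nat)
      then show ?thesis
        unfolding m(3) p(3) True[symmetric] by (auto simp: dvd_power_iff_le simp del: power_Suc)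
    next
      case False
      then have "\<not> p dvd c i" using p(1) m by (metis prime_dvd_power primes_dvd_imp_eq)
      moreover have "p dvd p ^ n" using p(2) by simp
      ultimately show ?thesis using p(3) by (metis dvd_trans)
    qed
  qed
  then have "{i \<in> I. c i = r} = {i \<in> I. p ^ n dvd c i} - {i \<in> I. p ^ Suc n dvd c i}" by blast
  moreover have "{i \<in> I. p ^ Suc n dvd c i} \<subseteq> {i \<in> I. p ^ n dvd c i}"
    using power_le_dvd[of p "Suc n" _ n] by auto
  ultimately show ?thesis using I by (simp add: card_Diff_subset)
qed

text \<open>The quotient of the gcd products for \<open>p ^ Suc k\<close> and \<open>p ^ k\<close>
  is \<open>p\<close> raised to the number of members divisible by \<open>p ^ Suc k\<close>.
  Differences of these numbers count the members equal to a given power.\<close>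

lemma prime_power_counts_eq:
  fixes a :: "'i \<Rightarrow> nat" and b :: "'j \<Rightarrow> nat"
  assumes fin: "finite I" "finite J"
    and a: "\<And>i. i \<in> I \<Longrightarrow> primepow (a i)" and b: "\<And>j. j \<in> J \<Longrightarrow> primepow (b j)"
    and gcds: "\<And>d. (\<Prod>i\<in>I. gcd d (a i)) = (\<Prod>j\<in>J. gcd d (b j))"
  shows "card {i \<in> I. a i = r} = card {j \<in> J. b j = r}"
proof (cases "primepow r")
  case False
  then have "{i \<in> I. a i = r} = {}" "{j \<in> J. b j = r} = {}" using a b by auto
  then show ?thesis by (simp only: card.empty)
next
  case True
  then obtain p n where p: "prime p" "n > 0" "r = p ^ n" by (auto simp: primepow_def)
  have pos: "(\<Prod>i\<in>I. gcd (p ^ k) (a i)) > 0" for k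
    using p(1) by (intro prod_pos) (simp add: prime_gt_0_nat)
  have cnt: "card {i \<in> I. p ^ Suc k dvd a i} = card {j \<in> J. p ^ Suc k dvd b j}" for k
  proof -
    have "p ^ card {i \<in> I. p ^ Suc k dvd a i} = p ^ card {j \<in> J. p ^ Suc k dvd b j}"
      using prod_gcd_prime_power_Suc[OF p(1) fin(1), of k a]
        prod_gcd_prime_power_Suc[OF p(1) fin(2), of k b] gcds[of "p ^ k"] gcds[of "p ^ Suc k"] pos[of k]
      by simp
    then show ?thesis using prime_gt_1_nat[OF p(1)] by simp
  qed
  obtain n' where "n = Suc n'" using p(2) by (cases n) auto
  have "card {i \<in> I. a i = r} = card {i \<in> I. p ^ n dvd a i} - card {i \<in> I. p ^ Suc n dvd a i}"
    using fin(1) a p by (rule card_eq_prime_power)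
  also have "\<dots> = card {j \<in> J. p ^ n dvd b j} - card {j \<in> J. p ^ Suc n dvd b j}"
    by (simp only: cnt \<open>n = Suc n'\<close>)
  also have "\<dots> = card {j \<in> J. b j = r}"
    using card_eq_prime_power[where c = b, OF fin(2) b p] by simp
  finally show ?thesis .
qed

lemma bij_betw_of_fibre_cards:
  assumes fin: "finite A" "finite B"
    and cards: "\<And>k. card {a \<in> A. f a = k} = card {b \<in> B. g b = k}"
  obtains h where "bij_betw h A B" "\<And>a. a \<in> A \<Longrightarrow> g (h a) = f a"
proof -
  have "\<exists>h. bij_betw h {a \<in> A. f a = k} {b \<in> B. g b = k}" for k
    using fin cards by (intro finite_same_card_bij) auto
  then obtain H where H: "\<And>k. bij_betw (H k) {a \<in> A. f a = k} {b \<in> B. g b = k}" by metis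
  define h where "h a = H (f a) a" for a
  have h: "h a \<in> B" "g (h a) = f a" if "a \<in> A" for a
    using bij_betw_imp_surj_on[OF H, of "f a"] that by (auto simp: h_def)
  have "bij_betw h A B"
  proof (rule bij_betw_imageI)
    show "inj_on h A"
    proof (rule inj_onI)
      fix x y assume xy: "x \<in> A" "y \<in> A" "h x = h y"
      then have "f x = f y" using h by metis
      then show "x = y"
        using xy bij_betw_imp_inj_on[OF H, of "f x"] by (auto simp: h_def inj_on_def)
    qed
    show "h ` A = B"
    proof (intro equalityI subsetI)
      fix b assume "b \<in> B"
      then have "b \<in> H (g b) ` {a \<in> A. f a = g b}" using bij_betw_imp_surj_on[OF H] by simp
      then obtain a where "a \<in> A" "b = H (f a) a" by auto
      then show "b \<in> h ` A" by (auto simp: h_def)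
    qed (use h in auto)
  qed
  with h that show ?thesis by blast
qed

text \<open>Multiplicative Moebius inversion along inclusion: the factors at proper subsets agree by
  induction and can be cancelled because they are positive.\<close>

lemma prod_over_subsets_unique:
  fixes f g :: "'a set \<Rightarrow> nat"
  assumes fin: "finite \<C>" "\<And>C. C \<in> \<C> \<Longrightarrow> finite C" and pos: "\<And>C. C \<in> \<C> \<Longrightarrow> g C > 0"
    and eq: "\<And>C. C \<in> \<C> \<Longrightarrow> (\<Prod>C'\<in>{C' \<in> \<C>. C' \<subseteq> C}. f C') = (\<Prod>C'\<in>{C' \<in> \<C>. C' \<subseteq> C}. g C')"
  shows "C \<in> \<C> \<Longrightarrow> f C = g C"
proof (induction "card C" arbitrary: C rule: less_induct)
  case less
  let ?L = "{C' \<in> \<C>. C' \<subset> C}"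
  have split: "{C' \<in> \<C>. C' \<subseteq> C} = insert C ?L" using less.prems by auto
  have L: "finite ?L" "C \<notin> ?L" using fin by auto
  have "f C' = g C'" if "C' \<in> ?L" for C'
    using that fin(2)[OF less.prems] by (intro less.hyps psubset_card_mono) auto
  then have "prod f ?L = prod g ?L" by (intro prod.cong) auto
  moreover have "prod g ?L > 0" using pos by (intro prod_pos) auto
  moreover have "f C * prod f ?L = g C * prod g ?L"
    using eq[OF less.prems] L unfolding split by simp
  ultimately show ?case by simp
qed

section \<open>Dominated vectors and the vertices they determine\<close>

locale marked =
  fixes M :: "'v marked_graph"
  assumes simple: "simple_graph (verts M) (edges M)"
    and marks: "\<And>u. u \<in> verts M \<Longrightarrow> primepow (mark M u)"
begin

abbreviation "V \<equiv> verts M"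
abbreviation T :: "('v \<Rightarrow> int) set" where
  "T \<equiv> clique_vectors M"
abbreviation compat :: "('v \<Rightarrow> int) \<Rightarrow> ('v \<Rightarrow> int) \<Rightarrow> bool" where
  "compat \<equiv> cliques_compatible M"

lemma finite_V: "finite V" using simple by (simp add: simple_graph_def)

lemma mark_gt_1: "u \<in> V \<Longrightarrow> mark M u > 1"
  using marks primepow_gt_Suc_0 by fastforce

lemma mark_gt_0: "u \<in> V \<Longrightarrow> mark M u > 0"
  using mark_gt_1 by fastforce

lemma finite_T: "finite T"
  by (rule finite_clique_vectors[OF finite_V])

lemma compat_sym: "compat s t \<Longrightarrow> compat t s"
  using simple unfolding cliques_compatible_def simple_graph_def by (metis symD)

definition unit :: "'v \<Rightarrow> 'v \<Rightarrow> int" where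
  "unit v = (\<lambda>w\<in>V. if w = v then 1 else 0)"

text \<open>The set D(t). Being phrased by compatibility alone, it is carried along by any bijection
  that preserves and reflects compatibility.\<close>

definition dominated :: "('v \<Rightarrow> int) \<Rightarrow> ('v \<Rightarrow> int) set" where
  "dominated t = {b \<in> T. \<forall>c\<in>T. compat t c \<longrightarrow> compat b c}"

lemma unit_T: "v \<in> V \<Longrightarrow> unit v \<in> T"
  using mark_gt_1 mark_gt_0 by (auto simp: clique_vectors_def unit_def cliques_compatible_def)

lemma T_compat: "t \<in> T \<Longrightarrow> compat t t"
  by (simp add: clique_vectors_def)

lemma compat_iff_units: "compat b c \<longleftrightarrow> (\<forall>v\<in>V. b v \<noteq> 0 \<longrightarrow> compat (unit v) c)"
  by (auto simp: cliques_compatible_def unit_def)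

lemma compat_units: "v \<in> V \<Longrightarrow> w \<in> V \<Longrightarrow> compat (unit v) (unit w) \<longleftrightarrow> v = w \<or> (v, w) \<in> edges M"
  by (auto simp: cliques_compatible_def unit_def)

text \<open>Compatibility depends on supports only, so membership of \<open>b\<close> is decided by
  the vertices in its support. This is why the set is a product of entire vertex groups.\<close>

lemma dominated_iff_units:
  "b \<in> T \<Longrightarrow> b \<in> dominated t \<longleftrightarrow> (\<forall>v\<in>V. b v \<noteq> 0 \<longrightarrow> unit v \<in> dominated t)"
  unfolding dominated_def using compat_iff_units[of b] unit_T by blast

lemma dominated_refl: "t \<in> T \<Longrightarrow> t \<in> dominated t"
  by (simp add: dominated_def)

lemma dominated_subset_iff: "b \<in> T \<Longrightarrow> dominated b \<subseteq> dominated t \<longleftrightarrow> b \<in> dominated t"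
  using dominated_refl by (auto simp: dominated_def)

lemma dominated_subset: "dominated t \<subseteq> T"
  by (auto simp: dominated_def)

lemma finite_dominated: "finite (dominated t)"
  using finite_subset[OF dominated_subset finite_T] .

text \<open>As \<open>t\<close> is compatible with itself, \<open>a\<close> is compatible with
  \<open>t\<close>, and then \<open>b\<close> with \<open>a\<close>. So the vertices occurring in a
  dominated set form a clique.\<close>

lemma dominated_pairwise_compat:
  assumes "t \<in> T" "a \<in> dominated t" "b \<in> dominated t"
  shows "compat a b"
proof -
  have "compat a t" using assms T_compat by (auto simp: dominated_def)
  then have "compat t a" by (rule compat_sym)
  then have "compat b a" using assms by (auto simp: dominated_def)
  then show ?thesis by (rule compat_sym)
qed

text \<open>The fibre over \<open>C\<close> of the map that sends a vertex to the dominated set of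
  its unit vector.\<close>

definition above :: "('v \<Rightarrow> int) set \<Rightarrow> 'v set" where
  "above C = {v \<in> V. dominated (unit v) = C}"

text \<open>Annihilation is a condition on each coordinate and the dominated set is a product over
  the clique \<open>S\<close>, so the count is a product of gcds over \<open>S\<close>. It is then
  grouped by dominated sets; those that come from no unit vector contribute an empty
  product.\<close>

lemma card_annihilated_dominated:
  assumes t: "t \<in> T"
  shows "card {b \<in> dominated t. annihilates M d b} =
    (\<Prod>C\<in>{C \<in> dominated ` T. C \<subseteq> dominated t}. \<Prod>v\<in>above C. gcd d (mark M v))"
proof -
  define S where "S = {v \<in> V. dominated (unit v) \<subseteq> dominated t}"
  have S: "S = {v \<in> V. unit v \<in> dominated t}"
    using dominated_subset_iff unit_T by (auto simp: S_def)
  have S_clique: "(u, v) \<in> edges M" if "u \<in> S" "v \<in> S" "u \<noteq> v" for u v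
    using dominated_pairwise_compat[OF t, of "unit u" "unit v"] compat_units that by (auto simp: S)
  define B where "B v = (if v \<in> S then {m \<in> {0..<int (mark M v)}. int (mark M v) dvd int d * m} else {0})" for v
  have "{b \<in> dominated t. annihilates M d b} = (\<Pi>\<^sub>E v\<in>V. B v)"
  proof (intro equalityI subsetI)
    fix b assume "b \<in> {b \<in> dominated t. annihilates M d b}"
    then have b: "b \<in> T" "b \<in> dominated t" "annihilates M d b" by (auto simp: dominated_def)
    then have "b v = 0" if "v \<in> V" "v \<notin> S" for v
      using dominated_iff_units[OF b(1)] that by (auto simp: S)
    with b show "b \<in> (\<Pi>\<^sub>E v\<in>V. B v)"
      by (auto simp: B_def PiE_iff clique_vectors_def annihilates_def)
  next
    fix b assume b: "b \<in> (\<Pi>\<^sub>E v\<in>V. B v)"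
    have bB: "b v \<in> B v" if "v \<in> V" for v using b that by auto
    have bS: "v \<in> S" if "v \<in> V" "b v \<noteq> 0" for v
      using bB[OF that(1)] that(2) by (auto simp: B_def split: if_splits)
    have "b v \<in> {0..<int (mark M v)}" if "v \<in> V" for v
      using bB[OF that] mark_gt_1[OF that] by (auto simp: B_def split: if_splits)
    moreover have "compat b b"
      unfolding cliques_compatible_def using bS S_clique by blast
    ultimately have "b \<in> T" using b by (auto simp: clique_vectors_def PiE_iff)
    then have "b \<in> dominated t" using bS by (auto simp: dominated_iff_units S)
    moreover have "annihilates M d b"
      unfolding annihilates_def
    proof
      fix v assume "v \<in> V"
      from bB[OF this] show "int (mark M v) dvd int d * b v" by (auto simp: B_def split: if_splits)
    qed
    ultimately show "b \<in> {b \<in> dominated t. annihilates M d b}" by simp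
  qed
  then have "card {b \<in> dominated t. annihilates M d b} = (\<Prod>v\<in>V. card (B v))"
    using finite_V by (simp add: card_PiE)
  also have "\<dots> = (\<Prod>v\<in>V. if v \<in> S then gcd d (mark M v) else 1)"
  proof (rule prod.cong)
    fix v assume v: "v \<in> V"
    show "card (B v) = (if v \<in> S then gcd d (mark M v) else 1)"
    proof (cases "v \<in> S")
      case True
      then show ?thesis
        by (simp only: B_def if_True card_annihilated_residues[OF mark_gt_0[OF v]])
    qed (simp add: B_def)
  qed simp
  also have "\<dots> = (\<Prod>v\<in>S. gcd d (mark M v))"
    using finite_V by (simp add: prod.If_cases S_def Int_def)
  also have "\<dots> = (\<Prod>C\<in>{C \<in> dominated ` T. C \<subseteq> dominated t}.
      \<Prod>v\<in>{v \<in> S. dominated (unit v) = C}. gcd d (mark M v))"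
    using finite_V finite_T unit_T by (intro prod.group[symmetric]) (auto simp: S_def)
  also have "\<dots> = (\<Prod>C\<in>{C \<in> dominated ` T. C \<subseteq> dominated t}. \<Prod>v\<in>above C. gcd d (mark M v))"
    by (intro prod.cong) (auto simp: S_def above_def)
  finally show ?thesis .
qed

text \<open>Adjacency of distinct vertices thus depends only on their dominated sets: domination
  extends compatibility first from \<open>unit v\<close> to \<open>a\<close> and then from
  \<open>unit w\<close> to \<open>b\<close>.\<close>

lemma edge_iff_dominated:
  assumes "v \<in> V" "w \<in> V" "v \<noteq> w"
  shows "(v, w) \<in> edges M \<longleftrightarrow> (\<forall>a\<in>dominated (unit v). \<forall>b\<in>dominated (unit w). compat a b)"
proof
  assume "(v, w) \<in> edges M"
  then have vw: "compat (unit v) (unit w)" using assms by (simp add: compat_units)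
  show "\<forall>a\<in>dominated (unit v). \<forall>b\<in>dominated (unit w). compat a b"
  proof (intro ballI)
    fix a b assume a: "a \<in> dominated (unit v)" and b: "b \<in> dominated (unit w)"
    have "compat a (unit w)" using a vw unit_T assms by (auto simp: dominated_def)
    then have "compat (unit w) a" by (rule compat_sym)
    then have "compat b a" using a b by (auto simp: dominated_def)
    then show "compat a b" by (rule compat_sym)
  qed
next
  assume "\<forall>a\<in>dominated (unit v). \<forall>b\<in>dominated (unit w). compat a b"
  then show "(v, w) \<in> edges M"
    using assms dominated_refl unit_T compat_units by metis
qed

end

text \<open>The isomorphism is not induced by \<open>\<sigma>\<close> on unit vectors, whose images
  need not be unit vectors. It only matches vertices with corresponding dominated sets and equal
  marks, of which both graphs have equally many.\<close>

theorem marked_graph_iso_of_clique_vectors: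
  fixes M :: "'v marked_graph" and N :: "'w marked_graph"
  assumes M: "marked M" and N: "marked N"
    and bij: "bij_betw \<sigma> (clique_vectors M) (clique_vectors N)"
    and ann: "\<And>t n. t \<in> clique_vectors M \<Longrightarrow> annihilates N n (\<sigma> t) \<longleftrightarrow> annihilates M n t"
    and compat: "\<And>s t. s \<in> clique_vectors M \<Longrightarrow> t \<in> clique_vectors M \<Longrightarrow>
      cliques_compatible N (\<sigma> s) (\<sigma> t) \<longleftrightarrow> cliques_compatible M s t"
  shows "marked_graph_iso M N"
proof -
  interpret M: marked M by (rule M)
  interpret N: marked N by (rule N)
  have \<sigma>_T: "\<sigma> ` M.T = N.T" "inj_on \<sigma> M.T" using bij by (auto simp: bij_betw_def)
  have \<sigma>_dom: "\<sigma> ` M.dominated t = N.dominated (\<sigma> t)" if t: "t \<in> M.T" for t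
  proof -
    have iff: "b \<in> M.dominated t \<longleftrightarrow> \<sigma> b \<in> N.dominated (\<sigma> t)" if "b \<in> M.T" for b
      unfolding M.dominated_def N.dominated_def \<sigma>_T(1)[symmetric] using that t compat by auto
    show ?thesis
    proof (intro equalityI subsetI)
      fix c assume "c \<in> \<sigma> ` M.dominated t"
      then obtain b where "b \<in> M.dominated t" "c = \<sigma> b" by auto
      then show "c \<in> N.dominated (\<sigma> t)" using iff M.dominated_subset by auto
    next
      fix c assume c: "c \<in> N.dominated (\<sigma> t)"
      then have "c \<in> \<sigma> ` M.T" using N.dominated_subset \<sigma>_T(1) by auto
      then obtain b where "b \<in> M.T" "c = \<sigma> b" by auto
      then show "c \<in> \<sigma> ` M.dominated t" using iff c by auto
    qed
  qed
  have \<sigma>_inj: "\<sigma> ` C = \<sigma> ` C' \<longleftrightarrow> C = C'" if "C \<subseteq> M.T" "C' \<subseteq> M.T" for C C'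
    using inj_on_image_eq_iff[OF \<sigma>_T(2) that] .
  have \<sigma>_sub: "\<sigma> ` C \<subseteq> \<sigma> ` C' \<longleftrightarrow> C \<subseteq> C'" if "C \<subseteq> M.T" "C' \<subseteq> M.T" for C C'
  proof
    assume sub: "\<sigma> ` C \<subseteq> \<sigma> ` C'"
    show "C \<subseteq> C'"
    proof
      fix x assume "x \<in> C"
      then have "x \<in> M.T" "\<sigma> x \<in> \<sigma> ` C'" using that(1) sub by auto
      then show "x \<in> C'" by (simp add: inj_on_image_mem_iff[OF \<sigma>_T(2) _ that(2)])
    qed
  qed (rule image_mono)
  let ?CM = "M.dominated ` M.T" and ?CN = "N.dominated ` N.T"
  have CN: "?CN = image \<sigma> ` ?CM"
    unfolding \<sigma>_T(1)[symmetric] image_image by (rule image_cong) (simp_all add: \<sigma>_dom)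
  have CM_sub: "C \<subseteq> M.T" if "C \<in> ?CM" for C using that M.dominated_subset by auto
  \<comment> \<open>The cardinalities that \<open>\<sigma>\<close> preserves give the products over
    all dominated subsets of a dominated set; the single factors follow by
    \<open>prod_over_subsets_unique\<close>.\<close>
  have gcds: "(\<Prod>v\<in>M.above C. gcd d (mark M v)) = (\<Prod>w\<in>N.above (\<sigma> ` C). gcd d (mark N w))"
    if C: "C \<in> ?CM" for d C
  proof (rule prod_over_subsets_unique[where \<C> = ?CM and
        f = "\<lambda>C. \<Prod>v\<in>M.above C. gcd d (mark M v)" and
        g = "\<lambda>C. \<Prod>w\<in>N.above (\<sigma> ` C). gcd d (mark N w)", OF _ _ _ _ C])
    show "finite ?CM" using M.finite_T by simp
    show "finite C" if "C \<in> ?CM" for C using that M.finite_dominated by auto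
    show "0 < (\<Prod>w\<in>N.above (\<sigma> ` C). gcd d (mark N w))" for C
    proof (rule prod_pos)
      fix w assume "w \<in> N.above (\<sigma> ` C)"
      then have "mark N w > 1" using N.mark_gt_1 by (simp add: N.above_def)
      then show "0 < gcd d (mark N w)" by simp
    qed
    fix C assume "C \<in> ?CM"
    then obtain t where t: "t \<in> M.T" "C = M.dominated t" by auto
    have \<sigma>t: "\<sigma> t \<in> N.T" using t \<sigma>_T by auto
    have "(\<Prod>C'\<in>{C' \<in> ?CM. C' \<subseteq> C}. \<Prod>v\<in>M.above C'. gcd d (mark M v))
        = card {b \<in> M.dominated t. annihilates M d b}"
      using M.card_annihilated_dominated[OF t(1)] t(2) by simp
    also have "\<dots> = card {b \<in> N.dominated (\<sigma> t). annihilates N d b}"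
    proof (rule bij_betw_same_card[of \<sigma>], rule bij_betw_imageI)
      show "inj_on \<sigma> {b \<in> M.dominated t. annihilates M d b}"
        by (rule inj_on_subset[OF \<sigma>_T(2)]) (use M.dominated_subset in auto)
      show "\<sigma> ` {b \<in> M.dominated t. annihilates M d b} = {b \<in> N.dominated (\<sigma> t). annihilates N d b}"
      proof -
        have "annihilates N d (\<sigma> b) \<longleftrightarrow> annihilates M d b" if "b \<in> M.dominated t" for b
          using subsetD[OF M.dominated_subset that] ann by simp
        then show ?thesis unfolding \<sigma>_dom[OF t(1), symmetric] by auto
      qed
    qed
    also have "\<dots> = (\<Prod>C'\<in>{C' \<in> ?CN. C' \<subseteq> \<sigma> ` C}. \<Prod>w\<in>N.above C'. gcd d (mark N w))"
      using N.card_annihilated_dominated[OF \<sigma>t] \<sigma>_dom[OF t(1)] t(2) by simp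
    also have "{C' \<in> ?CN. C' \<subseteq> \<sigma> ` C} = image \<sigma> ` {C' \<in> ?CM. C' \<subseteq> C}"
    proof -
      have "\<sigma> ` C' \<subseteq> \<sigma> ` C \<longleftrightarrow> C' \<subseteq> C" if "C' \<in> ?CM" for C'
        using \<sigma>_sub CM_sub that \<open>C \<in> ?CM\<close> by simp
      then show ?thesis unfolding CN by auto
    qed
    also have "(\<Prod>C'\<in>image \<sigma> ` {C' \<in> ?CM. C' \<subseteq> C}. \<Prod>w\<in>N.above C'. gcd d (mark N w))
        = (\<Prod>C'\<in>{C' \<in> ?CM. C' \<subseteq> C}. \<Prod>w\<in>N.above (\<sigma> ` C'). gcd d (mark N w))"
    proof (subst prod.reindex)
      show "inj_on (image \<sigma>) {C' \<in> ?CM. C' \<subseteq> C}"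
      proof (rule inj_onI)
        fix X Y assume "X \<in> {C' \<in> ?CM. C' \<subseteq> C}" "Y \<in> {C' \<in> ?CM. C' \<subseteq> C}" "\<sigma> ` X = \<sigma> ` Y"
        then show "X = Y" using \<sigma>_inj CM_sub by simp
      qed
    qed simp
    finally show "(\<Prod>C'\<in>{C' \<in> ?CM. C' \<subseteq> C}. \<Prod>v\<in>M.above C'. gcd d (mark M v))
        = (\<Prod>C'\<in>{C' \<in> ?CM. C' \<subseteq> C}. \<Prod>w\<in>N.above (\<sigma> ` C'). gcd d (mark N w))" .
  qed
  \<comment> \<open>Vertices are coloured by dominated set, transported to \<open>N\<close>, and
    mark; equally many vertices of each colour give the bijection \<open>h\<close>.\<close>
  define f where "f v = (\<sigma> ` M.dominated (M.unit v), mark M v)" for v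
  define g where "g w = (N.dominated (N.unit w), mark N w)" for w
  have "card {v \<in> verts M. f v = k} = card {w \<in> verts N. g w = k}" for k
  proof -
    obtain X r where k: "k = (X, r)" by force
    show ?thesis
    proof (cases "X \<in> ?CN")
      case True
      then obtain C where C: "C \<in> ?CM" "X = \<sigma> ` C" using CN by auto
      have "{v \<in> verts M. f v = k} = {v \<in> M.above C. mark M v = r}"
        using \<sigma>_inj[OF M.dominated_subset CM_sub[OF C(1)]] by (auto simp: f_def k C(2) M.above_def)
      moreover have "{w \<in> verts N. g w = k} = {w \<in> N.above X. mark N w = r}"
        by (auto simp: g_def k N.above_def)
      moreover have "card {v \<in> M.above C. mark M v = r} = card {w \<in> N.above X. mark N w = r}"
        using M.finite_V N.finite_V M.marks N.marks gcds[OF C(1)] unfolding C(2)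
        by (intro prime_power_counts_eq) (auto simp: M.above_def N.above_def)
      ultimately show ?thesis by simp
    next
      case False
      have "f v \<noteq> k" if "v \<in> verts M" for v
        using False M.unit_T[OF that] CN by (auto simp: f_def k)
      moreover have "g w \<noteq> k" if "w \<in> verts N" for w
        using False N.unit_T[OF that] by (auto simp: g_def k)
      ultimately have "{v \<in> verts M. f v = k} = {}" "{w \<in> verts N. g w = k} = {}" by auto
      then show ?thesis by (simp only: card.empty)
    qed
  qed
  from bij_betw_of_fibre_cards[OF M.finite_V N.finite_V this]
  obtain h where h: "bij_betw h (verts M) (verts N)" "\<And>v. v \<in> verts M \<Longrightarrow> g (h v) = f v"
    by blast
  have hV: "h v \<in> verts N" if "v \<in> verts M" for v using h(1) that by (auto simp: bij_betw_def)
  have "(v, w) \<in> edges M \<longleftrightarrow> (h v, h w) \<in> edges N" if vw: "v \<in> verts M" "w \<in> verts M" for v w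
  proof (cases "v = w")
    case True
    then show ?thesis using M.simple N.simple by (auto simp: simple_graph_def irrefl_def)
  next
    case False
    then have "h v \<noteq> h w" using h(1) vw by (auto simp: bij_betw_def inj_on_def)
    then have "(h v, h w) \<in> edges N \<longleftrightarrow>
        (\<forall>a\<in>\<sigma> ` M.dominated (M.unit v). \<forall>b\<in>\<sigma> ` M.dominated (M.unit w). N.compat a b)"
      using N.edge_iff_dominated[OF hV hV] vw h(2) by (simp add: f_def g_def)
    also have "\<dots> \<longleftrightarrow> (\<forall>a\<in>M.dominated (M.unit v). \<forall>b\<in>M.dominated (M.unit w). M.compat a b)"
    proof -
      have "N.compat (\<sigma> a) (\<sigma> b) \<longleftrightarrow> M.compat a b"
        if "a \<in> M.dominated (M.unit v)" "b \<in> M.dominated (M.unit w)" for a b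
        using that subsetD[OF M.dominated_subset] compat[of a b] by simp
      then show ?thesis by simp
    qed
    also have "\<dots> \<longleftrightarrow> (v, w) \<in> edges M" using M.edge_iff_dominated[OF vw False] by simp
    finally show ?thesis by simp
  qed
  moreover have "mark N (h v) = mark M v" if "v \<in> verts M" for v
    using h(2)[OF that] by (simp add: f_def g_def)
  ultimately show ?thesis using h(1) unfolding marked_graph_iso_def by (intro exI[of _ h]) simp
qed

lemma marked_marked_graph_of:
  assumes graph: "simple_graph V E" and dec: "\<And>i. i \<in> V \<Longrightarrow> primary_decomposition (A i) (P i)"
  shows "marked (marked_graph_of V E P)"
proof
  show "simple_graph (verts (marked_graph_of V E P)) (edges (marked_graph_of V E P))"
    using graph by (rule simple_graph_marked_graph_of)
  fix u assume "u \<in> verts (marked_graph_of V E P)"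
  then obtain i k where "u = (i, k)" "i \<in> V" "k < length (P i)"
    by (auto simp: marked_graph_of_simps)
  then show "primepow (mark (marked_graph_of V E P) u)"
    using dec[of i] by (simp add: marked_graph_of_simps primary_decomposition_def)
qed

lemma exists_forall_equivalent_iso:
  fixes G :: "'a monoid" and G' :: "'b monoid" and H :: "'c monoid" and H' :: "'d monoid"
  assumes "group G" "group G'" "group H" "group H'" "G \<cong> G'" "H \<cong> H'"
    and "exists_forall_equivalent G H"
  shows "exists_forall_equivalent G' H'"
  using assms satisfies_iso[of G G'] satisfies_iso[of H H']
  by (simp add: exists_forall_equivalent_def)

theorem theorem2p3:
  fixes V :: "'v set" and E :: "('v \<times> 'v) set" and A :: "'v \<Rightarrow> 'a monoid"
    and P :: "'v \<Rightarrow> nat list"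
    and W :: "'w set" and F :: "('w \<times> 'w) set" and B :: "'w \<Rightarrow> 'b monoid"
    and Q :: "'w \<Rightarrow> nat list"
  assumes "simple_graph V E"
    and "\<And>i. i \<in> V \<Longrightarrow> comm_group (A i) \<and> finite (carrier (A i))"
    and "\<And>i. i \<in> V \<Longrightarrow> primary_decomposition (A i) (P i)"
    and "simple_graph W F"
    and "\<And>j. j \<in> W \<Longrightarrow> comm_group (B j) \<and> finite (carrier (B j))"
    and "\<And>j. j \<in> W \<Longrightarrow> primary_decomposition (B j) (Q j)"
  shows "(marked_graph_iso (marked_graph_of V E P) (marked_graph_of W F Q)
            \<longleftrightarrow> graph_product V E A \<cong> graph_product W F B)
       \<and> (graph_product V E A \<cong> graph_product W F B
            \<longleftrightarrow> elementarily_equivalent (graph_product V E A) (graph_product W F B))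
       \<and> (elementarily_equivalent (graph_product V E A) (graph_product W F B)
            \<longleftrightarrow> exists_forall_equivalent (graph_product V E A) (graph_product W F B))"
proof -
  define G where "G = graph_product V E A"
  define H where "H = graph_product W F B"
  define M where "M = marked_graph_of V E P"
  define N where "N = marked_graph_of W F Q"
  note defs = G_def[symmetric] H_def[symmetric] M_def[symmetric] N_def[symmetric]
  interpret G: graph_prod V E A
    using assms by (intro graph_prod.intro) (auto simp: comm_group.axioms(2))
  interpret H: graph_prod W F B
    using assms by (intro graph_prod.intro) (auto simp: comm_group.axioms(2))
  have M: "marked M" and N: "marked N"
    unfolding M_def N_def using assms marked_marked_graph_of by blast+
  interpret M: cyclic_graph_prod M
    using M marked.simple[OF M] marked.mark_gt_0[OF M] by (intro cyclic_graph_prod.intro)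
  interpret N: cyclic_graph_prod N
    using N marked.simple[OF N] marked.mark_gt_0[OF N] by (intro cyclic_graph_prod.intro)
  have groups: "group G" "group H" "group (cyclic_product M)" "group (cyclic_product N)"
    unfolding G_def H_def
    by (rule G.GP.is_group H.GP.is_group M.GP.is_group N.GP.is_group)+
  have GM: "G \<cong> cyclic_product M"
    unfolding G_def M_def using assms by (intro graph_product_iso_cyclic_product) auto
  have HN: "H \<cong> cyclic_product N"
    unfolding H_def N_def using assms by (intro graph_product_iso_cyclic_product) auto
  have "G \<cong> H" if "marked_graph_iso M N"
  proof -
    note GM
    also have "cyclic_product M \<cong> cyclic_product N"
      using M.simple N.simple that by (rule cyclic_product_iso)
    also have "cyclic_product N \<cong> H"
      using groups(2) HN by (rule group.iso_sym)
    finally show ?thesis .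
  qed
  moreover have "elementarily_equivalent G H" if "G \<cong> H"
    using satisfies_iso[OF groups(1,2) that] by (simp add: elementarily_equivalent_def)
  moreover have "exists_forall_equivalent G H" if "elementarily_equivalent G H"
    using that
    by (simp add: elementarily_equivalent_def exists_forall_equivalent_def exists_forall_sentence_def)
  moreover have "marked_graph_iso M N" if "exists_forall_equivalent G H"
  proof -
    \<comment> \<open>The classes are described by vectors for cyclic vertex groups, so the
      equivalence is first moved to the cyclic products.\<close>
    have "exists_forall_equivalent (cyclic_product M) (cyclic_product N)"
      using groups(1,3,2,4) GM HN that by (rule exists_forall_equivalent_iso)
    then show ?thesis
      using clique_vectors_transfer[OF M.cyclic_graph_prod_axioms N.cyclic_graph_prod_axioms]
        marked_graph_iso_of_clique_vectors[OF M N] by metis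
  qed
  ultimately show ?thesis unfolding defs by blast
qed

end
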